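(* In the nonparametric instrumental variable model, assume $g_0$ is point identified, i.e. $\Theta_I=\{g_0\}$. Under Assumptions N1--N6 (listed in the context), suppose the normal prior $\pi(b)=\prod_{i=1}^{q_n}\pi_i(b_i)$, $\pi_i$ the $N(0,\sigma^2)$ density with a constant $\sigma^2>0$ not depending on $n$, is used, and $$q_n\Bigl(\frac{k_n^{3d/2}}{\sqrt n}+\frac1{k_n}\Bigr)^{1/3}=o(\varphi(\eta_{q_n}^2)).$$ Then for any $\varepsilon>0$, $$P(\|g_b-g_0\|_s>\varepsilon\mid X^n)=o_p(1).$$
   Context: Model: $Y=g_0(X)+\epsilon$ with $E(\epsilon\mid W)=0$, $W\in[0,1]^d$ ($d$ fixed), $X$ possibly correlated with $\epsilon$. $\mathcal H=L^2(X)=\{g:E[g(X)^2]<\infty\}$, $\langle g_1,g_2\rangle_X=E[g_1(X)g_2(X)]$, $\|g\|_s^2=E[g(X)^2]$. $G(g)=E_W\{[E(Y-g(X)\mid W)]^2\}$; $\Theta_I=\{g\in L^2(X):G(g)=0\}$. $\|g\|_w^2=E_W\{(E(g(X)\mid W))^2\}$. Sieve: $\phi_1,\phi_2,\ldots$ orthonormal basis functions of $L^2(X)$, integers $q_n\to\infty$, $\mathcal H_n=\mathrm{span}\{\phi_1,\ldots,\phi_{q_n}\}$, $g_b=\sum_{i=1}^{q_n}b_i\phi_i$, $b\in\mathbb R^{q_n}$. Posterior: data $X^n=\{(Y_i,X_i,W_i)\}_{i=1}^n$. For integers $k_n\to\infty$, $[0,1]^d$ is partitioned into the $k_n^d$ cubes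 $R^n_j$ of the form $\prod_{l=1}^d[\frac{i_l-1}{k_n},\frac{i_l}{k_n}]$, $i_l\in\{1,\ldots,k_n\}$. $\hat v_j=\frac1n\sum_iI_{(W_i\in R_j^n)}$ and $\bar G(g)=\sum_{j=1}^{k_n^d}\bigl(\frac1n\sum_{i=1}^n(Y_i-g(X_i))I_{(W_i\in R_j^n)}\bigr)^2\hat v_j^{-1}$ (terms with $\hat v_j=0$ read as $0$). The quasi-posterior is $P(g_b\mid X^n)\propto\pi(b)\exp(-\frac n2\bar G(g_b))$. Assumptions: N1: the data are i.i.d. N2: $k_n^{-d}=O(\min_{j\le k_n^d}P(W\in R_j^n))$ and $\max_{j\le k_n^d}P(W\in R_j^n)=O(k_n^{-d})$. N3: there is $C>0$ such that for all $i=1,\ldots,q_n$: (i) $\sup_wE(Y^2\mid W=w)<C$, $\sup_wE(\phi_i(X)^2\mid W=w)<C$; (ii) $w\mapsto E(Y\mid W=w)$ is Lipschitz on $[0,1]^d$; (iii) $|E(\phi_i(X)\mid W=w_1)-E(\phi_i(X)\mid W=w_2)|\le C\|w_1-w_2\|$ for all $w_1,w_2\in[0,1]^d$. N4: there exist $g_0\in\Theta_I$, $g^*_{q_n}=\sum_{i=1}^{q_n}b_i^*\phi_i$ with $\sum_{i=1}^\infty b_i^{*2}<\infty$, and a positive sequence $\{\eta_j\}_{j\ge1}$ strictly decreasing to zero such that $\|g^*_{q_n}-g_0\|_s=O(\eta_{q_n})$ as $q_n\to\infty$ ($g^*_{q_n}$ is chosen to be the projection of $g_0$ onto $\mathcal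 H_n$). N5: the joint distribution of $(Y,X,W)$ is absolutely continuous with respect to Lebesgue measure and, with $f_{XW},f_X,f_W$ the densities of $(X,W)$, $X$, $W$, $\iint\bigl(\frac{f_{XW}(x,w)}{f_X(x)f_W(w)}\bigr)^2f_X(x)f_W(w)\,dx\,dw<\infty$. N6: there is a continuous increasing function $\varphi(\cdot)>0$ with $\lim_{t\to0^+}\varphi(t)=0$ such that, for $\{g_0,g^*_{q_n},\{\eta_j\}\}$ as in N4 and some constants $C_1,C_2>0$: (i) $\|g-g_0\|_w^2\ge C_1\sum_{j=1}^\infty\varphi(\eta_j^2)|\langle g-g_0,\phi_j\rangle_X|^2$ for all $g\in L^2(X)$; (ii) $\|g^*_{q_n}-g_0\|_w^2\le C_2\sum_j\varphi(\eta_j^2)|\langle g_0-g^*_{q_n},\phi_j\rangle_X|^2$. *)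

theory Defs
  imports "HOL-Probability.Probability" "HOL-Library.Landau_Symbols"
begin

text \<open>
  Throughout, \<open>M\<close> is the underlying probability space, \<open>(Y, X, W)\<close> a generic observation carrying the
  population law, and \<open>(Ys i, Xs i, Ws i)\<close>, \<open>i \<ge> 1\<close>, the data. The dimension \<open>d\<close> of the instrument
  is \<open>CARD('d)\<close>.
\<close>

subsection \<open>The model and its population quantities\<close>

definition cexp :: "'a measure \<Rightarrow> ('a \<Rightarrow> 'w::topological_space) \<Rightarrow> ('a \<Rightarrow> real) \<Rightarrow> 'a \<Rightarrow> real" where
  "cexp M W Z = real_cond_exp M (vimage_algebra (space M) W borel) Z"

text \<open>
  \<open>h\<close> is a version of \<open>w \<mapsto> E(Z | W = w)\<close>. Integrability of \<open>Z\<close> is part of the notion, since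
  \<^const>\<open>real_cond_exp\<close> takes arbitrary values on non-integrable functions.
\<close>
definition cond_mean_version ::
    "'a measure \<Rightarrow> ('a \<Rightarrow> 'w::topological_space) \<Rightarrow> ('a \<Rightarrow> real) \<Rightarrow> ('w \<Rightarrow> real) \<Rightarrow> bool" where
  "cond_mean_version M W Z h \<longleftrightarrow>
     integrable M Z \<and> h \<in> borel_measurable borel \<and> (AE \<omega> in M. cexp M W Z \<omega> = h (W \<omega>))"

text \<open>Elements of \<open>L\<^sup>2(X)\<close> are represented by functions; equality of elements is almost sure equality
  of \<open>g(X)\<close>.\<close>
definition L2_of :: "'a measure \<Rightarrow> ('a \<Rightarrow> 'x::topological_space) \<Rightarrow> ('x \<Rightarrow> real) set" where
  "L2_of M X = {g \<in> borel_measurable borel. integrable M (\<lambda>\<omega>. (g (X \<omega>))\<^sup>2)}"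

definition inner_X :: "'a measure \<Rightarrow> ('a \<Rightarrow> 'x) \<Rightarrow> ('x \<Rightarrow> real) \<Rightarrow> ('x \<Rightarrow> real) \<Rightarrow> real" where
  "inner_X M X g1 g2 = (\<integral>\<omega>. g1 (X \<omega>) * g2 (X \<omega>) \<partial>M)"

definition norm_s :: "'a measure \<Rightarrow> ('a \<Rightarrow> 'x) \<Rightarrow> ('x \<Rightarrow> real) \<Rightarrow> real" where
  "norm_s M X g = sqrt (\<integral>\<omega>. (g (X \<omega>))\<^sup>2 \<partial>M)"

definition norm_w ::
    "'a measure \<Rightarrow> ('a \<Rightarrow> 'x) \<Rightarrow> ('a \<Rightarrow> 'w::topological_space) \<Rightarrow> ('x \<Rightarrow> real) \<Rightarrow> real" where
  "norm_w M X W g = sqrt (\<integral>\<omega>. (cexp M W (\<lambda>\<omega>. g (X \<omega>)) \<omega>)\<^sup>2 \<partial>M)"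

definition G_crit ::
    "'a measure \<Rightarrow> ('a \<Rightarrow> real) \<Rightarrow> ('a \<Rightarrow> 'x) \<Rightarrow> ('a \<Rightarrow> 'w::topological_space) \<Rightarrow> ('x \<Rightarrow> real) \<Rightarrow> real" where
  "G_crit M Y X W g = (\<integral>\<omega>. (cexp M W (\<lambda>\<omega>. Y \<omega> - g (X \<omega>)) \<omega>)\<^sup>2 \<partial>M)"

definition Theta_I ::
    "'a measure \<Rightarrow> ('a \<Rightarrow> real) \<Rightarrow> ('a \<Rightarrow> 'x::topological_space) \<Rightarrow> ('a \<Rightarrow> 'w::topological_space)
      \<Rightarrow> ('x \<Rightarrow> real) set" where
  "Theta_I M Y X W = {g \<in> L2_of M X. G_crit M Y X W g = 0}"

text \<open>\<open>\<Theta>\<^sub>I = {g\<^sub>0}\<close> as a statement about elements of \<open>L\<^sup>2(X)\<close>.\<close>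
definition point_identified ::
    "'a measure \<Rightarrow> ('a \<Rightarrow> real) \<Rightarrow> ('a \<Rightarrow> 'x::topological_space) \<Rightarrow> ('a \<Rightarrow> 'w::topological_space)
      \<Rightarrow> ('x \<Rightarrow> real) \<Rightarrow> bool" where
  "point_identified M Y X W g0 \<longleftrightarrow>
     g0 \<in> Theta_I M Y X W \<and> (\<forall>g \<in> Theta_I M Y X W. AE \<omega> in M. g (X \<omega>) = g0 (X \<omega>))"

definition NPIV_model ::
    "'a measure \<Rightarrow> ('a \<Rightarrow> real) \<Rightarrow> ('a \<Rightarrow> 'x::euclidean_space) \<Rightarrow> ('a \<Rightarrow> real ^ 'd) \<Rightarrow> ('x \<Rightarrow> real)
      \<Rightarrow> ('a \<Rightarrow> real) \<Rightarrow> bool" where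
  "NPIV_model M Y X W g0 eps \<longleftrightarrow>
     Y \<in> borel_measurable M \<and> X \<in> borel_measurable M \<and> W \<in> borel_measurable M \<and>
     (\<forall>\<omega>\<in>space M. W \<omega> \<in> cbox 0 1) \<and>
     (\<forall>\<omega>\<in>space M. Y \<omega> = g0 (X \<omega>) + eps \<omega>) \<and>
     integrable M eps \<and> (AE \<omega> in M. cexp M W eps \<omega> = 0)"

subsection \<open>Sieve, partition and quasi-posterior\<close>

text \<open>Basis functions are indexed from \<open>1\<close>; the value \<open>\<phi> 0\<close> is never used.\<close>
definition sieve_fun :: "(nat \<Rightarrow> 'x \<Rightarrow> real) \<Rightarrow> nat \<Rightarrow> (nat \<Rightarrow> real) \<Rightarrow> 'x \<Rightarrow> real" where
  "sieve_fun \<phi> q b = (\<lambda>x. \<Sum>i=1..q. b i * \<phi> i x)"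

definition orthonormal_basis_L2 ::
    "'a measure \<Rightarrow> ('a \<Rightarrow> 'x::topological_space) \<Rightarrow> (nat \<Rightarrow> 'x \<Rightarrow> real) \<Rightarrow> bool" where
  "orthonormal_basis_L2 M X \<phi> \<longleftrightarrow>
     (\<forall>i\<ge>1. \<phi> i \<in> L2_of M X) \<and>
     (\<forall>i\<ge>1. \<forall>j\<ge>1. inner_X M X (\<phi> i) (\<phi> j) = (if i = j then 1 else 0)) \<and>
     (\<forall>g \<in> L2_of M X.
        (\<lambda>m. norm_s M X (\<lambda>x. g x - sieve_fun \<phi> m (\<lambda>i. inner_X M X g (\<phi> i)) x)) \<longlonglongrightarrow> 0)"

definition cell_indices :: "nat \<Rightarrow> ('d \<Rightarrow> nat) set" where
  "cell_indices k = {j. \<forall>l. j l \<in> {1..k}}"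

definition cell :: "nat \<Rightarrow> ('d::finite \<Rightarrow> nat) \<Rightarrow> (real ^ 'd) set" where
  "cell k j = cbox (\<chi> l. (real (j l) - 1) / real k) (\<chi> l. real (j l) / real k)"

definition v_hat :: "(nat \<Rightarrow> 'a \<Rightarrow> real ^ 'd) \<Rightarrow> nat \<Rightarrow> nat \<Rightarrow> ('d::finite \<Rightarrow> nat) \<Rightarrow> 'a \<Rightarrow> real" where
  "v_hat Ws n k j \<omega> = (1 / real n) * (\<Sum>i=1..n. indicator (cell k j) (Ws i \<omega>))"

text \<open>Cells with \<open>v_hat = 0\<close> contribute \<open>0\<close>, because division by zero yields zero.\<close>
definition G_bar ::
    "(nat \<Rightarrow> 'a \<Rightarrow> real) \<Rightarrow> (nat \<Rightarrow> 'a \<Rightarrow> 'x) \<Rightarrow> (nat \<Rightarrow> 'a \<Rightarrow> real ^ 'd::finite)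
      \<Rightarrow> nat \<Rightarrow> nat \<Rightarrow> ('x \<Rightarrow> real) \<Rightarrow> 'a \<Rightarrow> real" where
  "G_bar Ys Xs Ws n k g \<omega> =
     (\<Sum>j\<in>cell_indices k.
        ((1 / real n) * (\<Sum>i=1..n. (Ys i \<omega> - g (Xs i \<omega>)) * indicator (cell k j) (Ws i \<omega>)))\<^sup>2
          / v_hat Ws n k j \<omega>)"

text \<open>The coefficient space \<open>\<real>\<^sup>q\<close> is the space of extensional functions on \<open>{1..q}\<close> with Lebesgue
  measure.\<close>
definition coef_lebesgue :: "nat \<Rightarrow> (nat \<Rightarrow> real) measure" where
  "coef_lebesgue q = (\<Pi>\<^sub>M i\<in>{1..q}. lborel)"

text \<open>Here \<open>\<sigma>\<close> is the standard deviation, as in \<^const>\<open>normal_density\<close>.\<close>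
definition normal_prior :: "real \<Rightarrow> nat \<Rightarrow> (nat \<Rightarrow> real) \<Rightarrow> real" where
  "normal_prior \<sigma> q b = (\<Prod>i=1..q. normal_density 0 \<sigma> (b i))"

definition quasi_lik ::
    "(nat \<Rightarrow> 'a \<Rightarrow> real) \<Rightarrow> (nat \<Rightarrow> 'a \<Rightarrow> 'x) \<Rightarrow> (nat \<Rightarrow> 'a \<Rightarrow> real ^ 'd::finite)
      \<Rightarrow> (nat \<Rightarrow> 'x \<Rightarrow> real) \<Rightarrow> nat \<Rightarrow> nat \<Rightarrow> nat \<Rightarrow> 'a \<Rightarrow> (nat \<Rightarrow> real) \<Rightarrow> real" where
  "quasi_lik Ys Xs Ws \<phi> n k q \<omega> b = exp (- (real n / 2) * G_bar Ys Xs Ws n k (sieve_fun \<phi> q b) \<omega>)"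

definition quasi_posterior ::
    "(nat \<Rightarrow> 'a \<Rightarrow> real) \<Rightarrow> (nat \<Rightarrow> 'a \<Rightarrow> 'x) \<Rightarrow> (nat \<Rightarrow> 'a \<Rightarrow> real ^ 'd::finite)
      \<Rightarrow> (nat \<Rightarrow> 'x \<Rightarrow> real) \<Rightarrow> ((nat \<Rightarrow> real) \<Rightarrow> real) \<Rightarrow> nat \<Rightarrow> nat \<Rightarrow> nat \<Rightarrow> 'a
      \<Rightarrow> (nat \<Rightarrow> real) measure" where
  "quasi_posterior Ys Xs Ws \<phi> pr n k q \<omega> =
     density (coef_lebesgue q)
       (\<lambda>b. ennreal (pr b * quasi_lik Ys Xs Ws \<phi> n k q \<omega> b /
              (\<integral>b'. pr b' * quasi_lik Ys Xs Ws \<phi> n k q \<omega> b' \<partial>coef_lebesgue q)))"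

definition posterior_prob ::
    "(nat \<Rightarrow> 'a \<Rightarrow> real) \<Rightarrow> (nat \<Rightarrow> 'a \<Rightarrow> 'x) \<Rightarrow> (nat \<Rightarrow> 'a \<Rightarrow> real ^ 'd::finite)
      \<Rightarrow> (nat \<Rightarrow> 'x \<Rightarrow> real) \<Rightarrow> ((nat \<Rightarrow> real) \<Rightarrow> real) \<Rightarrow> nat \<Rightarrow> nat \<Rightarrow> nat
      \<Rightarrow> (('x \<Rightarrow> real) \<Rightarrow> bool) \<Rightarrow> 'a \<Rightarrow> real" where
  "posterior_prob Ys Xs Ws \<phi> pr n k q P \<omega> =
     measure (quasi_posterior Ys Xs Ws \<phi> pr n k q \<omega>)
       {b \<in> space (coef_lebesgue q). P (sieve_fun \<phi> q b)}"

definition little_o_p_one :: "'a measure \<Rightarrow> (nat \<Rightarrow> 'a \<Rightarrow> real) \<Rightarrow> bool" where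
  "little_o_p_one M Z \<longleftrightarrow>
     (\<forall>n. Z n \<in> borel_measurable M) \<and>
     (\<forall>\<delta>>0. (\<lambda>n. measure M {\<omega> \<in> space M. \<bar>Z n \<omega>\<bar> > \<delta>}) \<longlonglongrightarrow> 0)"

subsection \<open>Assumptions\<close>

definition N1 ::
    "'a measure \<Rightarrow> ('a \<Rightarrow> real) \<Rightarrow> ('a \<Rightarrow> 'x::euclidean_space) \<Rightarrow> ('a \<Rightarrow> real ^ 'd)
      \<Rightarrow> (nat \<Rightarrow> 'a \<Rightarrow> real) \<Rightarrow> (nat \<Rightarrow> 'a \<Rightarrow> 'x) \<Rightarrow> (nat \<Rightarrow> 'a \<Rightarrow> real ^ 'd) \<Rightarrow> bool" where
  "N1 M Y X W Ys Xs Ws \<longleftrightarrow>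
     prob_space.indep_vars M (\<lambda>_. borel) (\<lambda>i \<omega>. (Ys i \<omega>, Xs i \<omega>, Ws i \<omega>)) {1..} \<and>
     (\<forall>i\<ge>1. distr M borel (\<lambda>\<omega>. (Ys i \<omega>, Xs i \<omega>, Ws i \<omega>)) = distr M borel (\<lambda>\<omega>. (Y \<omega>, X \<omega>, W \<omega>)))"

definition N2 :: "'a measure \<Rightarrow> ('a \<Rightarrow> real ^ 'd::finite) \<Rightarrow> (nat \<Rightarrow> nat) \<Rightarrow> bool" where
  "N2 M W k \<longleftrightarrow>
     (\<lambda>n. 1 / real (k n) ^ CARD('d))
       \<in> O(\<lambda>n. Min ((\<lambda>j. measure M {\<omega> \<in> space M. W \<omega> \<in> cell (k n) j}) ` cell_indices (k n))) \<and>
     (\<lambda>n. Max ((\<lambda>j. measure M {\<omega> \<in> space M. W \<omega> \<in> cell (k n) j}) ` cell_indices (k n)))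
       \<in> O(\<lambda>n. 1 / real (k n) ^ CARD('d))"

definition cond_mean_sup_less ::
    "'a measure \<Rightarrow> ('a \<Rightarrow> real ^ 'd::finite) \<Rightarrow> ('a \<Rightarrow> real) \<Rightarrow> real \<Rightarrow> bool" where
  "cond_mean_sup_less M W Z C \<longleftrightarrow>
     (\<exists>h. cond_mean_version M W Z h \<and> bdd_above (h ` cbox 0 1) \<and> (SUP w\<in>cbox 0 1. h w) < C)"

definition N3 ::
    "'a measure \<Rightarrow> ('a \<Rightarrow> real) \<Rightarrow> ('a \<Rightarrow> 'x) \<Rightarrow> ('a \<Rightarrow> real ^ 'd::finite)
      \<Rightarrow> (nat \<Rightarrow> 'x \<Rightarrow> real) \<Rightarrow> (nat \<Rightarrow> nat) \<Rightarrow> bool" where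
  "N3 M Y X W \<phi> q \<longleftrightarrow>
     (\<exists>C>0.
        cond_mean_sup_less M W (\<lambda>\<omega>. (Y \<omega>)\<^sup>2) C \<and>
        (\<exists>h. cond_mean_version M W Y h \<and> (\<exists>L. L-lipschitz_on (cbox 0 1) h)) \<and>
        (\<forall>n. \<forall>i\<in>{1..q n}.
           cond_mean_sup_less M W (\<lambda>\<omega>. (\<phi> i (X \<omega>))\<^sup>2) C \<and>
           (\<exists>h. cond_mean_version M W (\<lambda>\<omega>. \<phi> i (X \<omega>)) h \<and>
                (\<forall>w1\<in>cbox 0 1. \<forall>w2\<in>cbox 0 1. \<bar>h w1 - h w2\<bar> \<le> C * norm (w1 - w2)))))"

definition N4 ::
    "'a measure \<Rightarrow> ('a \<Rightarrow> real) \<Rightarrow> ('a \<Rightarrow> 'x::topological_space) \<Rightarrow> ('a \<Rightarrow> 'w::topological_space)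
      \<Rightarrow> (nat \<Rightarrow> 'x \<Rightarrow> real) \<Rightarrow> (nat \<Rightarrow> nat) \<Rightarrow> ('x \<Rightarrow> real) \<Rightarrow> (nat \<Rightarrow> real) \<Rightarrow> (nat \<Rightarrow> real) \<Rightarrow> bool" where
  "N4 M Y X W \<phi> q g0 bstar \<eta> \<longleftrightarrow>
     g0 \<in> Theta_I M Y X W \<and>
     summable (\<lambda>i. (bstar (Suc i))\<^sup>2) \<and>
     (\<forall>n. \<forall>b. inner_X M X (\<lambda>x. g0 x - sieve_fun \<phi> (q n) bstar x) (sieve_fun \<phi> (q n) b) = 0) \<and>
     (\<forall>j\<ge>1. \<eta> j > 0) \<and> strict_antimono_on {1..} \<eta> \<and> \<eta> \<longlonglongrightarrow> 0 \<and>
     (\<lambda>n. norm_s M X (\<lambda>x. sieve_fun \<phi> (q n) bstar x - g0 x)) \<in> O(\<lambda>n. \<eta> (q n))"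

definition N5 ::
    "'a measure \<Rightarrow> ('a \<Rightarrow> real) \<Rightarrow> ('a \<Rightarrow> 'x::euclidean_space) \<Rightarrow> ('a \<Rightarrow> 'w::euclidean_space) \<Rightarrow> bool" where
  "N5 M Y X W \<longleftrightarrow>
     absolutely_continuous lborel (distr M borel (\<lambda>\<omega>. (Y \<omega>, X \<omega>, W \<omega>))) \<and>
     (\<exists>fXW fX fW.
        distributed M lborel (\<lambda>\<omega>. (X \<omega>, W \<omega>)) (\<lambda>z. ennreal (fXW z)) \<and> (\<forall>z. fXW z \<ge> 0) \<and>
        distributed M lborel X (\<lambda>x. ennreal (fX x)) \<and> (\<forall>x. fX x \<ge> 0) \<and>
        distributed M lborel W (\<lambda>w. ennreal (fW w)) \<and> (\<forall>w. fW w \<ge> 0) \<and>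
        (\<integral>\<^sup>+x. \<integral>\<^sup>+w. ennreal ((fXW (x, w) / (fX x * fW w))\<^sup>2 * fX x * fW w) \<partial>lborel \<partial>lborel) < \<infinity>)"

text \<open>The series range over \<open>j \<ge> 1\<close> and converge, as \<open>vphi\<close> is increasing, \<open>\<eta>\<close> is decreasing and
  Bessel's inequality applies.\<close>
definition N6 ::
    "'a measure \<Rightarrow> ('a \<Rightarrow> 'x::topological_space) \<Rightarrow> ('a \<Rightarrow> 'w::topological_space)
      \<Rightarrow> (nat \<Rightarrow> 'x \<Rightarrow> real) \<Rightarrow> (nat \<Rightarrow> nat) \<Rightarrow> ('x \<Rightarrow> real) \<Rightarrow> (nat \<Rightarrow> real) \<Rightarrow> (nat \<Rightarrow> real)
      \<Rightarrow> (real \<Rightarrow> real) \<Rightarrow> bool" where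
  "N6 M X W \<phi> q g0 bstar \<eta> vphi \<longleftrightarrow>
     continuous_on {0<..} vphi \<and> mono_on {0<..} vphi \<and> (\<forall>t>0. vphi t > 0) \<and>
     (vphi \<longlongrightarrow> 0) (at_right 0) \<and>
     (\<exists>C1>0. \<forall>g \<in> L2_of M X.
        (norm_w M X W (\<lambda>x. g x - g0 x))\<^sup>2 \<ge>
          C1 * (\<Sum>i. vphi ((\<eta> (Suc i))\<^sup>2) * \<bar>inner_X M X (\<lambda>x. g x - g0 x) (\<phi> (Suc i))\<bar>\<^sup>2)) \<and>
     (\<exists>C2>0. \<forall>n.
        (norm_w M X W (\<lambda>x. sieve_fun \<phi> (q n) bstar x - g0 x))\<^sup>2 \<le>
          C2 * (\<Sum>i. vphi ((\<eta> (Suc i))\<^sup>2) *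
                 \<bar>inner_X M X (\<lambda>x. g0 x - sieve_fun \<phi> (q n) bstar x) (\<phi> (Suc i))\<bar>\<^sup>2))"

end

theory Submission
  imports Defs "HOL-Real_Asymp.Real_Asymp"
begin

text \<open>
  Write \<open>g\<^sub>b\<close> for the sieve function with coefficients \<open>b\<close>, let \<open>b\<^sup>*\<close> be the coefficients of the
  projection of \<open>g\<^sub>0\<close>, and put \<open>p = vphi (\<eta>\<^sub>q\<^sup>2)\<close> and \<open>\<delta> = k ^ (3 d / 2) / sqrt n + 1 / k\<close>, so that the
  rate condition reads \<open>q \<delta> ^ (1/3) = o(p)\<close>.

  The population criterion at \<open>b\<close> is the squared weak norm of \<open>g\<^sub>b - g\<^sub>0\<close> (\<open>norm_w_sieve_eq\<close>). The source
  condition bounds it from below by a multiple of \<open>p \<parallel>b - b\<^sup>*\<parallel>\<^sup>2\<close>, and at \<open>b\<^sup>*\<close> from above by a multiple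
  of \<open>p e\<^sup>2\<close>, where \<open>e\<close> is the strong norm of the approximation error and tends to zero
  (\<open>source_condition_bounds\<close>). A posterior draw at strong distance more than \<open>\<epsilon>\<close> from \<open>g\<^sub>0\<close> has
  \<open>\<parallel>b - b\<^sup>*\<parallel>\<^sup>2 \<ge> \<epsilon>\<^sup>2 / 4\<close> for large \<open>n\<close>, so that its population criterion is at least of order \<open>p\<close>,
  whereas close to \<open>b\<^sup>*\<close> the criterion is of smaller order than \<open>p\<close>.

  The empirical criterion inherits this gap. Both criteria are quadratic forms in the vector
  \<open>(1, - b)\<close>, and their difference is at most \<open>(q + 1) (1 + \<parallel>b\<parallel>\<^sup>2)\<close> times a random quantity that does not
  depend on \<open>b\<close>: the total relative deviation of the empirical cell means from their expectations,
  plus a discretisation error of order \<open>1 / k\<^sup>2\<close> (\<open>G_bar_approx\<close>, which rests on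
  \<open>ratio_perturbation\<close> and \<open>cell_criterion_approx\<close>). The expectation of the total deviation is
  \<open>O(q k ^ (3 d / 2) / sqrt n)\<close> (\<open>expectation_cell_dev_le\<close>). By Markov's inequality the difference of
  the criteria is \<open>o(p) (1 + \<parallel>b\<parallel>\<^sup>2)\<close> with probability tending to one, since
  \<open>q\<^sup>2 \<delta> \<le> (q \<delta> ^ (1/3)) ^ 3 = o(p)\<close>. The factor \<open>1 + \<parallel>b\<parallel>\<^sup>2\<close> is what makes the comparison usable on all of
  \<open>\<real>\<^sup>q\<close>: for \<open>b\<close> far from \<open>b\<^sup>*\<close> it is dominated by the lower bound \<open>p \<parallel>b - b\<^sup>*\<parallel>\<^sup>2\<close>.

  It remains to compare numerator and denominator of the posterior (\<open>quasi_posterior_set_le\<close>). The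
  numerator is at most \<open>exp (- n \<gamma> / 2)\<close> with \<open>\<gamma>\<close> of order \<open>p\<close>. The denominator is at least
  \<open>exp (- n \<gamma> / 4)\<close> times the prior mass of a cube of half-width \<open>p / q\<close> about \<open>b\<^sup>*\<close>, which is at least
  \<open>exp (- const * q\<^sup>2 / p)\<close>. As \<open>n p\<^sup>2\<close> grows faster than \<open>q\<^sup>2\<close>, the quotient tends to zero
  (\<open>contraction_factor_tendsto_0\<close>).
\<close>

section \<open>Means of independent variables and the partition into cubes\<close>

text \<open>
  Independence is used only through vanishing covariances: the second moment of the centred mean is
  at most \<open>s / n\<close>, and the first absolute moment is bounded by its root. First moments are all that
  is needed later, because the deviations enter linearly and are summed before Markov's inequality
  is applied.
\<close>
lemma (in prob_space) expectation_abs_mean_dev_le: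
  fixes T :: "nat \<Rightarrow> 'a \<Rightarrow> real"
  assumes ind: "indep_vars (\<lambda>_. borel) T {1..n}" and n: "n \<ge> 1"
    and sq: "\<And>i. i \<in> {1..n} \<Longrightarrow> integrable M (\<lambda>\<omega>. (T i \<omega>)\<^sup>2)"
    and mean: "\<And>i. i \<in> {1..n} \<Longrightarrow> expectation (T i) = c"
    and second: "\<And>i. i \<in> {1..n} \<Longrightarrow> expectation (\<lambda>\<omega>. (T i \<omega>)\<^sup>2) \<le> s"
  shows "integrable M (\<lambda>\<omega>. \<bar>1 / real n * (\<Sum>i=1..n. T i \<omega>) - c\<bar>)"
    and "expectation (\<lambda>\<omega>. \<bar>1 / real n * (\<Sum>i=1..n. T i \<omega>) - c\<bar>) \<le> sqrt (s / real n)"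
proof -
  have rv: "T i \<in> borel_measurable M" if "i \<in> {1..n}" for i
    using ind that by (auto simp: indep_vars_def)
  have int: "integrable M (T i)" if "i \<in> {1..n}" for i
    using square_integrable_imp_integrable[OF rv[OF that]] sq[OF that] by simp
  define U where "U = (\<lambda>i \<omega>. T i \<omega> - c)"
  have Uint: "integrable M (U i)" if "i \<in> {1..n}" for i
    using int[OF that] by (simp add: U_def)
  have Usq: "(\<lambda>\<omega>. U i \<omega> * U i \<omega>) = (\<lambda>\<omega>. (T i \<omega>)\<^sup>2 - 2 * c * T i \<omega> + c\<^sup>2)" for i
    by (simp add: U_def power2_eq_square algebra_simps fun_eq_iff)
  have Usqint: "integrable M (\<lambda>\<omega>. U i \<omega> * U i \<omega>)" if "i \<in> {1..n}" for i
    unfolding Usq using int[OF that] sq[OF that] by simp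
  have Usecond: "expectation (\<lambda>\<omega>. U i \<omega> * U i \<omega>) \<le> s" if "i \<in> {1..n}" for i
  proof -
    have "expectation (\<lambda>\<omega>. U i \<omega> * U i \<omega>) = expectation (\<lambda>\<omega>. (T i \<omega>)\<^sup>2) - 2 * c * expectation (T i) + c\<^sup>2"
      unfolding Usq using int[OF that] sq[OF that] by (simp add: prob_space)
    also have "\<dots> = expectation (\<lambda>\<omega>. (T i \<omega>)\<^sup>2) - c * c"
      using mean[OF that] by (simp add: power2_eq_square)
    also have "\<dots> \<le> s"
      using second[OF that] zero_le_square[of c] by linarith
    finally show ?thesis .
  qed
  have indU: "indep_vars (\<lambda>_. borel) U {1..n}"
    unfolding U_def by (rule indep_vars_compose2[OF ind, where Y="\<lambda>_ x. x - c"]) auto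
  have cross: "integrable M (\<lambda>\<omega>. U i \<omega> * U l \<omega>) \<and> expectation (\<lambda>\<omega>. U i \<omega> * U l \<omega>) = 0"
    if "i \<in> {1..n}" "l \<in> {1..n}" "i \<noteq> l" for i l
  proof -
    have ind2: "indep_vars (\<lambda>_. borel) U {i, l}"
      by (rule indep_vars_subset[OF indU]) (use that in auto)
    have "integrable M (\<lambda>\<omega>. \<Prod>m\<in>{i,l}. U m \<omega>)"
      by (rule indep_vars_integrable[OF _ ind2]) (use that Uint in auto)
    moreover have "expectation (\<lambda>\<omega>. \<Prod>m\<in>{i,l}. U m \<omega>) = (\<Prod>m\<in>{i,l}. expectation (U m))"
      by (rule indep_vars_lebesgue_integral[OF _ ind2]) (use that Uint in auto)
    moreover have "expectation (U i) = 0"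
      using mean[OF that(1)] int[OF that(1)] by (simp add: U_def prob_space)
    ultimately show ?thesis using that by simp
  qed
  define V where "V = (\<lambda>\<omega>. 1 / real n * (\<Sum>i=1..n. T i \<omega>) - c)"
  have V_eq: "V \<omega> = 1 / real n * (\<Sum>i=1..n. U i \<omega>)" for \<omega>
    using n by (simp add: V_def U_def sum_subtractf field_simps)
  have Vsq: "(V \<omega>)\<^sup>2 = 1 / (real n)\<^sup>2 * (\<Sum>i=1..n. \<Sum>l=1..n. U i \<omega> * U l \<omega>)" for \<omega>
    unfolding V_eq power_mult_distrib power2_eq_square[of "\<Sum>i=1..n. U i \<omega>"] sum_product
    by (simp add: power_one_over)
  have pint: "integrable M (\<lambda>\<omega>. U i \<omega> * U l \<omega>)" if "i \<in> {1..n}" "l \<in> {1..n}" for i l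
    using cross Usqint that by (cases "i = l") auto
  have Vsqint: "integrable M (\<lambda>\<omega>. (V \<omega>)\<^sup>2)"
    unfolding Vsq using pint by (intro integrable_mult_right Bochner_Integration.integrable_sum) auto
  have Vrv: "V \<in> borel_measurable M"
    unfolding V_def using rv by measurable
  have Vint: "integrable M V"
    using square_integrable_imp_integrable[OF Vrv] Vsqint by simp
  have "expectation (\<lambda>\<omega>. (V \<omega>)\<^sup>2) = 1 / (real n)\<^sup>2 * (\<Sum>i=1..n. \<Sum>l=1..n. expectation (\<lambda>\<omega>. U i \<omega> * U l \<omega>))"
  proof -
    have "expectation (\<lambda>\<omega>. \<Sum>i=1..n. \<Sum>l=1..n. U i \<omega> * U l \<omega>)
        = (\<Sum>i=1..n. expectation (\<lambda>\<omega>. \<Sum>l=1..n. U i \<omega> * U l \<omega>))"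
      using pint by (intro Bochner_Integration.integral_sum Bochner_Integration.integrable_sum) auto
    also have "\<dots> = (\<Sum>i=1..n. \<Sum>l=1..n. expectation (\<lambda>\<omega>. U i \<omega> * U l \<omega>))"
      using pint by (intro sum.cong refl Bochner_Integration.integral_sum) auto
    finally show ?thesis unfolding Vsq by simp
  qed
  also have "\<dots> = 1 / (real n)\<^sup>2 * (\<Sum>i=1..n. \<Sum>l=1..n. if i = l then expectation (\<lambda>\<omega>. U i \<omega> * U i \<omega>) else 0)"
    using cross by (intro arg_cong[where f="\<lambda>x. 1 / (real n)\<^sup>2 * x"] sum.cong) auto
  also have "\<dots> = 1 / (real n)\<^sup>2 * (\<Sum>i=1..n. expectation (\<lambda>\<omega>. U i \<omega> * U i \<omega>))"
    by simp
  also have "\<dots> \<le> 1 / (real n)\<^sup>2 * (\<Sum>i=1..n. s)"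
    by (intro mult_left_mono sum_mono Usecond) auto
  also have "\<dots> = s / real n"
    using n by (simp add: power2_eq_square)
  finally have *: "expectation (\<lambda>\<omega>. (V \<omega>)\<^sup>2) \<le> s / real n" .
  show "integrable M (\<lambda>\<omega>. \<bar>1 / real n * (\<Sum>i=1..n. T i \<omega>) - c\<bar>)"
    using Vint unfolding V_def by (rule integrable_abs)
  have "0 \<le> variance (\<lambda>\<omega>. \<bar>V \<omega>\<bar>)" by (rule variance_positive)
  also have "\<dots> = expectation (\<lambda>\<omega>. (V \<omega>)\<^sup>2) - (expectation (\<lambda>\<omega>. \<bar>V \<omega>\<bar>))\<^sup>2"
    using Vint Vsqint by (subst variance_eq) auto
  finally have "(expectation (\<lambda>\<omega>. \<bar>V \<omega>\<bar>))\<^sup>2 \<le> s / real n" using * by simp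
  then show "expectation (\<lambda>\<omega>. \<bar>1 / real n * (\<Sum>i=1..n. T i \<omega>) - c\<bar>) \<le> sqrt (s / real n)"
    unfolding V_def by (rule real_le_rsqrt)
qed

text \<open>
  The faces of the cubes lie on countably many coordinate hyperplanes. This is how a Lebesgue
  density of \<open>W\<close> makes the overlaps of the closed cells negligible.
\<close>
lemma AE_lborel_cart_avoid_countable:
  fixes A :: "real set"
  assumes "countable A"
  shows "AE w :: real ^ 'd in lborel. \<forall>l. w $ l \<notin> A"
proof -
  have "AE w :: real ^ 'd in lborel. w $ l \<noteq> c" for l :: 'd and c
  proof -
    have "negligible {w :: real ^ 'd. w $ l = c}"
      unfolding cart_eq_inner_axis by (rule negligible_standard_hyperplane) (simp add: axis_in_Basis_iff)
    then have "{w :: real ^ 'd. w $ l = c} \<in> null_sets lebesgue"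
      by (simp add: negligible_iff_null_sets)
    moreover have "{w :: real ^ 'd. w $ l = c} \<in> sets lborel"
      by simp
    ultimately have "{w :: real ^ 'd. w $ l = c} \<in> null_sets lborel"
      by (simp add: null_sets_completion_iff)
    then show ?thesis by (rule AE_I'[where N = "{w. w $ l = c}"]) auto
  qed
  then have "AE w :: real ^ 'd in lborel. \<forall>l. \<forall>c\<in>A. w $ l \<noteq> c"
    using assms by (simp add: AE_all_countable AE_ball_countable)
  then show ?thesis by (rule eventually_mono) auto
qed

lemma mem_cell_iff:
  "w \<in> cell k j \<longleftrightarrow> (\<forall>l. (real (j l) - 1) / real k \<le> w $ l \<and> w $ l \<le> real (j l) / real k)"
  by (auto simp: cell_def mem_box_cart)

text \<open>
  Off the grid hyperplanes the index of the cell is forced: \<open>j l\<close> is the ceiling of \<open>k * w $ l\<close>.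
\<close>
lemma unique_cell:
  fixes w :: "real ^ 'd"
  assumes w: "w \<in> cbox 0 1" and k: "k \<ge> 1" and avoid: "\<forall>l. w $ l \<notin> (\<lambda>i. real i / real k) ` UNIV"
  shows "\<exists>!j. j \<in> cell_indices k \<and> w \<in> cell k j"
proof
  define j where "j = (\<lambda>l. nat \<lceil>real k * w $ l\<rceil>)"
  have w01: "0 \<le> w $ l" "w $ l \<le> 1" for l using w by (auto simp: mem_box_cart)
  have pos: "0 < w $ l" for l
  proof -
    have "w $ l \<noteq> real 0 / real k" using avoid by (metis rangeI)
    then show ?thesis using w01[of l] by simp
  qed
  have rj: "real (j l) = of_int \<lceil>real k * w $ l\<rceil>" for l
    using pos[of l] k by (simp add: j_def of_nat_nat)
  have up: "real k * w $ l \<le> real (j l)" and lo: "real (j l) - 1 < real k * w $ l" for l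
    unfolding rj by linarith+
  have "j l \<in> {1..k}" for l
  proof -
    have "real k * w $ l > 0" using pos[of l] k by simp
    moreover have "real k * w $ l \<le> real k" using w01[of l] k by (simp add: mult_left_le)
    ultimately show ?thesis using up[of l] lo[of l] by auto
  qed
  then show "j \<in> cell_indices k \<and> w \<in> cell k j"
    using up lo k by (auto simp: cell_indices_def mem_cell_iff field_simps less_imp_le)
  fix j' assume j': "j' \<in> cell_indices k \<and> w \<in> cell k j'"
  show "j' = j"
  proof
    fix l
    have "real (j' l) - 1 \<le> real k * w $ l" "real k * w $ l \<le> real (j' l)" 
      using j' k by (auto simp: mem_cell_iff field_simps)
    moreover have "real k * w $ l \<noteq> real i" for i
      using avoid[rule_format, of l] k by (auto simp: image_iff field_simps)
    then have "real k * w $ l \<noteq> real (j' l)" "real k * w $ l \<noteq> real (j l)"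
         "real k * w $ l \<noteq> real (j' l - 1)" by auto
    moreover have "j' l \<ge> 1" using j' by (auto simp: cell_indices_def)
    ultimately have "real (j' l) - 1 < real k * w $ l" "real k * w $ l < real (j' l)"
      by (auto simp: of_nat_diff)
    then have "real (j' l) - 1 < real (j l)" "real (j l) - 1 < real (j' l)"
      using up[of l] lo[of l] by linarith+
    then show "j' l = j l" by linarith
  qed
qed

lemma cell_indices_eq_PiE: "cell_indices k = (\<Pi>\<^sub>E l\<in>UNIV. {1..k})"
  by (auto simp: cell_indices_def PiE_def)

lemma finite_cell_indices [simp]: "finite (cell_indices k :: ('d::finite \<Rightarrow> nat) set)"
  unfolding cell_indices_eq_PiE by (rule finite_PiE) auto

lemma card_cell_indices: "card (cell_indices k :: ('d::finite \<Rightarrow> nat) set) = k ^ CARD('d)"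
  unfolding cell_indices_eq_PiE by (subst card_PiE) auto

lemma norm_le_of_mem_same_cell:
  fixes w w' :: "real ^ 'd"
  assumes "w \<in> cell k j" "w' \<in> cell k j"
  shows "norm (w - w') \<le> real CARD('d) / real k"
proof -
  have "norm (w - w') \<le> (\<Sum>l\<in>UNIV. \<bar>(w - w') $ l\<bar>)" by (rule norm_le_l1_cart)
  also have "\<dots> \<le> (\<Sum>l\<in>(UNIV :: 'd set). 1 / real k)"
  proof (rule sum_mono)
    fix l
    have "w $ l \<in> {(real (j l) - 1) / real k..real (j l) / real k}" 
      "w' $ l \<in> {(real (j l) - 1) / real k..real (j l) / real k}"
      using assms by (auto simp: mem_cell_iff)
    then show "\<bar>(w - w') $ l\<bar> \<le> 1 / real k"
      by (auto simp: diff_divide_distrib abs_le_iff)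
  qed
  finally show ?thesis by simp
qed

text \<open>
  One cell of the criterion is the ratio \<open>c\<^sup>2 / v\<close> of a squared mean and a probability. With
  \<open>c = v \<mu>\<close>, \<open>c' = v (\<mu> + x)\<close> and \<open>v' = v (1 + y)\<close> the change of the ratio is
  \<open>v (2 \<mu> x + x\<^sup>2 - \<mu>\<^sup>2 y) / (1 + y)\<close>, so a relative error \<open>S \<le> 1/2\<close> costs only a multiple
  of \<open>S v\<close>. The factor \<open>v\<close> survives, and so the errors of all cells add up to a multiple of \<open>S\<close>.
  The constant \<open>B\<close> stands for the size of the coefficient vector and comes out squared, as it must
  for a quadratic form.
\<close>
lemma ratio_perturbation:
  fixes v v' c c' B H S :: real
  assumes v: "v > 0" and S: "0 \<le> S" "S \<le> 1/2" and BH: "0 \<le> B" "0 \<le> H"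
    and v': "\<bar>v' - v\<bar> \<le> S * v" and c: "\<bar>c\<bar> \<le> H * B * v" and c': "\<bar>c' - c\<bar> \<le> B * S * v"
  shows "\<bar>c'\<^sup>2 / v' - c\<^sup>2 / v\<bar> \<le> 2 * (H + 1)\<^sup>2 * B\<^sup>2 * S * v"
proof -
  \<comment> \<open>The perturbed denominator stays away from zero.\<close>
  have v'_ge: "v' \<ge> v / 2" 
  proof -
    have "S * v \<le> 1/2 * v" by (rule mult_right_mono) (use S v in auto)
    then show ?thesis using v' by linarith
  qed
  then have v'_pos: "v' > 0" using v by linarith
  define x where "x = c' - c"
  have "c'\<^sup>2 / v' - c\<^sup>2 / v = (2 * c * x * v + x\<^sup>2 * v - c\<^sup>2 * (v' - v)) / (v * v')"
    using v v'_pos by (simp add: x_def field_simps power2_eq_square)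
  then have "\<bar>c'\<^sup>2 / v' - c\<^sup>2 / v\<bar> = \<bar>2 * c * x * v + x\<^sup>2 * v - c\<^sup>2 * (v' - v)\<bar> / (v * v')"
    using v v'_pos by (simp add: abs_mult)
  also have "\<bar>2 * c * x * v + x\<^sup>2 * v - c\<^sup>2 * (v' - v)\<bar> \<le> (H + 1)\<^sup>2 * B\<^sup>2 * S * v ^ 3"
  proof -
    have xb: "\<bar>x\<bar> \<le> B * S * v" using c' by (simp add: x_def)
    have "\<bar>2 * c * x * v\<bar> \<le> 2 * (H * B * v) * (B * S * v) * v"
      unfolding abs_mult using c xb v S BH by (intro mult_mono) auto
    moreover have "\<bar>x\<^sup>2 * v\<bar> \<le> (B * S * v) * (B * 1 * v) * v"
    proof -
      have "\<bar>x\<bar> * \<bar>x\<bar> * v \<le> (B * S * v) * (B * 1 * v) * v"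
      proof (intro mult_mono)
        show "\<bar>x\<bar> \<le> B * 1 * v" 
          by (rule order_trans[OF xb]) (use S v BH in \<open>intro mult_right_mono mult_left_mono; auto\<close>)
      qed (use xb v S BH in auto)
      then show ?thesis using v by (simp add: power2_eq_square abs_mult)
    qed
    moreover have "\<bar>c\<^sup>2 * (v' - v)\<bar> \<le> (H * B * v) * (H * B * v) * (S * v)"
      unfolding power2_eq_square abs_mult using c v' v S BH by (intro mult_mono) auto
    ultimately have "\<bar>2 * c * x * v + x\<^sup>2 * v - c\<^sup>2 * (v' - v)\<bar> \<le>
        2 * (H * B * v) * (B * S * v) * v + (B * S * v) * (B * 1 * v) * v + (H * B * v) * (H * B * v) * (S * v)"
      by linarith
    also have "\<dots> = (H + 1)\<^sup>2 * B\<^sup>2 * S * v ^ 3"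
      by (simp add: power2_eq_square power3_eq_cube algebra_simps)
    finally show ?thesis .
  qed
  also have "(H + 1)\<^sup>2 * B\<^sup>2 * S * v ^ 3 / (v * v') \<le> (H + 1)\<^sup>2 * B\<^sup>2 * S * v ^ 3 / (v * (v / 2))"
    using v'_ge v v'_pos S BH by (intro divide_left_mono mult_left_mono mult_nonneg_nonneg) auto
  also have "\<dots> = 2 * (H + 1)\<^sup>2 * B\<^sup>2 * S * v"
    using v by (simp add: field_simps power3_eq_cube)
  finally show ?thesis using v v'_pos by (simp add: divide_right_mono)
qed

section \<open>Gaussian prior and quasi-posterior on the coefficient space\<close>

lemma sigma_finite_coef_lebesgue: "sigma_finite_measure (coef_lebesgue q)"
proof -
  interpret product_sigma_finite "\<lambda>i::nat. lborel :: real measure" ..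
  interpret finite_product_sigma_finite "\<lambda>i::nat. lborel :: real measure" "{1..q}"
    by standard simp
  show ?thesis unfolding coef_lebesgue_def by (rule sigma_finite_measure_axioms)
qed

lemma coef_component_measurable [measurable]:
  "i \<in> {1..q} \<Longrightarrow> (\<lambda>b. b i) \<in> borel_measurable (coef_lebesgue q)"
  unfolding coef_lebesgue_def by measurable

lemma normal_prior_measurable [measurable]:
  "normal_prior \<sigma> q \<in> borel_measurable (coef_lebesgue q)"
  unfolding normal_prior_def[abs_def] by measurable

lemma normal_prior_nonneg: "normal_prior \<sigma> q b \<ge> 0"
  by (simp add: normal_prior_def prod_nonneg)

lemma nn_integral_normal_prior:
  assumes "\<sigma> > 0"
  shows "(\<integral>\<^sup>+ b. ennreal (normal_prior \<sigma> q b) \<partial>coef_lebesgue q) = 1"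
proof -
  interpret product_sigma_finite "\<lambda>i::nat. lborel :: real measure" ..
  have "(\<integral>\<^sup>+ b. ennreal (normal_prior \<sigma> q b) \<partial>coef_lebesgue q)
      = (\<integral>\<^sup>+ b. (\<Prod>i\<in>{1..q}. ennreal (normal_density 0 \<sigma> (b i))) \<partial>(\<Pi>\<^sub>M i\<in>{1..q}. lborel))"
    unfolding normal_prior_def coef_lebesgue_def by (simp add: prod_ennreal)
  also have "\<dots> = (\<Prod>i\<in>{1..q}. \<integral>\<^sup>+ x. ennreal (normal_density 0 \<sigma> x) \<partial>lborel)"
    by (rule product_nn_integral_prod) auto
  also have "(\<integral>\<^sup>+ x. ennreal (normal_density 0 \<sigma> x) \<partial>lborel) = 1"
    using prob_space.emeasure_space_1[OF prob_space_normal_density[OF assms, of 0]]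
    by (simp add: emeasure_density)
  finally show ?thesis by simp
qed

text \<open>
  The prior mass of a cube: on each edge the Gaussian density is at least its value at \<open>A\<close>, a
  bound for the moduli that occur there.
\<close>
lemma normal_prior_cube_ge:
  assumes \<sigma>: "\<sigma> > 0" and t: "t \<ge> 0" and a: "\<And>i. i \<in> {1..q} \<Longrightarrow> \<bar>a i\<bar> + t \<le> A"
  shows "(\<integral>\<^sup>+ b. ennreal (normal_prior \<sigma> q b) * indicator {b. \<forall>i\<in>{1..q}. \<bar>b i - a i\<bar> \<le> t} b \<partial>coef_lebesgue q)
          \<ge> ennreal ((2 * t * normal_density 0 \<sigma> A) ^ q)"
proof -
  interpret product_sigma_finite "\<lambda>i::nat. lborel :: real measure" ..
  let ?N = "normal_density 0 \<sigma>"
  have dens: "?N x \<ge> ?N A" if "i \<in> {1..q}" "x \<in> {a i - t..a i + t}" for i x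
  proof -
    have "\<bar>x\<bar> \<le> A" using a[OF that(1)] that(2) by auto
    then have "x\<^sup>2 \<le> A\<^sup>2" by (intro abs_le_square_iff[THEN iffD1]) linarith
    then have "- x\<^sup>2 / (2 * \<sigma>\<^sup>2) \<ge> - A\<^sup>2 / (2 * \<sigma>\<^sup>2)"
      using \<sigma> by (intro divide_right_mono) auto
    then show ?thesis unfolding normal_density_def by (intro mult_left_mono) auto
  qed
  have "ennreal ((2 * t * ?N A) ^ q) = (\<Prod>i\<in>{1..q}. ennreal (?N A * (2 * t)))"
    using t by (simp add: ennreal_power mult_ac)
  also have "\<dots> \<le> (\<Prod>i\<in>{1..q}. \<integral>\<^sup>+ x. ennreal (?N x) * indicator {a i - t..a i + t} x \<partial>lborel)"
  proof (rule prod_mono_ennreal)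
    fix i assume i: "i \<in> {1..q}"
    have "ennreal (?N A * (2 * t)) = (\<integral>\<^sup>+ x. ennreal (?N A) * indicator {a i - t..a i + t} x \<partial>lborel)"
      using t by (simp add: nn_integral_cmult_indicator ennreal_mult)
    also have "\<dots> \<le> (\<integral>\<^sup>+ x. ennreal (?N x) * indicator {a i - t..a i + t} x \<partial>lborel)"
      using dens[OF i] by (intro nn_integral_mono) (auto simp: indicator_def)
    finally show "ennreal (?N A * (2 * t)) \<le> \<dots>" .
  qed
  also have "\<dots> = (\<integral>\<^sup>+ b. (\<Prod>i\<in>{1..q}. ennreal (?N (b i)) * indicator {a i - t..a i + t} (b i)) \<partial>(\<Pi>\<^sub>M i\<in>{1..q}. lborel))"
    by (rule product_nn_integral_prod[symmetric]) auto
  also have "\<dots> \<le> (\<integral>\<^sup>+ b. ennreal (normal_prior \<sigma> q b) * indicator {b. \<forall>i\<in>{1..q}. \<bar>b i - a i\<bar> \<le> t} b \<partial>coef_lebesgue q)"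
    unfolding coef_lebesgue_def
  proof (rule nn_integral_mono)
    fix b :: "nat \<Rightarrow> real"
    show "(\<Prod>i\<in>{1..q}. ennreal (?N (b i)) * indicator {a i - t..a i + t} (b i))
        \<le> ennreal (normal_prior \<sigma> q b) * indicator {b. \<forall>i\<in>{1..q}. \<bar>b i - a i\<bar> \<le> t} b"
    proof (cases "\<forall>i\<in>{1..q}. \<bar>b i - a i\<bar> \<le> t")
      case True
      then have "(\<Prod>i\<in>{1..q}. ennreal (?N (b i)) * indicator {a i - t..a i + t} (b i)) = (\<Prod>i\<in>{1..q}. ennreal (?N (b i)))"
        by (intro prod.cong) (auto simp: indicator_def abs_le_iff algebra_simps)
      then show ?thesis using True by (simp add: normal_prior_def prod_ennreal)
    next
      case False
      then obtain i where "i \<in> {1..q}" "\<not> \<bar>b i - a i\<bar> \<le> t" by auto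
      then have "(\<Prod>i\<in>{1..q}. ennreal (?N (b i)) * indicator {a i - t..a i + t} (b i)) = 0"
        by (intro prod_zero bexI[of _ i]) (auto simp: indicator_def)
      then show ?thesis by (rule ord_eq_le_trans) (rule zero_le)
    qed
  qed
  finally show ?thesis .
qed

text \<open>
  The usual quotient bound. On \<open>S\<close> the likelihood is at most \<open>exp (- n \<gamma> / 2)\<close>; the normalising
  constant is at least \<open>exp (- n \<gamma> / 4)\<close> times the prior mass of a cube on which the criterion is
  at most \<open>\<gamma> / 2\<close>. The lower bound \<open>\<gamma>\<close> is taken on all of \<open>S\<close>, large coefficients included,
  and so the numerator is controlled with the total mass of the prior alone.
\<close>
lemma quasi_posterior_set_le:
  fixes G :: "(nat \<Rightarrow> real) \<Rightarrow> real" and n q :: nat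
  defines "lik \<equiv> \<lambda>b. exp (- (real n / 2) * G b)"
  assumes \<sigma>: "\<sigma> > 0" and t: "t > 0" and a: "\<And>i. i \<in> {1..q} \<Longrightarrow> \<bar>a i\<bar> + t \<le> A"
    and G[measurable]: "G \<in> borel_measurable (coef_lebesgue q)"
    and S[measurable]: "S \<in> sets (coef_lebesgue q)"
    and nonneg: "\<And>b. b \<in> space (coef_lebesgue q) \<Longrightarrow> G b \<ge> 0"
    and out: "\<And>b. b \<in> S \<Longrightarrow> G b \<ge> \<gamma>"
    and cube: "\<And>b. b \<in> space (coef_lebesgue q) \<Longrightarrow> \<forall>i\<in>{1..q}. \<bar>b i - a i\<bar> \<le> t \<Longrightarrow> G b \<le> \<gamma> / 2"
  shows "measure (density (coef_lebesgue q)
           (\<lambda>b. ennreal (normal_prior \<sigma> q b * lik b / (\<integral>b'. normal_prior \<sigma> q b' * lik b' \<partial>coef_lebesgue q)))) S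
         \<le> exp (- (real n * \<gamma> / 4)) / (2 * t * normal_density 0 \<sigma> A) ^ q"
proof -
  let ?L = "coef_lebesgue q" and ?p = "normal_prior \<sigma> q"
  define D where "D = (\<integral>b. ?p b * lik b \<partial>?L)"
  define \<kappa> where "\<kappa> = (2 * t * normal_density 0 \<sigma> A) ^ q"
  have \<kappa>: "\<kappa> > 0" unfolding \<kappa>_def using t \<sigma> by (intro zero_less_power mult_pos_pos normal_density_pos) auto
  have lik[measurable]: "lik \<in> borel_measurable ?L" unfolding lik_def by measurable
  have lik1: "lik b \<le> 1" if "b \<in> space ?L" for b using nonneg[OF that] by (simp add: lik_def)
  have lik0: "lik b \<ge> 0" for b by (simp add: lik_def)
  have int: "integrable ?L (\<lambda>b. ?p b * lik b)"
  proof (rule integrableI_bounded)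
    have "(\<integral>\<^sup>+ b. ennreal (norm (?p b * lik b)) \<partial>?L) \<le> (\<integral>\<^sup>+ b. ennreal (?p b) \<partial>?L)"
      using lik1 lik0 normal_prior_nonneg
      by (intro nn_integral_mono ennreal_leI) (auto simp: abs_mult mult_left_le)
    also have "\<dots> < \<infinity>" by (simp add: nn_integral_normal_prior[OF \<sigma>])
    finally show "(\<integral>\<^sup>+ b. ennreal (norm (?p b * lik b)) \<partial>?L) < \<infinity>" .
  qed measurable
  have D_nn: "ennreal D = (\<integral>\<^sup>+ b. ennreal (?p b * lik b) \<partial>?L)"
    unfolding D_def using int lik0 normal_prior_nonneg
    by (intro nn_integral_eq_integral[symmetric]) auto
  have D_ge: "D \<ge> exp (- (real n * \<gamma> / 4)) * \<kappa>"
  proof -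
    let ?I = "indicator {b. \<forall>i\<in>{1..q}. \<bar>b i - a i\<bar> \<le> t} :: (nat \<Rightarrow> real) \<Rightarrow> ennreal"
    have [measurable]: "{b \<in> space ?L. \<forall>i\<in>{1..q}. \<bar>b i - a i\<bar> \<le> t} \<in> sets ?L" by measurable
    have m: "(\<lambda>b. ennreal (?p b) * ?I b) \<in> borel_measurable ?L"
    proof -
      have "(\<lambda>b. ennreal (?p b) * indicator {b \<in> space ?L. \<forall>i\<in>{1..q}. \<bar>b i - a i\<bar> \<le> t} b) \<in> borel_measurable ?L"
        by measurable
      then show ?thesis by (rule measurable_cong[THEN iffD1, rotated]) (auto simp: indicator_def)
    qed
    have "ennreal (exp (- (real n * \<gamma> / 4)) * \<kappa>) 
        \<le> ennreal (exp (- (real n * \<gamma> / 4))) * (\<integral>\<^sup>+ b. ennreal (?p b) * ?I b \<partial>?L)"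
      unfolding \<kappa>_def using normal_prior_cube_ge[OF \<sigma> less_imp_le[OF t] a] t
      by (simp add: ennreal_mult mult_left_mono)
    also have "\<dots> = (\<integral>\<^sup>+ b. ennreal (exp (- (real n * \<gamma> / 4))) * (ennreal (?p b) * ?I b) \<partial>?L)"
      by (rule nn_integral_cmult[symmetric, OF m])
    also have "\<dots> \<le> (\<integral>\<^sup>+ b. ennreal (?p b * lik b) \<partial>?L)"
    proof (rule nn_integral_mono)
      fix b assume b: "b \<in> space ?L"
      show "ennreal (exp (- (real n * \<gamma> / 4))) * (ennreal (?p b) * ?I b) \<le> ennreal (?p b * lik b)"
      proof (cases "\<forall>i\<in>{1..q}. \<bar>b i - a i\<bar> \<le> t")
        case True
        then have "real n / 2 * G b \<le> real n / 2 * (\<gamma> / 2)" using cube[OF b] by (intro mult_left_mono) auto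
        then have "exp (- (real n * \<gamma> / 4)) \<le> lik b" unfolding lik_def by simp
        then have "exp (- (real n * \<gamma> / 4)) * ?p b \<le> ?p b * lik b"
          using normal_prior_nonneg[of \<sigma> q b] by (subst mult.commute) (rule mult_left_mono)
        then show ?thesis using True normal_prior_nonneg[of \<sigma> q b]
          by (simp add: ennreal_mult'[symmetric] ennreal_leI)
      qed simp
    qed
    also have "\<dots> = ennreal D" by (rule D_nn[symmetric])
    finally show ?thesis
      unfolding D_def using lik0 normal_prior_nonneg by (subst (asm) ennreal_le_iff) (auto intro!: integral_nonneg)
  qed
  have D: "D > 0" by (rule less_le_trans[OF _ D_ge]) (use \<kappa> in simp)
  have "emeasure (density ?L (\<lambda>b. ennreal (?p b * lik b / D))) S
      = (\<integral>\<^sup>+ b. ennreal (?p b * lik b / D) * indicator S b \<partial>?L)"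
    by (rule emeasure_density) auto
  also have "\<dots> \<le> (\<integral>\<^sup>+ b. ennreal (exp (- (real n * \<gamma> / 2)) / D) * ennreal (?p b) \<partial>?L)"
  proof (rule nn_integral_mono)
    fix b assume b: "b \<in> space ?L"
    show "ennreal (?p b * lik b / D) * indicator S b \<le> ennreal (exp (- (real n * \<gamma> / 2)) / D) * ennreal (?p b)"
    proof (cases "b \<in> S")
      case True
      then have "real n / 2 * \<gamma> \<le> real n / 2 * G b" using out by (intro mult_left_mono) auto
      then have "lik b \<le> exp (- (real n * \<gamma> / 2))" unfolding lik_def by simp
      then have "?p b * lik b / D \<le> ?p b * exp (- (real n * \<gamma> / 2)) / D"
        using normal_prior_nonneg[of \<sigma> q b] D by (intro divide_right_mono mult_left_mono) auto
      then have "?p b * lik b / D \<le> exp (- (real n * \<gamma> / 2)) / D * ?p b"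
        by (simp add: mult.commute)
      then show ?thesis using True D normal_prior_nonneg[of \<sigma> q b]
        by (simp add: ennreal_mult'[symmetric] ennreal_leI)
    qed simp
  qed
  also have "\<dots> = ennreal (exp (- (real n * \<gamma> / 2)) / D)"
    by (subst nn_integral_cmult) (auto simp: nn_integral_normal_prior[OF \<sigma>])
  finally have "measure (density ?L (\<lambda>b. ennreal (?p b * lik b / D))) S \<le> exp (- (real n * \<gamma> / 2)) / D"
    using D unfolding measure_def by (intro enn2real_leI) auto
  also have "\<dots> \<le> exp (- (real n * \<gamma> / 2)) / (exp (- (real n * \<gamma> / 4)) * \<kappa>)"
    using D_ge D \<kappa> by (intro divide_left_mono) auto
  also have "\<dots> = exp (- (real n * \<gamma> / 4)) / \<kappa>"
  proof -
    have "exp (- (real n * \<gamma> / 2)) = exp (- (real n * \<gamma> / 4)) * exp (- (real n * \<gamma> / 4))"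
      by (simp add: exp_add[symmetric])
    then show ?thesis by simp
  qed
  finally show ?thesis unfolding D_def \<kappa>_def .
qed

section \<open>Measurability\<close>

lemma cell_sets [measurable]: "cell k j \<in> sets borel"
  unfolding cell_def by simp

lemma sieve_fun_measurable:
  assumes "\<And>i. i \<in> {1..q} \<Longrightarrow> \<phi> i \<in> borel_measurable borel"
    and [measurable]: "f \<in> borel_measurable N"
    and "\<And>i. i \<in> {1..q} \<Longrightarrow> (\<lambda>\<omega>. b \<omega> i) \<in> borel_measurable N"
  shows "(\<lambda>\<omega>. sieve_fun \<phi> q (b \<omega>) (f \<omega>)) \<in> borel_measurable N"
  unfolding sieve_fun_def
  by (intro borel_measurable_sum borel_measurable_times assms(3) measurable_compose[OF assms(2) assms(1)])

lemma G_bar_sieve_measurable: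
  assumes "\<And>i. i \<in> {1..n} \<Longrightarrow> (\<lambda>z. Ys i (p z)) \<in> borel_measurable N"
    and "\<And>i. i \<in> {1..n} \<Longrightarrow> (\<lambda>z. Xs i (p z)) \<in> borel_measurable N"
    and "\<And>i. i \<in> {1..n} \<Longrightarrow> (\<lambda>z. Ws i (p z)) \<in> borel_measurable N"
    and "\<And>i. i \<in> {1..q} \<Longrightarrow> \<phi> i \<in> borel_measurable borel"
    and "\<And>i. i \<in> {1..q} \<Longrightarrow> (\<lambda>z. b z i) \<in> borel_measurable N"
  shows "(\<lambda>z. G_bar Ys Xs Ws n k (sieve_fun \<phi> q (b z)) (p z)) \<in> borel_measurable N"
proof -
  have ind: "(\<lambda>z. indicator (cell k j) (Ws i (p z)) :: real) \<in> borel_measurable N" if "i \<in> {1..n}" for i j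
    by (rule measurable_compose[OF assms(3)[OF that]]) measurable
  show ?thesis
    unfolding G_bar_def v_hat_def
    by (intro borel_measurable_sum borel_measurable_divide borel_measurable_power borel_measurable_times
        borel_measurable_const borel_measurable_diff sieve_fun_measurable ind assms)
qed

lemma (in prob_space) norm_s_sieve_measurable:
  assumes "\<And>i. i \<in> {1..q} \<Longrightarrow> \<phi> i \<in> borel_measurable borel"
    and [measurable]: "X \<in> borel_measurable M" "g0 \<in> borel_measurable borel"
  shows "(\<lambda>b. norm_s M X (\<lambda>x. sieve_fun \<phi> q b x - g0 x)) \<in> borel_measurable (coef_lebesgue q)"
proof -
  have [measurable]: "(\<lambda>z. sieve_fun \<phi> q (fst z) (X (snd z))) \<in> borel_measurable (coef_lebesgue q \<Otimes>\<^sub>M M)"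
    by (rule sieve_fun_measurable)
      (auto intro: assms(1) measurable_compose[OF measurable_fst coef_component_measurable])
  show ?thesis unfolding norm_s_def
    by (intro borel_measurable_sqrt[THEN measurable_compose[rotated]] borel_measurable_lebesgue_integral)
      (simp add: case_prod_beta)
qed

text \<open>
  The posterior probability is an integral over the coefficients of a function that is jointly
  measurable in the coefficients and in the sample point, the normalising constant included.
\<close>
lemma posterior_prob_measurable:
  assumes Ys: "\<And>i. i \<in> {1..n} \<Longrightarrow> Ys i \<in> borel_measurable M"
    and Xs: "\<And>i. i \<in> {1..n} \<Longrightarrow> Xs i \<in> borel_measurable M"
    and Ws: "\<And>i. i \<in> {1..n} \<Longrightarrow> Ws i \<in> borel_measurable M"
    and \<phi>: "\<And>i. i \<in> {1..q} \<Longrightarrow> \<phi> i \<in> borel_measurable borel"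
    and pr[measurable]: "pr \<in> borel_measurable (coef_lebesgue q)"
    and S: "{b \<in> space (coef_lebesgue q). P (sieve_fun \<phi> q b)} \<in> sets (coef_lebesgue q)"
  shows "posterior_prob Ys Xs Ws \<phi> pr n k q P \<in> borel_measurable M"
proof -
  interpret L: sigma_finite_measure "coef_lebesgue q" by (rule sigma_finite_coef_lebesgue)
  let ?S = "{b \<in> space (coef_lebesgue q). P (sieve_fun \<phi> q b)}"
  let ?l = "quasi_lik Ys Xs Ws \<phi> n k q"
  have [measurable]: "(\<lambda>z. ?l (fst z) (snd z)) \<in> borel_measurable (M \<Otimes>\<^sub>M coef_lebesgue q)"
    unfolding quasi_lik_def
    by (intro borel_measurable_exp[THEN measurable_compose[rotated]] borel_measurable_times borel_measurable_const
        G_bar_sieve_measurable measurable_compose[OF measurable_fst] measurable_compose[OF measurable_snd] Ys Xs Ws \<phi>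
        coef_component_measurable)
  have lik_b: "?l \<omega> \<in> borel_measurable (coef_lebesgue q)" if "\<omega> \<in> space M" for \<omega>
  proof -
    have "(\<lambda>b. ?l (fst (\<omega>, b)) (snd (\<omega>, b))) \<in> borel_measurable (coef_lebesgue q)"
      using that by measurable
    then show ?thesis by simp
  qed
  have D[measurable]: "(\<lambda>\<omega>. \<integral>b'. pr b' * ?l \<omega> b' \<partial>coef_lebesgue q) \<in> borel_measurable M"
    by (intro L.borel_measurable_lebesgue_integral) (simp add: case_prod_beta)
  have *: "posterior_prob Ys Xs Ws \<phi> pr n k q P \<omega> =
      enn2real (\<integral>\<^sup>+b. ennreal (pr b * ?l \<omega> b / (\<integral>b'. pr b' * ?l \<omega> b' \<partial>coef_lebesgue q)) * indicator ?S b \<partial>coef_lebesgue q)"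
    if "\<omega> \<in> space M" for \<omega>
    unfolding posterior_prob_def quasi_posterior_def measure_def
    using lik_b[OF that] S by (subst emeasure_density) auto
  have "(\<lambda>\<omega>. enn2real (\<integral>\<^sup>+b. ennreal (pr b * ?l \<omega> b / (\<integral>b'. pr b' * ?l \<omega> b' \<partial>coef_lebesgue q)) * indicator ?S b \<partial>coef_lebesgue q))
      \<in> borel_measurable M"
  proof (intro measurable_compose[OF L.borel_measurable_nn_integral borel_measurable_enn2real])
    have [measurable]: "?S \<in> sets (coef_lebesgue q)" by (rule S)
    show "(\<lambda>(\<omega>, b). ennreal (pr b * ?l \<omega> b / (\<integral>b'. pr b' * ?l \<omega> b' \<partial>coef_lebesgue q)) * indicator ?S b)
        \<in> borel_measurable (M \<Otimes>\<^sub>M coef_lebesgue q)"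
      by (simp add: case_prod_beta)
  qed simp
  then show ?thesis by (subst measurable_cong[OF *])
qed

section \<open>Conditional moments on the cells\<close>

text \<open>
  The response and the basis functions are treated alike, the response having index \<open>0\<close>. A residual
  \<open>Y - g\<^sub>b(X)\<close> is then a linear combination of regressors with coefficient vector \<open>(1, - b)\<close>, which
  turns both criteria into quadratic forms in that vector.
\<close>
definition regressor :: "('a \<Rightarrow> real) \<Rightarrow> ('a \<Rightarrow> 'x) \<Rightarrow> (nat \<Rightarrow> 'x \<Rightarrow> real) \<Rightarrow> nat \<Rightarrow> 'a \<Rightarrow> real" where
  "regressor Y X \<phi> a \<omega> = (if a = 0 then Y \<omega> else \<phi> a (X \<omega>))"

definition residual_coef :: "(nat \<Rightarrow> real) \<Rightarrow> nat \<Rightarrow> real" where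
  "residual_coef b a = (if a = 0 then 1 else - b a)"

lemma residual_eq_sum:
  "Y \<omega> - sieve_fun \<phi> q b (X \<omega>) = (\<Sum>a=0..q. residual_coef b a * regressor Y X \<phi> a \<omega>)"
proof -
  have "(\<Sum>a=0..q. residual_coef b a * regressor Y X \<phi> a \<omega>)
      = residual_coef b 0 * regressor Y X \<phi> 0 \<omega> + (\<Sum>a=1..q. residual_coef b a * regressor Y X \<phi> a \<omega>)"
    by (simp add: sum.atLeast_Suc_atMost)
  then show ?thesis
    by (simp add: residual_coef_def regressor_def sieve_fun_def sum_negf)
qed

lemma (in prob_space) N1_mean_abs_dev_le:
  assumes N1: "N1 M Y X W Ys Xs Ws" and n: "n \<ge> 1"
    and YXW[measurable]: "Y \<in> borel_measurable M" "X \<in> borel_measurable M" "W \<in> borel_measurable M"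
    and f[measurable]: "f \<in> borel_measurable borel"
    and sq: "integrable M (\<lambda>\<omega>. (f (Y \<omega>, X \<omega>, W \<omega>))\<^sup>2)"
    and s: "expectation (\<lambda>\<omega>. (f (Y \<omega>, X \<omega>, W \<omega>))\<^sup>2) \<le> s"
  defines "dev \<equiv> \<lambda>\<omega>. \<bar>1 / real n * (\<Sum>i=1..n. f (Ys i \<omega>, Xs i \<omega>, Ws i \<omega>)) - expectation (\<lambda>\<omega>. f (Y \<omega>, X \<omega>, W \<omega>))\<bar>"
  shows "integrable M dev" and "expectation dev \<le> sqrt (s / real n)"
proof -
  let ?O = "\<lambda>\<omega>. (Y \<omega>, X \<omega>, W \<omega>)" and ?Os = "\<lambda>i \<omega>. (Ys i \<omega>, Xs i \<omega>, Ws i \<omega>)"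
  have O: "?O \<in> borel_measurable M" by simp
  have ind: "indep_vars (\<lambda>_. borel) ?Os {1..}"
    and law: "\<And>i. i \<ge> 1 \<Longrightarrow> distr M borel (?Os i) = distr M borel ?O"
    using N1 by (auto simp: N1_def)
  have Os: "?Os i \<in> borel_measurable M" if "i \<ge> 1" for i
    using ind that by (auto simp: indep_vars_def)
  have ind': "indep_vars (\<lambda>_. borel) (\<lambda>i \<omega>. f (?Os i \<omega>)) {1..n}"
    by (rule indep_vars_compose2[OF indep_vars_subset[OF ind], where Y="\<lambda>_. f"]) auto
  have int: "integrable M (\<lambda>\<omega>. (f (?Os i \<omega>))\<^sup>2)" if "i \<in> {1..n}" for i
  proof -
    have "integrable (distr M borel (?Os i)) (\<lambda>z. (f z)\<^sup>2)"
      using law[of i] that sq O by (simp add: integrable_distr_eq)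
    then show ?thesis using Os[of i] that by (subst (asm) integrable_distr_eq) auto
  qed
  have exp: "expectation (\<lambda>\<omega>. g (?Os i \<omega>)) = expectation (\<lambda>\<omega>. g (?O \<omega>))"
    if "i \<in> {1..n}" "g \<in> borel_measurable borel" for i and g :: "_ \<Rightarrow> real"
  proof -
    have "expectation (\<lambda>\<omega>. g (?Os i \<omega>)) = integral\<^sup>L (distr M borel (?Os i)) g"
      using Os[of i] that by (subst integral_distr) auto
    also have "\<dots> = integral\<^sup>L (distr M borel ?O) g" using law[of i] that by simp
    also have "\<dots> = expectation (\<lambda>\<omega>. g (?O \<omega>))"
      using O that by (subst integral_distr) auto
    finally show ?thesis .
  qed
  show "integrable M dev" "expectation dev \<le> sqrt (s / real n)"
    unfolding dev_def
    by (rule expectation_abs_mean_dev_le[OF ind' n]; use int exp[of _ f] exp[of _ "\<lambda>z. (f z)\<^sup>2"] s in simp)+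
qed

text \<open>
  The function \<open>h a\<close> is a Lipschitz version of the conditional mean of the regressor \<open>a\<close> given \<open>W\<close>.
  One constant \<open>C\<close> serves all regressors, including the response, as both the Lipschitz constant and
  the bound on the conditional second moments.
\<close>
locale iv_moments = prob_space M for M :: "'a measure" +
  fixes Y :: "'a \<Rightarrow> real" and X :: "'a \<Rightarrow> 'x::euclidean_space" and W :: "'a \<Rightarrow> real ^ 'd::finite"
    and \<phi> :: "nat \<Rightarrow> 'x \<Rightarrow> real" and h :: "nat \<Rightarrow> real ^ 'd \<Rightarrow> real" and C :: real and fW :: "real ^ 'd \<Rightarrow> ennreal"
  assumes Y_meas[measurable]: "Y \<in> borel_measurable M"
    and X_meas[measurable]: "X \<in> borel_measurable M"
    and W_meas[measurable]: "W \<in> borel_measurable M"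
    and \<phi>_meas[measurable]: "\<And>a. a \<ge> 1 \<Longrightarrow> \<phi> a \<in> borel_measurable borel"
    and W_cube: "\<And>\<omega>. \<omega> \<in> space M \<Longrightarrow> W \<omega> \<in> cbox 0 1"
    and W_density: "distributed M lborel W fW"
    and C_ge_1: "C \<ge> 1"
    and sq_integrable: "\<And>a. integrable M (\<lambda>\<omega>. (regressor Y X \<phi> a \<omega>)\<^sup>2)"
    and sq_cexp_le: "\<And>a. AE \<omega> in M. cexp M W (\<lambda>\<omega>. (regressor Y X \<phi> a \<omega>)\<^sup>2) \<omega> \<le> C"
    and version: "\<And>a. cond_mean_version M W (regressor Y X \<phi> a) (h a)"
    and lipschitz: "\<And>a w1 w2. w1 \<in> cbox 0 1 \<Longrightarrow> w2 \<in> cbox 0 1 \<Longrightarrow> \<bar>h a w1 - h a w2\<bar> \<le> C * norm (w1 - w2)"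
begin

abbreviation "Z \<equiv> regressor Y X \<phi>"

lemma Z_meas [measurable]: "Z a \<in> borel_measurable M"
  by (cases "a = 0") (auto simp: regressor_def[abs_def])

lemma Z_integrable: "integrable M (Z a)"
  using version[of a] by (simp add: cond_mean_version_def)

lemma h_meas [measurable]: "h a \<in> borel_measurable borel"
  using version[of a] by (simp add: cond_mean_version_def)

abbreviation "FW \<equiv> vimage_algebra (space M) W borel"

lemma W_FW [measurable]: "W \<in> borel_measurable FW"
  by (rule measurable_vimage_algebra1) auto

lemma subalgebra_FW: "subalgebra M FW"
  unfolding subalgebra_def using W_meas
  by (auto simp: sets_vimage_algebra2 intro: measurable_sets)

sublocale cond: finite_measure_subalgebra M FW
  by unfold_locales (rule subalgebra_FW)

lemma integral_h_eq:
  assumes [measurable]: "A \<in> sets borel"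
  shows "expectation (\<lambda>\<omega>. h a (W \<omega>) * indicator A (W \<omega>)) = expectation (\<lambda>\<omega>. Z a \<omega> * indicator A (W \<omega>))"
proof -
  have ae: "AE \<omega> in M. real_cond_exp M FW (Z a) \<omega> = h a (W \<omega>)"
    using version[of a] by (simp add: cond_mean_version_def cexp_def)
  have "integrable M (\<lambda>\<omega>. indicator (W -` A \<inter> space M) \<omega> * Z a \<omega>)"
    using integrable_mult_indicator[OF _ Z_integrable, of "W -` A \<inter> space M" a] by simp
  then have "integrable M (\<lambda>\<omega>. indicator A (W \<omega>) * Z a \<omega>)"
    by (rule Bochner_Integration.integrable_cong[THEN iffD1, rotated 2]) (auto simp: indicator_def)
  then have "expectation (\<lambda>\<omega>. indicator A (W \<omega>) * real_cond_exp M FW (Z a) \<omega>) = expectation (\<lambda>\<omega>. indicator A (W \<omega>) * Z a \<omega>)"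
    by (intro cond.real_cond_exp_intg(2)) auto
  moreover have "expectation (\<lambda>\<omega>. indicator A (W \<omega>) * real_cond_exp M FW (Z a) \<omega>) = expectation (\<lambda>\<omega>. indicator A (W \<omega>) * h a (W \<omega>))"
    by (rule integral_cong_AE) (use ae in auto)
  ultimately show ?thesis by (simp add: mult.commute)
qed

lemma second_moment_le:
  assumes [measurable]: "A \<in> sets borel"
  shows "integrable M (\<lambda>\<omega>. (Z a \<omega> * indicator A (W \<omega>))\<^sup>2)"
    and "expectation (\<lambda>\<omega>. (Z a \<omega> * indicator A (W \<omega>))\<^sup>2) \<le> C * prob {\<omega> \<in> space M. W \<omega> \<in> A}"
proof -
  let ?Q = "\<lambda>\<omega>. (Z a \<omega>)\<^sup>2"
  have eq: "(\<lambda>\<omega>. (Z a \<omega> * indicator A (W \<omega>))\<^sup>2) = (\<lambda>\<omega>. indicator A (W \<omega>) * ?Q \<omega>)"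
    by (auto simp: indicator_def fun_eq_iff)
  have "integrable M (\<lambda>\<omega>. indicator (W -` A \<inter> space M) \<omega> * ?Q \<omega>)"
    using integrable_mult_indicator[OF _ sq_integrable, of "W -` A \<inter> space M" a] by simp
  then have int: "integrable M (\<lambda>\<omega>. indicator A (W \<omega>) * ?Q \<omega>)"
    by (rule Bochner_Integration.integrable_cong[THEN iffD1, rotated 2]) (auto simp: indicator_def)
  then show "integrable M (\<lambda>\<omega>. (Z a \<omega> * indicator A (W \<omega>))\<^sup>2)" unfolding eq .
  have ind: "integrable M (\<lambda>\<omega>. indicator A (W \<omega>) :: real)"
    by (rule integrable_const_bound[where B=1]) (auto simp: indicator_def)
  have "expectation (\<lambda>\<omega>. indicator A (W \<omega>) * ?Q \<omega>) = expectation (\<lambda>\<omega>. indicator A (W \<omega>) * real_cond_exp M FW ?Q \<omega>)"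
    by (intro cond.real_cond_exp_intg(2)[symmetric] int) auto
  also have "\<dots> \<le> expectation (\<lambda>\<omega>. C * indicator A (W \<omega>))"
  proof (rule integral_mono_AE)
    show "integrable M (\<lambda>\<omega>. indicator A (W \<omega>) * real_cond_exp M FW ?Q \<omega>)"
      by (intro cond.real_cond_exp_intg(1) int) auto
    show "integrable M (\<lambda>\<omega>. C * indicator A (W \<omega>))" using ind by simp
    show "AE \<omega> in M. indicator A (W \<omega>) * real_cond_exp M FW ?Q \<omega> \<le> C * indicator A (W \<omega>)"
      using sq_cexp_le[of a] by (auto simp: cexp_def indicator_def)
  qed
  also have "\<dots> = C * prob {\<omega> \<in> space M. W \<omega> \<in> A}"
  proof -
    have "expectation (\<lambda>\<omega>. indicator A (W \<omega>)) = expectation (indicator {\<omega> \<in> space M. W \<omega> \<in> A} :: _ \<Rightarrow> real)"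
      by (intro Bochner_Integration.integral_cong) (auto simp: indicator_def)
    then show ?thesis by simp
  qed
  finally show "expectation (\<lambda>\<omega>. (Z a \<omega> * indicator A (W \<omega>))\<^sup>2) \<le> C * prob {\<omega> \<in> space M. W \<omega> \<in> A}"
    unfolding eq .
qed

text \<open>
  A bound for all \<open>\<bar>h a\<bar>\<close> on the unit cube: the mean of \<open>h a (W)\<close> is at most \<open>C\<close> in modulus, and the
  Lipschitz condition bounds the oscillation by \<open>C\<close> times the diameter of the cube, for which the
  dimension is a crude bound.
\<close>
definition H :: real where "H = C * (real CARD('d) + 1)"

lemma H_nonneg: "H \<ge> 0" using C_ge_1 by (simp add: H_def)

lemma norm_diff_cube:
  assumes "w1 \<in> cbox 0 1" "w2 \<in> cbox (0 :: real ^ 'd) 1"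
  shows "norm (w1 - w2) \<le> real CARD('d)"
proof -
  have "norm (w1 - w2) \<le> (\<Sum>l\<in>UNIV. \<bar>(w1 - w2) $ l\<bar>)" by (rule norm_le_l1_cart)
  also have "\<dots> \<le> (\<Sum>l\<in>(UNIV :: 'd set). 1)"
  proof (rule sum_mono)
    fix l
    have "0 \<le> w1 $ l" "w1 $ l \<le> 1" "0 \<le> w2 $ l" "w2 $ l \<le> 1"
      using assms by (auto simp: mem_box_cart)
    then show "\<bar>(w1 - w2) $ l\<bar> \<le> 1" by (simp add: abs_le_iff)
  qed
  finally show ?thesis by simp
qed

lemma h_W_integrable: "integrable M (\<lambda>\<omega>. h a (W \<omega>))"
proof -
  obtain \<omega>0 where \<omega>0: "\<omega>0 \<in> space M" using not_empty by auto
  have "\<bar>h a (W \<omega>)\<bar> \<le> \<bar>h a (W \<omega>0)\<bar> + C * real CARD('d)" if "\<omega> \<in> space M" for \<omega>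
  proof -
    have "\<bar>h a (W \<omega>) - h a (W \<omega>0)\<bar> \<le> C * norm (W \<omega> - W \<omega>0)"
      by (intro lipschitz W_cube that \<omega>0)
    also have "\<dots> \<le> C * real CARD('d)"
      using C_ge_1 by (intro mult_left_mono norm_diff_cube W_cube that \<omega>0) auto
    finally show ?thesis by linarith
  qed
  then show ?thesis by (intro integrable_const_bound[where B="\<bar>h a (W \<omega>0)\<bar> + C * real CARD('d)"]) auto
qed

lemma h_bound:
  assumes w: "w \<in> cbox 0 1"
  shows "\<bar>h a w\<bar> \<le> H"
proof -
  have "expectation (\<lambda>\<omega>. h a (W \<omega>)) = expectation (Z a)"
    using integral_h_eq[of UNIV a] by simp
  moreover have "\<bar>expectation (Z a)\<bar> \<le> C"
  proof -
    have "\<bar>expectation (Z a)\<bar> \<le> expectation (\<lambda>\<omega>. \<bar>Z a \<omega>\<bar>)" by (rule integral_abs_bound)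
    also have "\<dots> \<le> expectation (\<lambda>\<omega>. (1 + (Z a \<omega>)\<^sup>2) / 2)"
    proof (rule integral_mono)
      fix \<omega>
      have "(\<bar>Z a \<omega>\<bar> - 1)\<^sup>2 \<ge> 0" by simp
      then show "\<bar>Z a \<omega>\<bar> \<le> (1 + (Z a \<omega>)\<^sup>2) / 2" by (simp add: power2_diff)
    qed (use Z_integrable sq_integrable in auto)
    also have "\<dots> = (1 + expectation (\<lambda>\<omega>. (Z a \<omega>)\<^sup>2)) / 2"
      using sq_integrable[of a] by (simp add: prob_space)
    also have "\<dots> \<le> C"
      using second_moment_le(2)[of UNIV a] C_ge_1 by (simp add: prob_space)
    finally show ?thesis .
  qed
  moreover have "\<bar>h a w - expectation (\<lambda>\<omega>. h a (W \<omega>))\<bar> \<le> C * real CARD('d)"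
  proof -
    have "\<bar>expectation (\<lambda>\<omega>. h a w - h a (W \<omega>))\<bar> \<le> expectation (\<lambda>\<omega>. \<bar>h a w - h a (W \<omega>)\<bar>)"
      by (rule integral_abs_bound)
    also have "\<dots> \<le> expectation (\<lambda>\<omega>. C * real CARD('d))"
    proof (rule integral_mono)
      fix \<omega> assume \<omega>: "\<omega> \<in> space M"
      have "\<bar>h a w - h a (W \<omega>)\<bar> \<le> C * norm (w - W \<omega>)" by (intro lipschitz W_cube w \<omega>)
      also have "\<dots> \<le> C * real CARD('d)"
        using C_ge_1 by (intro mult_left_mono norm_diff_cube W_cube w \<omega>) auto
      finally show "\<bar>h a w - h a (W \<omega>)\<bar> \<le> C * real CARD('d)" .
    qed (use h_W_integrable in auto)
    finally show ?thesis using h_W_integrable by (simp add: prob_space)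
  qed
  ultimately show ?thesis by (simp add: H_def algebra_simps)
qed

definition cell_prob :: "nat \<Rightarrow> ('d \<Rightarrow> nat) \<Rightarrow> real" where
  "cell_prob k j = prob {\<omega> \<in> space M. W \<omega> \<in> cell k j}"

definition cell_mean :: "nat \<Rightarrow> ('d \<Rightarrow> nat) \<Rightarrow> nat \<Rightarrow> real" where
  "cell_mean k j a = expectation (\<lambda>\<omega>. Z a \<omega> * indicator (cell k j) (W \<omega>))"

lemma indicator_W_integrable [simp]:
  assumes [measurable]: "A \<in> sets borel"
  shows "integrable M (\<lambda>\<omega>. indicator A (W \<omega>) :: real)"
  by (rule integrable_const_bound[where B=1]) (auto simp: indicator_def)

lemma expectation_indicator_cell: "expectation (\<lambda>\<omega>. indicator (cell k j) (W \<omega>)) = cell_prob k j"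
proof -
  have "expectation (\<lambda>\<omega>. indicator (cell k j) (W \<omega>)) = expectation (indicator {\<omega> \<in> space M. W \<omega> \<in> cell k j} :: _ \<Rightarrow> real)"
    by (intro Bochner_Integration.integral_cong) (auto simp: indicator_def)
  then show ?thesis by (simp add: cell_prob_def)
qed

lemma cell_prob_nonneg: "cell_prob k j \<ge> 0" by (simp add: cell_prob_def)

lemma integrable_bounded_indicator:
  assumes [measurable]: "m \<in> borel_measurable borel" "A \<in> sets borel"
    and m: "\<And>\<omega>. \<omega> \<in> space M \<Longrightarrow> \<bar>m (W \<omega>)\<bar> \<le> D"
  shows "integrable M (\<lambda>\<omega>. m (W \<omega>) * indicator A (W \<omega>) :: real)"
proof (rule integrable_const_bound[where B="\<bar>D\<bar>"])
  show "AE \<omega> in M. norm (m (W \<omega>) * indicator A (W \<omega>) :: real) \<le> \<bar>D\<bar>"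
    using m by (intro AE_I2) (fastforce simp: indicator_def)
qed measurable

lemma cell_mean_le: "\<bar>cell_mean k j a\<bar> \<le> H * cell_prob k j"
proof -
  have "\<bar>cell_mean k j a\<bar> = \<bar>expectation (\<lambda>\<omega>. h a (W \<omega>) * indicator (cell k j) (W \<omega>))\<bar>"
    unfolding cell_mean_def by (subst integral_h_eq) auto
  also have "\<dots> \<le> expectation (\<lambda>\<omega>. \<bar>h a (W \<omega>) * indicator (cell k j) (W \<omega>)\<bar>)"
    by (rule integral_abs_bound)
  also have "\<dots> \<le> expectation (\<lambda>\<omega>. H * indicator (cell k j) (W \<omega>))"
  proof (rule integral_mono)
    show "integrable M (\<lambda>\<omega>. \<bar>h a (W \<omega>) * indicator (cell k j) (W \<omega>)\<bar>)"
      by (intro integrable_abs integrable_bounded_indicator[where D=H] h_bound W_cube) auto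
    show "integrable M (\<lambda>\<omega>. H * indicator (cell k j) (W \<omega>))" by simp
  qed (auto simp: indicator_def h_bound W_cube)
  also have "\<dots> = H * cell_prob k j" by (simp add: expectation_indicator_cell)
  finally show ?thesis .
qed

lemma AE_cell_partition:
  assumes k: "k \<ge> 1"
  shows "AE \<omega> in M. (\<Sum>j\<in>cell_indices k. indicator (cell k j) (W \<omega>)) = (1 :: real)"
proof -
  have "AE w :: real ^ 'd in lborel. \<forall>l. w $ l \<notin> (\<lambda>i. real i / real k) ` UNIV"
    by (rule AE_lborel_cart_avoid_countable) auto
  then have "AE w in density lborel fW. \<forall>l. w $ l \<notin> (\<lambda>i. real i / real k) ` UNIV"
    using W_density by (subst AE_density) (auto simp: distributed_def)
  then have "AE w in distr M lborel W. \<forall>l. w $ l \<notin> (\<lambda>i. real i / real k) ` UNIV"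
    by (subst distributed_distr_eq_density[OF W_density])
  then have "AE \<omega> in M. \<forall>l. W \<omega> $ l \<notin> (\<lambda>i. real i / real k) ` UNIV"
    by (rule AE_distrD[rotated]) auto
  then show ?thesis using AE_space
  proof eventually_elim
    case (elim \<omega>)
    have "\<exists>!j. j \<in> cell_indices k \<and> W \<omega> \<in> cell k j"
      using elim by (intro unique_cell W_cube k)
    then obtain j where j: "j \<in> cell_indices k \<and> W \<omega> \<in> cell k j"
        and uniq: "\<forall>j'. j' \<in> cell_indices k \<and> W \<omega> \<in> cell k j' \<longrightarrow> j' = j"
      by (rule ex1E)
    have "(\<Sum>j'\<in>cell_indices k. indicator (cell k j') (W \<omega>) :: real) = (\<Sum>j'\<in>cell_indices k. if j' = j then 1 else 0)"
    proof (rule sum.cong)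
      fix j' :: "'d \<Rightarrow> nat" assume "j' \<in> cell_indices k"
      then have "W \<omega> \<in> cell k j' \<longleftrightarrow> j' = j" using j uniq by blast
      then show "indicator (cell k j') (W \<omega>) = (if j' = j then 1 else 0 :: real)"
        by (simp add: indicator_def)
    qed simp
    then show ?case using j by simp
  qed
qed

lemma sum_cell_prob:
  assumes "k \<ge> 1"
  shows "(\<Sum>j\<in>cell_indices k. cell_prob k j) = 1"
proof -
  have "(\<Sum>j\<in>cell_indices k. cell_prob k j) = expectation (\<lambda>\<omega>. \<Sum>j\<in>cell_indices k. indicator (cell k j) (W \<omega>))"
    by (subst Bochner_Integration.integral_sum) (auto simp: expectation_indicator_cell)
  also have "\<dots> = expectation (\<lambda>\<omega>. 1)"
    by (rule integral_cong_AE) (use AE_cell_partition[OF assms] in auto)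
  finally show ?thesis by (simp add: prob_space)
qed

text \<open>
  Replacing the conditional mean \<open>m(W)\<close> by its averages over the cells changes the population
  criterion by the within-cell variance of \<open>m(W)\<close>. As \<open>m\<close> is Lipschitz and a cell has side
  \<open>1 / k\<close>, this is of order \<open>1 / k\<^sup>2\<close>.
\<close>
lemma cell_criterion_approx:
  fixes \<beta> :: "nat \<Rightarrow> real" and q :: nat
  assumes k: "k \<ge> 1" and pos: "\<And>j. j \<in> cell_indices k \<Longrightarrow> cell_prob k j > 0"
  defines "B \<equiv> \<Sum>a=0..q. \<bar>\<beta> a\<bar>"
  shows "\<bar>expectation (\<lambda>\<omega>. (\<Sum>a=0..q. \<beta> a * h a (W \<omega>))\<^sup>2)
           - (\<Sum>j\<in>cell_indices k. (\<Sum>a=0..q. \<beta> a * cell_mean k j a)\<^sup>2 / cell_prob k j)\<bar>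
         \<le> (B * C * real CARD('d) / real k)\<^sup>2"
proof -
  define m where "m = (\<lambda>w. \<Sum>a=0..q. \<beta> a * h a w)"
  define lam where "lam = B * C * real CARD('d) / real k"
  have [measurable]: "m \<in> borel_measurable borel" unfolding m_def by measurable
  have B0: "B \<ge> 0" by (simp add: B_def sum_nonneg)
  have lam0: "lam \<ge> 0" using B0 C_ge_1 by (simp add: lam_def)
  have m_bound: "\<bar>m w\<bar> \<le> B * H" if "w \<in> cbox 0 1" for w
  proof -
    have "\<bar>m w\<bar> \<le> (\<Sum>a=0..q. \<bar>\<beta> a * h a w\<bar>)" unfolding m_def by (rule sum_abs)
    also have "\<dots> \<le> (\<Sum>a=0..q. \<bar>\<beta> a\<bar> * H)"
      using that by (intro sum_mono) (auto simp: abs_mult intro: mult_left_mono h_bound)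
    finally show ?thesis by (simp add: B_def sum_distrib_right)
  qed
  have m_lip: "\<bar>m w1 - m w2\<bar> \<le> lam"
    if "w1 \<in> cbox 0 1" "w2 \<in> cbox 0 1" "w1 \<in> cell k j" "w2 \<in> cell k j" for w1 w2 j
  proof -
    have "\<bar>m w1 - m w2\<bar> = \<bar>\<Sum>a=0..q. \<beta> a * (h a w1 - h a w2)\<bar>"
      by (simp add: m_def sum_subtractf right_diff_distrib)
    also have "\<dots> \<le> (\<Sum>a=0..q. \<bar>\<beta> a * (h a w1 - h a w2)\<bar>)" by (rule sum_abs)
    also have "\<dots> \<le> (\<Sum>a=0..q. \<bar>\<beta> a\<bar> * (C * (real CARD('d) / real k)))"
    proof (rule sum_mono)
      fix a
      have "\<bar>h a w1 - h a w2\<bar> \<le> C * norm (w1 - w2)" by (rule lipschitz[OF that(1,2)])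
      also have "\<dots> \<le> C * (real CARD('d) / real k)"
        using C_ge_1 norm_le_of_mem_same_cell[OF that(3,4)] by (intro mult_left_mono) auto
      finally show "\<bar>\<beta> a * (h a w1 - h a w2)\<bar> \<le> \<bar>\<beta> a\<bar> * (C * (real CARD('d) / real k))"
        unfolding abs_mult by (rule mult_left_mono) simp
    qed
    also have "\<dots> = lam" unfolding sum_distrib_right[symmetric] by (simp add: lam_def B_def mult.assoc)
    finally show ?thesis .
  qed
  let ?I = "\<lambda>j \<omega>. indicator (cell k j) (W \<omega>) :: real"
  define c where "c = (\<lambda>j. \<Sum>a=0..q. \<beta> a * cell_mean k j a)"
  have int1: "integrable M (\<lambda>\<omega>. m (W \<omega>) * ?I j \<omega>)" for j
    by (rule integrable_bounded_indicator[where D="B * H"]) (auto intro: m_bound W_cube)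
  have int2: "integrable M (\<lambda>\<omega>. (m (W \<omega>))\<^sup>2 * ?I j \<omega>)" for j
  proof (rule integrable_bounded_indicator[where m="\<lambda>w. (m w)\<^sup>2" and D="(B * H)\<^sup>2"])
    fix \<omega> assume "\<omega> \<in> space M"
    then show "\<bar>(m (W \<omega>))\<^sup>2\<bar> \<le> (B * H)\<^sup>2"
      using power_mono[OF m_bound[OF W_cube], of \<omega> 2] by simp
  qed auto
  have c_eq: "c j = expectation (\<lambda>\<omega>. m (W \<omega>) * ?I j \<omega>)" for j
  proof -
    have inth: "integrable M (\<lambda>\<omega>. h a (W \<omega>) * ?I j \<omega>)" for a
      by (rule integrable_bounded_indicator[where D=H]) (auto intro: h_bound W_cube)
    have "expectation (\<lambda>\<omega>. m (W \<omega>) * ?I j \<omega>) = expectation (\<lambda>\<omega>. \<Sum>a=0..q. \<beta> a * (h a (W \<omega>) * ?I j \<omega>))"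
      by (simp add: m_def sum_distrib_right mult.assoc)
    also have "\<dots> = (\<Sum>a=0..q. expectation (\<lambda>\<omega>. \<beta> a * (h a (W \<omega>) * ?I j \<omega>)))"
      using inth by (intro Bochner_Integration.integral_sum) auto
    also have "\<dots> = c j" unfolding c_def cell_mean_def
      by (intro sum.cong refl) (simp add: integral_h_eq)
    finally show ?thesis by simp
  qed
  \<comment> \<open>Within a cell, the gap between the two criteria is the integral over the cell of the squared deviation of \<open>m(W)\<close> from its cell mean.\<close>
  have gap: "0 \<le> expectation (\<lambda>\<omega>. (m (W \<omega>))\<^sup>2 * ?I j \<omega>) - (c j)\<^sup>2 / cell_prob k j \<and>
      expectation (\<lambda>\<omega>. (m (W \<omega>))\<^sup>2 * ?I j \<omega>) - (c j)\<^sup>2 / cell_prob k j \<le> lam\<^sup>2 * cell_prob k j"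
    if j: "j \<in> cell_indices k" for j
  proof -
    let ?v = "cell_prob k j"
    have v: "?v > 0" by (rule pos[OF j])
    define \<mu> where "\<mu> = c j / ?v"
    have dev: "(\<lambda>\<omega>. (m (W \<omega>) - \<mu>)\<^sup>2 * ?I j \<omega>) =
        (\<lambda>\<omega>. (m (W \<omega>))\<^sup>2 * ?I j \<omega> - 2 * \<mu> * (m (W \<omega>) * ?I j \<omega>) + \<mu>\<^sup>2 * ?I j \<omega>)"
      by (simp add: fun_eq_iff power2_diff algebra_simps)
    have devint: "integrable M (\<lambda>\<omega>. (m (W \<omega>) - \<mu>)\<^sup>2 * ?I j \<omega>)"
      unfolding dev using int1[of j] int2[of j] by simp
    have "expectation (\<lambda>\<omega>. (m (W \<omega>) - \<mu>)\<^sup>2 * ?I j \<omega>)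
        = expectation (\<lambda>\<omega>. (m (W \<omega>))\<^sup>2 * ?I j \<omega>) - 2 * \<mu> * c j + \<mu>\<^sup>2 * ?v"
      unfolding dev using int1[of j] int2[of j] by (simp add: c_eq expectation_indicator_cell)
    also have "\<dots> = expectation (\<lambda>\<omega>. (m (W \<omega>))\<^sup>2 * ?I j \<omega>) - (c j)\<^sup>2 / ?v"
      using v by (simp add: \<mu>_def power2_eq_square field_simps)
    finally have eq: "expectation (\<lambda>\<omega>. (m (W \<omega>))\<^sup>2 * ?I j \<omega>) - (c j)\<^sup>2 / ?v = expectation (\<lambda>\<omega>. (m (W \<omega>) - \<mu>)\<^sup>2 * ?I j \<omega>)"
      by simp
    have near: "\<bar>m (W \<omega>) - \<mu>\<bar> \<le> lam" if \<omega>: "\<omega> \<in> space M" "W \<omega> \<in> cell k j" for \<omega>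
    proof -
      have "(m (W \<omega>) - \<mu>) * ?v = expectation (\<lambda>\<omega>'. m (W \<omega>) * ?I j \<omega>' - m (W \<omega>') * ?I j \<omega>')"
        using v int1[of j] by (simp add: \<mu>_def c_eq expectation_indicator_cell algebra_simps)
      then have "\<bar>(m (W \<omega>) - \<mu>) * ?v\<bar> \<le> expectation (\<lambda>\<omega>'. \<bar>m (W \<omega>) * ?I j \<omega>' - m (W \<omega>') * ?I j \<omega>'\<bar>)"
        by simp
      also have "\<dots> \<le> expectation (\<lambda>\<omega>'. lam * ?I j \<omega>')"
      proof (rule integral_mono)
        show "integrable M (\<lambda>\<omega>'. \<bar>m (W \<omega>) * ?I j \<omega>' - m (W \<omega>') * ?I j \<omega>'\<bar>)" using int1[of j] by simp
        show "integrable M (\<lambda>\<omega>'. lam * ?I j \<omega>')" by simp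
        fix \<omega>' assume "\<omega>' \<in> space M"
        then show "\<bar>m (W \<omega>) * ?I j \<omega>' - m (W \<omega>') * ?I j \<omega>'\<bar> \<le> lam * ?I j \<omega>'"
          using m_lip[of "W \<omega>" "W \<omega>'" j] W_cube \<omega> by (cases "W \<omega>' \<in> cell k j") auto
      qed
      also have "\<dots> = lam * ?v" by (simp add: expectation_indicator_cell)
      finally show ?thesis using v by (simp add: abs_mult)
    qed
    have "expectation (\<lambda>\<omega>. (m (W \<omega>) - \<mu>)\<^sup>2 * ?I j \<omega>) \<le> expectation (\<lambda>\<omega>. lam\<^sup>2 * ?I j \<omega>)"
    proof (rule integral_mono)
      fix \<omega> assume "\<omega> \<in> space M"
      then show "(m (W \<omega>) - \<mu>)\<^sup>2 * ?I j \<omega> \<le> lam\<^sup>2 * ?I j \<omega>"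
        using near[of \<omega>] lam0 abs_le_square_iff[of "m (W \<omega>) - \<mu>" lam] by (cases "W \<omega> \<in> cell k j") simp_all
    qed (use devint in auto)
    also have "\<dots> = lam\<^sup>2 * ?v" by (simp add: expectation_indicator_cell)
    finally show ?thesis unfolding eq by (simp add: integral_nonneg)
  qed
  have "expectation (\<lambda>\<omega>. (m (W \<omega>))\<^sup>2) = expectation (\<lambda>\<omega>. \<Sum>j\<in>cell_indices k. (m (W \<omega>))\<^sup>2 * ?I j \<omega>)"
  proof (rule integral_cong_AE)
    show "AE \<omega> in M. (m (W \<omega>))\<^sup>2 = (\<Sum>j\<in>cell_indices k. (m (W \<omega>))\<^sup>2 * ?I j \<omega>)"
      using AE_cell_partition[OF k] by eventually_elim (simp add: sum_distrib_left[symmetric])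
  qed measurable
  also have "\<dots> = (\<Sum>j\<in>cell_indices k. expectation (\<lambda>\<omega>. (m (W \<omega>))\<^sup>2 * ?I j \<omega>))"
    by (rule Bochner_Integration.integral_sum) (rule int2)
  finally have total: "expectation (\<lambda>\<omega>. (m (W \<omega>))\<^sup>2) - (\<Sum>j\<in>cell_indices k. (c j)\<^sup>2 / cell_prob k j)
      = (\<Sum>j\<in>cell_indices k. expectation (\<lambda>\<omega>. (m (W \<omega>))\<^sup>2 * ?I j \<omega>) - (c j)\<^sup>2 / cell_prob k j)" (is "?lhs = ?rhs")
    by (simp only: sum_subtractf)
  have "?rhs \<ge> 0" by (intro sum_nonneg gap[THEN conjunct1])
  moreover have "?rhs \<le> (\<Sum>j\<in>cell_indices k. lam\<^sup>2 * cell_prob k j)" by (intro sum_mono gap[THEN conjunct2])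
  moreover have "\<dots> = lam\<^sup>2" using sum_cell_prob[OF k] by (simp add: sum_distrib_left[symmetric])
  ultimately have "\<bar>?lhs\<bar> \<le> lam\<^sup>2" using total by linarith
  then show ?thesis unfolding m_def c_def lam_def .
qed

end

section \<open>The empirical criterion\<close>

context iv_moments begin

definition emp_mean where
  "emp_mean Ys Xs Ws n k j a \<omega> =
     1 / real n * (\<Sum>i=1..n. regressor (Ys i) (Xs i) \<phi> a \<omega> * indicator (cell k j) (Ws i \<omega> :: real ^ 'd))"

text \<open>
  The total relative deviation of all empirical cell means and cell frequencies. It is the only
  random quantity on which the comparison of the two criteria depends, and it bounds that
  comparison for all coefficient vectors at once.
\<close>
definition cell_dev where
  "cell_dev Ys Xs Ws n k q \<omega> =
     (\<Sum>j\<in>cell_indices k. \<bar>v_hat Ws n k j \<omega> - cell_prob k j\<bar> / cell_prob k j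
        + (\<Sum>a=0..q. \<bar>emp_mean Ys Xs Ws n k j a \<omega> - cell_mean k j a\<bar> / cell_prob k j))"

text \<open>
  Each of the \<open>q + 2\<close> relative deviations in a cell has mean at most a multiple of
  \<open>1 / sqrt (n v)\<close>, where the cell probability \<open>v\<close> is at least of order \<open>k ^ (- d)\<close>; summing over the
  \<open>k ^ d\<close> cells gives the factor \<open>k ^ (3 d / 2) / sqrt n\<close> of the rate condition.
\<close>
lemma expectation_cell_dev_le:
  fixes Ys :: "nat \<Rightarrow> 'a \<Rightarrow> real" and Xs :: "nat \<Rightarrow> 'a \<Rightarrow> 'x" and Ws :: "nat \<Rightarrow> 'a \<Rightarrow> real ^ 'd"
  assumes N1: "N1 M Y X W Ys Xs Ws" and n: "n \<ge> 1" and k: "k \<ge> 1"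
    and K: "K > 0" "\<And>j. j \<in> cell_indices k \<Longrightarrow> 1 / real k ^ CARD('d) \<le> K * cell_prob k j"
  shows "integrable M (cell_dev Ys Xs Ws n k q)"
    and "expectation (cell_dev Ys Xs Ws n k q)
           \<le> (real q + 2) * sqrt (C * K) * (real k powr (3 * real CARD('d) / 2) / sqrt (real n))"
proof -
  define kd where "kd = real k ^ CARD('d)"
  have kd: "kd > 0" using k by (simp add: kd_def)
  have pos: "cell_prob k j > 0" if "j \<in> cell_indices k" for j
  proof -
    have "0 < 1 / kd" using kd by simp
    also have "\<dots> \<le> K * cell_prob k j" using K(2)[OF that] by (simp add: kd_def)
    finally show ?thesis using K(1) by (simp add: zero_less_mult_iff)
  qed
  define r where "r = sqrt (C * K) * (sqrt kd / sqrt (real n))"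
  have scale: "sqrt (C * cell_prob k j / real n) / cell_prob k j \<le> r" if j: "j \<in> cell_indices k" for j
  proof -
    let ?v = "cell_prob k j"
    have v: "?v > 0" by (rule pos[OF j])
    have "1 \<le> K * kd * ?v" using K(2)[OF j] kd by (simp add: kd_def field_simps)
    then have "C / (real n * ?v) * 1 \<le> C / (real n * ?v) * (K * kd * ?v)"
      using C_ge_1 n v by (intro mult_left_mono) auto
    then have "C / (real n * ?v) \<le> C * K * kd / real n"
      using v n by (simp add: field_simps)
    have "sqrt (C * ?v / real n) / ?v = sqrt (C * ?v / real n) / sqrt (?v\<^sup>2)" using v by simp
    also have "\<dots> = sqrt (C * ?v / real n / ?v\<^sup>2)" by (simp only: real_sqrt_divide)
    also have "\<dots> = sqrt (C / (real n * ?v))"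
      using v by (simp add: power2_eq_square)
    also have "\<dots> \<le> sqrt (C * K * kd / real n)" by (rule real_sqrt_le_mono) fact
    also have "\<dots> = r" by (simp add: r_def real_sqrt_mult real_sqrt_divide)
    finally show ?thesis .
  qed
  have r_nonneg: "r \<ge> 0" using C_ge_1 K kd by (simp add: r_def)
  have snd_snd: "(\<lambda>z :: real \<times> 'x \<times> (real ^ 'd). snd (snd z)) \<in> borel_measurable borel"
    by (intro borel_measurable_continuous_onI continuous_intros)
  have fst_snd: "(\<lambda>z :: real \<times> 'x \<times> (real ^ 'd). fst (snd z)) \<in> borel_measurable borel"
    by (intro borel_measurable_continuous_onI continuous_intros)
  let ?e = "\<lambda>j \<omega>. \<bar>v_hat Ws n k j \<omega> - cell_prob k j\<bar>"
  let ?d = "\<lambda>j a \<omega>. \<bar>emp_mean Ys Xs Ws n k j a \<omega> - cell_mean k j a\<bar>"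
  have e: "integrable M (?e j) \<and> expectation (?e j) \<le> sqrt (C * cell_prob k j / real n)"
    if j: "j \<in> cell_indices k" for j
  proof -
    let ?f = "\<lambda>z :: real \<times> 'x \<times> (real ^ 'd). indicator (cell k j) (snd (snd z)) :: real"
    have f: "?f \<in> borel_measurable borel"
      by (rule measurable_compose[OF snd_snd]) simp
    have sq: "(\<lambda>\<omega>. (?f (Y \<omega>, X \<omega>, W \<omega>))\<^sup>2) = (\<lambda>\<omega>. indicator (cell k j) (W \<omega>))"
      by (auto simp: indicator_def fun_eq_iff)
    have le: "expectation (\<lambda>\<omega>. (?f (Y \<omega>, X \<omega>, W \<omega>))\<^sup>2) \<le> C * cell_prob k j"
      unfolding sq expectation_indicator_cell using C_ge_1 cell_prob_nonneg[of k j] mult_right_mono[of 1 C] by simp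
    have int: "integrable M (\<lambda>\<omega>. (?f (Y \<omega>, X \<omega>, W \<omega>))\<^sup>2)" unfolding sq by simp
    show ?thesis
      using N1_mean_abs_dev_le[OF N1 n _ _ _ f int le]
      by (simp add: v_hat_def expectation_indicator_cell)
  qed
  have d: "integrable M (?d j a) \<and> expectation (?d j a) \<le> sqrt (C * cell_prob k j / real n)"
    if j: "j \<in> cell_indices k" for j a
  proof -
    let ?f = "\<lambda>z :: real \<times> 'x \<times> (real ^ 'd). regressor fst (fst \<circ> snd) \<phi> a z * indicator (cell k j) (snd (snd z))"
    have ind: "(\<lambda>z :: real \<times> 'x \<times> (real ^ 'd). indicator (cell k j) (snd (snd z)) :: real) \<in> borel_measurable borel"
      by (rule measurable_compose[OF snd_snd]) simp
    have "(\<lambda>z :: real \<times> 'x \<times> (real ^ 'd). regressor fst (fst \<circ> snd) \<phi> a z) \<in> borel_measurable borel"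
    proof (cases "a = 0")
      case True
      then show ?thesis unfolding regressor_def
        by (auto intro!: borel_measurable_continuous_onI continuous_intros)
    next
      case False
      have "(\<lambda>z :: real \<times> 'x \<times> (real ^ 'd). \<phi> a (fst (snd z))) \<in> borel_measurable borel"
        by (rule measurable_compose[OF fst_snd \<phi>_meas]) (use False in simp)
      then show ?thesis using False by (simp add: regressor_def)
    qed
    then have f: "?f \<in> borel_measurable borel" using ind by (rule borel_measurable_times)
    have fO: "?f (y \<omega>, x \<omega>, w \<omega>) = regressor y x \<phi> a \<omega> * indicator (cell k j) (w \<omega>)"
      for \<omega> and y :: "'a \<Rightarrow> real" and x :: "'a \<Rightarrow> 'x" and w :: "'a \<Rightarrow> real ^ 'd"
      by (simp add: regressor_def)
    show ?thesis
      using N1_mean_abs_dev_le[OF N1 n _ _ _ f, of "C * cell_prob k j"] second_moment_le[of "cell k j" a]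
      unfolding fO emp_mean_def cell_mean_def by (simp add: cell_prob_def)
  qed
  have int: "integrable M (\<lambda>\<omega>. ?e j \<omega> / cell_prob k j + (\<Sum>a=0..q. ?d j a \<omega> / cell_prob k j))"
    if "j \<in> cell_indices k" for j
    using e[OF that] d[OF that] by (intro Bochner_Integration.integrable_add Bochner_Integration.integrable_sum integrable_divide) auto
  show "integrable M (cell_dev Ys Xs Ws n k q)"
    unfolding cell_dev_def by (rule Bochner_Integration.integrable_sum) (rule int)
  have "expectation (cell_dev Ys Xs Ws n k q)
      = (\<Sum>j\<in>cell_indices k. expectation (\<lambda>\<omega>. ?e j \<omega> / cell_prob k j + (\<Sum>a=0..q. ?d j a \<omega> / cell_prob k j)))"
    unfolding cell_dev_def by (rule Bochner_Integration.integral_sum) (rule int)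
  also have "\<dots> \<le> (\<Sum>j\<in>(cell_indices k :: ('d \<Rightarrow> nat) set). (real q + 2) * r)"
  proof (rule sum_mono)
    fix j :: "'d \<Rightarrow> nat" assume j: "j \<in> cell_indices k"
    have v: "cell_prob k j > 0" by (rule pos[OF j])
    have "expectation (\<lambda>\<omega>. ?e j \<omega> / cell_prob k j + (\<Sum>a=0..q. ?d j a \<omega> / cell_prob k j))
        = expectation (?e j) / cell_prob k j + (\<Sum>a=0..q. expectation (?d j a) / cell_prob k j)"
      using e[OF j] d[OF j]
      by (subst Bochner_Integration.integral_add)
        (auto intro!: Bochner_Integration.integrable_sum integrable_divide sum.cong simp: Bochner_Integration.integral_sum)
    also have "\<dots> \<le> r + (\<Sum>a=0..q. r)"
    proof (intro add_mono sum_mono)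
      have "expectation (?e j) / cell_prob k j \<le> sqrt (C * cell_prob k j / real n) / cell_prob k j"
        using e[OF j] v by (intro divide_right_mono) auto
      then show "expectation (?e j) / cell_prob k j \<le> r" using scale[OF j] by linarith
      fix a
      have "expectation (?d j a) / cell_prob k j \<le> sqrt (C * cell_prob k j / real n) / cell_prob k j"
        using d[OF j] v by (intro divide_right_mono) auto
      then show "expectation (?d j a) / cell_prob k j \<le> r" using scale[OF j] by linarith
    qed
    also have "\<dots> = (real q + 2) * r" by (simp add: algebra_simps)
    finally show "expectation (\<lambda>\<omega>. ?e j \<omega> / cell_prob k j + (\<Sum>a=0..q. ?d j a \<omega> / cell_prob k j)) \<le> (real q + 2) * r" .
  qed
  also have "\<dots> = (real q + 2) * sqrt (C * K) * (kd * sqrt kd / sqrt (real n))"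
    by (simp add: card_cell_indices kd_def r_def)
  also have "kd * sqrt kd = real k powr (3 * real CARD('d) / 2)"
  proof -
    have "real k powr (3 * real CARD('d) / 2) = real k powr real CARD('d) * (real k powr real CARD('d)) powr (1/2)"
      unfolding powr_powr powr_add[symmetric] by (simp add: field_simps)
    also have "real k powr real CARD('d) = kd"
      using k by (simp add: kd_def powr_realpow)
    also have "kd powr (1/2) = sqrt kd" using kd by (simp add: powr_half_sqrt)
    finally show ?thesis by simp
  qed
  finally show "expectation (cell_dev Ys Xs Ws n k q)
           \<le> (real q + 2) * sqrt (C * K) * (real k powr (3 * real CARD('d) / 2) / sqrt (real n))" .
qed

lemma sum_residual_coef_squared_le:
  "(\<Sum>a=0..q. \<bar>residual_coef b a\<bar>)\<^sup>2 \<le> (real q + 1) * (1 + (\<Sum>i=1..q. (b i)\<^sup>2))"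
proof -
  have "(\<Sum>a=0..q. \<bar>residual_coef b a\<bar>)\<^sup>2 \<le> (\<Sum>a=0..q. (\<bar>residual_coef b a\<bar>)\<^sup>2) * real (card {0..q})"
    by (rule sum_squared_le_sum_of_squares)
  also have "(\<Sum>a=0..q. (\<bar>residual_coef b a\<bar>)\<^sup>2) = 1 + (\<Sum>i=1..q. (b i)\<^sup>2)"
    by (simp add: sum.atLeast_Suc_atMost residual_coef_def)
  finally show ?thesis by (simp add: mult.commute add.commute)
qed

text \<open>
  The stochastic error (from the cell means) and the discretisation error (from the Lipschitz
  condition) together, with the factor \<open>1 + \<Sum> b\<^sub>i\<^sup>2\<close> that lets the estimate hold on the whole
  coefficient space.
\<close>
lemma G_bar_approx:
  fixes Ys :: "nat \<Rightarrow> 'a \<Rightarrow> real" and Xs :: "nat \<Rightarrow> 'a \<Rightarrow> 'x" and Ws :: "nat \<Rightarrow> 'a \<Rightarrow> real ^ 'd"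
  assumes k: "k \<ge> 1" and pos: "\<And>j. j \<in> cell_indices k \<Longrightarrow> cell_prob k j > 0"
    and dev: "cell_dev Ys Xs Ws n k q \<omega> \<le> S" and S: "S \<le> 1/2"
  shows "\<bar>G_bar Ys Xs Ws n k (sieve_fun \<phi> q b) \<omega>
           - expectation (\<lambda>\<omega>. (\<Sum>a=0..q. residual_coef b a * h a (W \<omega>))\<^sup>2)\<bar>
         \<le> (real q + 1) * (1 + (\<Sum>i=1..q. (b i)\<^sup>2)) * (2 * (H + 1)\<^sup>2 * S + (C * real CARD('d) / real k)\<^sup>2)"
proof -
  let ?\<beta> = "residual_coef b"
  define B where "B = (\<Sum>a=0..q. \<bar>?\<beta> a\<bar>)"
  have B0: "B \<ge> 0" by (simp add: B_def sum_nonneg)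
  let ?e = "\<lambda>j. \<bar>v_hat Ws n k j \<omega> - cell_prob k j\<bar>"
  let ?d = "\<lambda>j a. \<bar>emp_mean Ys Xs Ws n k j a \<omega> - cell_mean k j a\<bar>"
  have S0: "0 \<le> S"
    by (rule order_trans[OF _ dev]) (auto simp: cell_dev_def cell_prob_nonneg intro!: sum_nonneg add_nonneg_nonneg)
  have summand: "?e j / cell_prob k j + (\<Sum>a=0..q. ?d j a / cell_prob k j) \<le> S" if "j \<in> cell_indices k" for j
  proof -
    have "?e j / cell_prob k j + (\<Sum>a=0..q. ?d j a / cell_prob k j) \<le> cell_dev Ys Xs Ws n k q \<omega>"
      unfolding cell_dev_def using that
      by (intro member_le_sum[where f="\<lambda>j. ?e j / cell_prob k j + (\<Sum>a=0..q. ?d j a / cell_prob k j)"])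
        (auto simp: cell_prob_nonneg intro!: sum_nonneg add_nonneg_nonneg)
    then show ?thesis using dev by linarith
  qed
  have e: "?e j \<le> S * cell_prob k j" if j: "j \<in> cell_indices k" for j
  proof -
    have "?e j / cell_prob k j \<le> S"
      by (rule order_trans[OF _ summand[OF j]]) (auto simp: cell_prob_nonneg intro!: sum_nonneg)
    then show ?thesis using pos[OF j] by (simp add: field_simps)
  qed
  have d: "?d j a \<le> S * cell_prob k j" if j: "j \<in> cell_indices k" and a: "a \<in> {0..q}" for j a
  proof -
    have "?d j a / cell_prob k j \<le> (\<Sum>a=0..q. ?d j a / cell_prob k j)"
      by (rule member_le_sum[where f="\<lambda>a. ?d j a / cell_prob k j"]) (use a in \<open>auto simp: cell_prob_nonneg\<close>)
    also have "\<dots> \<le> S"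
      by (rule order_trans[OF _ summand[OF j]]) (auto simp: cell_prob_nonneg)
    finally show ?thesis using pos[OF j] by (simp add: field_simps)
  qed
  let ?c = "\<lambda>j. \<Sum>a=0..q. ?\<beta> a * cell_mean k j a" and ?c' = "\<lambda>j. \<Sum>a=0..q. ?\<beta> a * emp_mean Ys Xs Ws n k j a \<omega>"
  have G_bar: "G_bar Ys Xs Ws n k (sieve_fun \<phi> q b) \<omega> = (\<Sum>j\<in>cell_indices k. (?c' j)\<^sup>2 / v_hat Ws n k j \<omega>)"
  proof -
    have "1 / real n * (\<Sum>i=1..n. (Ys i \<omega> - sieve_fun \<phi> q b (Xs i \<omega>)) * indicator (cell k j) (Ws i \<omega>)) = ?c' j" for j
    proof -
      have "(\<Sum>i=1..n. (Ys i \<omega> - sieve_fun \<phi> q b (Xs i \<omega>)) * indicator (cell k j) (Ws i \<omega>))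
          = (\<Sum>i=1..n. \<Sum>a=0..q. ?\<beta> a * (regressor (Ys i) (Xs i) \<phi> a \<omega> * indicator (cell k j) (Ws i \<omega>)))"
        by (simp add: residual_eq_sum[of "Ys _" \<omega> \<phi> q b "Xs _"] sum_distrib_right mult.assoc)
      also have "\<dots> = (\<Sum>a=0..q. ?\<beta> a * (\<Sum>i=1..n. regressor (Ys i) (Xs i) \<phi> a \<omega> * indicator (cell k j) (Ws i \<omega>)))"
        by (subst sum.swap) (simp only: sum_distrib_left)
      finally show ?thesis by (simp add: emp_mean_def sum_distrib_left mult_ac)
    qed
    then show ?thesis by (simp add: G_bar_def)
  qed
  have cell: "\<bar>(?c' j)\<^sup>2 / v_hat Ws n k j \<omega> - (?c j)\<^sup>2 / cell_prob k j\<bar> \<le> 2 * (H + 1)\<^sup>2 * B\<^sup>2 * S * cell_prob k j"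
    if j: "j \<in> cell_indices k" for j
  proof (rule ratio_perturbation[OF pos[OF j] S0 S B0 H_nonneg e[OF j]])
    have "\<bar>?c j\<bar> \<le> (\<Sum>a=0..q. \<bar>?\<beta> a * cell_mean k j a\<bar>)" by (rule sum_abs)
    also have "\<dots> \<le> (\<Sum>a=0..q. \<bar>?\<beta> a\<bar> * (H * cell_prob k j))"
      unfolding abs_mult by (intro sum_mono mult_left_mono cell_mean_le) auto
    also have "\<dots> = H * B * cell_prob k j" unfolding sum_distrib_right[symmetric] B_def by simp
    finally show "\<bar>?c j\<bar> \<le> H * B * cell_prob k j" .
    have "\<bar>?c' j - ?c j\<bar> = \<bar>\<Sum>a=0..q. ?\<beta> a * (emp_mean Ys Xs Ws n k j a \<omega> - cell_mean k j a)\<bar>"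
      by (simp add: sum_subtractf right_diff_distrib)
    also have "\<dots> \<le> (\<Sum>a=0..q. \<bar>?\<beta> a * (emp_mean Ys Xs Ws n k j a \<omega> - cell_mean k j a)\<bar>)" by (rule sum_abs)
    also have "\<dots> \<le> (\<Sum>a=0..q. \<bar>?\<beta> a\<bar> * (S * cell_prob k j))"
      unfolding abs_mult using d[OF j] by (intro sum_mono mult_left_mono) auto
    also have "\<dots> = B * S * cell_prob k j" unfolding sum_distrib_right[symmetric] B_def by simp
    finally show "\<bar>?c' j - ?c j\<bar> \<le> B * S * cell_prob k j" .
  qed
  have "\<bar>G_bar Ys Xs Ws n k (sieve_fun \<phi> q b) \<omega> - (\<Sum>j\<in>cell_indices k. (?c j)\<^sup>2 / cell_prob k j)\<bar>
      \<le> (\<Sum>j\<in>cell_indices k. \<bar>(?c' j)\<^sup>2 / v_hat Ws n k j \<omega> - (?c j)\<^sup>2 / cell_prob k j\<bar>)"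
    unfolding G_bar sum_subtractf[symmetric] by (rule sum_abs)
  also have "\<dots> \<le> (\<Sum>j\<in>cell_indices k. 2 * (H + 1)\<^sup>2 * B\<^sup>2 * S * cell_prob k j)"
    by (intro sum_mono cell)
  also have "\<dots> = B\<^sup>2 * (2 * (H + 1)\<^sup>2 * S)"
    unfolding sum_distrib_left[symmetric] sum_cell_prob[OF k] by simp
  finally have "\<bar>G_bar Ys Xs Ws n k (sieve_fun \<phi> q b) \<omega>
      - expectation (\<lambda>\<omega>. (\<Sum>a=0..q. ?\<beta> a * h a (W \<omega>))\<^sup>2)\<bar> \<le> B\<^sup>2 * (2 * (H + 1)\<^sup>2 * S) + (B * C * real CARD('d) / real k)\<^sup>2"
    using cell_criterion_approx[OF k pos, where \<beta>="?\<beta>" and q=q] unfolding B_def by linarith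
  also have "\<dots> = B\<^sup>2 * (2 * (H + 1)\<^sup>2 * S + (C * real CARD('d) / real k)\<^sup>2)"
    by (simp add: power_mult_distrib power_divide distrib_left)
  also have "\<dots> \<le> (real q + 1) * (1 + (\<Sum>i=1..q. (b i)\<^sup>2)) * (2 * (H + 1)\<^sup>2 * S + (C * real CARD('d) / real k)\<^sup>2)"
    using S0 sum_residual_coef_squared_le[where b=b and q=q] unfolding B_def by (intro mult_right_mono) auto
  finally show ?thesis .
qed

end

section \<open>Hilbert space geometry and the source condition\<close>

lemma L2_of_measurable: "f \<in> L2_of M X \<Longrightarrow> f \<in> borel_measurable borel"
  by (simp add: L2_of_def)

lemma L2_of_prod_integrable:
  assumes "f \<in> L2_of M X" "g \<in> L2_of M X" and [measurable]: "X \<in> borel_measurable M"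
  shows "integrable M (\<lambda>\<omega>. f (X \<omega>) * g (X \<omega>))"
proof (rule Bochner_Integration.integrable_bound)
  have [measurable]: "f \<in> borel_measurable borel" "g \<in> borel_measurable borel"
    using assms by (auto simp: L2_of_def)
  show "(\<lambda>\<omega>. f (X \<omega>) * g (X \<omega>)) \<in> borel_measurable M" by measurable
  show "integrable M (\<lambda>\<omega>. (f (X \<omega>))\<^sup>2 + (g (X \<omega>))\<^sup>2)"
    using assms by (auto simp: L2_of_def)
  show "AE \<omega> in M. norm (f (X \<omega>) * g (X \<omega>)) \<le> norm ((f (X \<omega>))\<^sup>2 + (g (X \<omega>))\<^sup>2)"
  proof (rule AE_I2)
    fix \<omega>
    have "2 * (\<bar>f (X \<omega>)\<bar> * \<bar>g (X \<omega>)\<bar>) \<le> (f (X \<omega>))\<^sup>2 + (g (X \<omega>))\<^sup>2"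
      using sum_squares_bound[of "\<bar>f (X \<omega>)\<bar>" "\<bar>g (X \<omega>)\<bar>"] by (simp add: mult.assoc)
    moreover have "0 \<le> \<bar>f (X \<omega>)\<bar> * \<bar>g (X \<omega>)\<bar>" by simp
    ultimately have "\<bar>f (X \<omega>)\<bar> * \<bar>g (X \<omega>)\<bar> \<le> (f (X \<omega>))\<^sup>2 + (g (X \<omega>))\<^sup>2"
      by linarith
    then show "norm (f (X \<omega>) * g (X \<omega>)) \<le> norm ((f (X \<omega>))\<^sup>2 + (g (X \<omega>))\<^sup>2)"
      by (simp add: abs_mult)
  qed
qed

lemma L2_of_scale_add:
  assumes "f \<in> L2_of M X" "g \<in> L2_of M X" and X: "X \<in> borel_measurable M"
  shows "(\<lambda>x. f x + c * g x) \<in> L2_of M X"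
proof -
  have [measurable]: "f \<in> borel_measurable borel" "g \<in> borel_measurable borel"
    using assms by (auto simp: L2_of_def)
  have "(\<lambda>\<omega>. (f (X \<omega>) + c * g (X \<omega>))\<^sup>2)
      = (\<lambda>\<omega>. (f (X \<omega>))\<^sup>2 + 2 * c * (f (X \<omega>) * g (X \<omega>)) + c\<^sup>2 * (g (X \<omega>))\<^sup>2)"
    by (simp add: fun_eq_iff power2_sum power_mult_distrib algebra_simps)
  moreover have "integrable M \<dots>"
    using L2_of_prod_integrable[OF assms] assms by (auto simp: L2_of_def)
  ultimately show ?thesis by (simp add: L2_of_def)
qed

lemma inner_X_scale_add_left:
  assumes "f \<in> L2_of M X" "g \<in> L2_of M X" "e \<in> L2_of M X" "X \<in> borel_measurable M"
  shows "inner_X M X (\<lambda>x. f x + c * g x) e = inner_X M X f e + c * inner_X M X g e"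
  using L2_of_prod_integrable[OF assms(1,3,4)] L2_of_prod_integrable[OF assms(2,3,4)]
  by (simp add: inner_X_def distrib_right mult.assoc)

lemma norm_s_power2: "(norm_s M X f)\<^sup>2 = inner_X M X f f"
  by (simp add: norm_s_def inner_X_def power2_eq_square[symmetric] integral_nonneg)

locale L2_basis =
  fixes M :: "'a measure" and X :: "'a \<Rightarrow> 'x::topological_space" and \<phi> :: "nat \<Rightarrow> 'x \<Rightarrow> real"
  assumes X: "X \<in> borel_measurable M"
    and \<phi>_L2: "\<And>i. i \<ge> 1 \<Longrightarrow> \<phi> i \<in> L2_of M X"
    and orth: "\<And>i j. i \<ge> 1 \<Longrightarrow> j \<ge> 1 \<Longrightarrow> inner_X M X (\<phi> i) (\<phi> j) = (if i = j then 1 else 0)"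
begin

lemma zero_L2: "(\<lambda>x. 0) \<in> L2_of M X" by (simp add: L2_of_def)

lemma sieve_fun_Suc: "sieve_fun \<phi> (Suc m) b = (\<lambda>x. sieve_fun \<phi> m b x + b (Suc m) * \<phi> (Suc m) x)"
  by (simp add: sieve_fun_def fun_eq_iff)

lemma sieve_fun_0: "sieve_fun \<phi> 0 b = (\<lambda>x. 0)"
  by (simp add: sieve_fun_def fun_eq_iff)

lemma sieve_fun_L2: "sieve_fun \<phi> m b \<in> L2_of M X"
proof (induction m)
  case 0
  then show ?case by (simp add: sieve_fun_0 zero_L2)
next
  case (Suc m)
  then show ?case unfolding sieve_fun_Suc by (intro L2_of_scale_add X \<phi>_L2) auto
qed

lemma inner_sieve_fun:
  assumes f: "f \<in> L2_of M X"
  shows "inner_X M X (sieve_fun \<phi> m b) f = (\<Sum>i=1..m. b i * inner_X M X (\<phi> i) f)"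
proof (induction m)
  case 0
  then show ?case by (simp add: sieve_fun_0 inner_X_def)
next
  case (Suc m)
  then show ?case unfolding sieve_fun_Suc
    by (subst inner_X_scale_add_left) (auto intro: sieve_fun_L2 \<phi>_L2 f X)
qed

lemma inner_commute: "inner_X M X f g = inner_X M X g f"
  by (simp add: inner_X_def mult.commute)

lemma inner_sieve_fun_basis:
  assumes "i \<in> {1..m}"
  shows "inner_X M X (sieve_fun \<phi> m b) (\<phi> i) = b i"
proof -
  have "inner_X M X (sieve_fun \<phi> m b) (\<phi> i) = (\<Sum>l=1..m. b l * inner_X M X (\<phi> l) (\<phi> i))"
    using assms by (intro inner_sieve_fun \<phi>_L2) auto
  also have "\<dots> = (\<Sum>l=1..m. if l = i then b i else 0)"
    using assms by (intro sum.cong) (auto simp: orth)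
  finally show ?thesis using assms by simp
qed

lemma norm_sieve_fun: "(norm_s M X (sieve_fun \<phi> m b))\<^sup>2 = (\<Sum>i=1..m. (b i)\<^sup>2)"
  unfolding norm_s_power2 inner_sieve_fun[OF sieve_fun_L2]
  by (intro sum.cong refl) (simp add: inner_commute[of "\<phi> _"] inner_sieve_fun_basis power2_eq_square)

lemma bessel:
  assumes f: "f \<in> L2_of M X"
  shows "(\<Sum>i=1..m. (inner_X M X f (\<phi> i))\<^sup>2) \<le> (norm_s M X f)\<^sup>2"
proof -
  define b where "b = (\<lambda>i. inner_X M X f (\<phi> i))"
  let ?s = "sieve_fun \<phi> m b"
  have s: "?s \<in> L2_of M X" by (rule sieve_fun_L2)
  have r: "(\<lambda>x. f x + (-1) * ?s x) \<in> L2_of M X" by (rule L2_of_scale_add[OF f s X])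
  have sf: "inner_X M X ?s f = (\<Sum>i=1..m. (b i)\<^sup>2)"
    unfolding inner_sieve_fun[OF f] by (simp add: b_def inner_commute[of "\<phi> _"] power2_eq_square)
  have "0 \<le> inner_X M X (\<lambda>x. f x + (-1) * ?s x) (\<lambda>x. f x + (-1) * ?s x)"
    unfolding norm_s_power2[symmetric] by simp
  also have "\<dots> = inner_X M X f (\<lambda>x. f x + (-1) * ?s x) + (-1) * inner_X M X ?s (\<lambda>x. f x + (-1) * ?s x)"
    by (rule inner_X_scale_add_left[OF f s r X])
  also have "inner_X M X f (\<lambda>x. f x + (-1) * ?s x) = inner_X M X f f + (-1) * inner_X M X ?s f"
    by (subst inner_commute) (rule inner_X_scale_add_left[OF f s f X])
  also have "inner_X M X ?s (\<lambda>x. f x + (-1) * ?s x) = inner_X M X f ?s + (-1) * inner_X M X ?s ?s"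
    by (subst inner_commute) (rule inner_X_scale_add_left[OF f s s X])
  also have "inner_X M X f ?s = inner_X M X ?s f" by (rule inner_commute)
  also have "inner_X M X ?s ?s = (\<Sum>i=1..m. (b i)\<^sup>2)" unfolding norm_s_power2[symmetric] norm_sieve_fun ..
  finally have "(\<Sum>i=1..m. (b i)\<^sup>2) \<le> (norm_s M X f)\<^sup>2" unfolding sf norm_s_power2 by simp
  then show ?thesis by (simp add: b_def)
qed

lemma norm_s_diff_le:
  assumes f: "f \<in> L2_of M X" and g: "g \<in> L2_of M X" and e: "e \<in> L2_of M X"
  shows "(norm_s M X (\<lambda>x. f x - e x))\<^sup>2 \<le> 2 * (norm_s M X (\<lambda>x. f x - g x))\<^sup>2 + 2 * (norm_s M X (\<lambda>x. g x - e x))\<^sup>2"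
proof -
  have int: "integrable M (\<lambda>\<omega>. (f' (X \<omega>) - g' (X \<omega>))\<^sup>2)" if "f' \<in> L2_of M X" "g' \<in> L2_of M X" for f' g'
    using L2_of_scale_add[OF that X, of "-1"] by (simp add: L2_of_def)
  have "(\<integral>\<omega>. (f (X \<omega>) - e (X \<omega>))\<^sup>2 \<partial>M) \<le> (\<integral>\<omega>. 2 * (f (X \<omega>) - g (X \<omega>))\<^sup>2 + 2 * (g (X \<omega>) - e (X \<omega>))\<^sup>2 \<partial>M)"
  proof (rule integral_mono)
    fix \<omega>
    show "(f (X \<omega>) - e (X \<omega>))\<^sup>2 \<le> 2 * (f (X \<omega>) - g (X \<omega>))\<^sup>2 + 2 * (g (X \<omega>) - e (X \<omega>))\<^sup>2"
      using sum_squares_bound[of "f (X \<omega>) - g (X \<omega>)" "g (X \<omega>) - e (X \<omega>)"]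
      by (simp add: power2_eq_square algebra_simps)
  qed (use int f g e in auto)
  then show ?thesis using int f g e by (simp add: norm_s_def integral_nonneg)
qed

end

text \<open>
  For decreasing weights a series is controlled by the weight at the truncation point: from below
  by its first \<open>q\<close> terms, from above if these terms vanish. Summability has to be established, since
  \<open>suminf\<close> is unspecified on divergent series.
\<close>
lemma weighted_series_bounds:
  fixes w c :: "nat \<Rightarrow> real"
  assumes w: "\<And>i. w i \<ge> 0" and dec: "\<And>i j. i \<le> j \<Longrightarrow> w j \<le> w i"
    and c: "\<And>i. c i \<ge> 0" and bound: "\<And>m. (\<Sum>i<m. c i) \<le> D" and q: "q \<ge> 1"
  shows "w (q - 1) * (\<Sum>i<q. c i) \<le> (\<Sum>i. w i * c i)"
    and "(\<And>i. i < q \<Longrightarrow> c i = 0) \<Longrightarrow> (\<Sum>i. w i * c i) \<le> w (q - 1) * D"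
proof -
  have sc: "summable c"
    by (rule bounded_imp_summable[where B=D]) (use c bound[of "Suc _"] in \<open>auto simp: lessThan_Suc_atMost\<close>)
  have s: "summable (\<lambda>i. w i * c i)"
    by (rule summable_comparison_test'[where g="\<lambda>i. w 0 * c i" and N=0])
      (auto intro!: summable_mult sc mult_right_mono simp: abs_mult w c dec)
  have "w (q - 1) * (\<Sum>i<q. c i) \<le> (\<Sum>i<q. w i * c i)"
    unfolding sum_distrib_left by (intro sum_mono mult_right_mono dec c) auto
  also have "\<dots> \<le> (\<Sum>i. w i * c i)"
    by (rule sum_le_suminf[OF s]) (auto simp: w c)
  finally show "w (q - 1) * (\<Sum>i<q. c i) \<le> (\<Sum>i. w i * c i)" .
  assume z: "\<And>i. i < q \<Longrightarrow> c i = 0"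
  have "(\<Sum>i. w i * c i) \<le> (\<Sum>i. w (q - 1) * c i)"
  proof (rule suminf_le[OF _ s summable_mult[OF sc]])
    fix i
    show "w i * c i \<le> w (q - 1) * c i"
      using z[of i] dec[of "q - 1" i] c[of i] q by (cases "i < q") (auto intro: mult_right_mono)
  qed
  also have "\<dots> = w (q - 1) * (\<Sum>i. c i)" by (rule suminf_mult[OF sc])
  also have "\<dots> \<le> w (q - 1) * D"
    by (intro mult_left_mono suminf_le_const sc bound w)
  finally show "(\<Sum>i. w i * c i) \<le> w (q - 1) * D" .
qed

text \<open>
  Both sums weigh the generalised Fourier coefficients of a difference by \<open>vphi (\<eta>\<^sub>j\<^sup>2)\<close>, which
  decreases in \<open>j\<close>. Since \<open>bstar\<close> gives the orthogonal projection of \<open>g0\<close>, the first \<open>q\<close> coefficients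
  of \<open>g\<^sub>b - g\<^sub>0\<close> are \<open>b i - bstar i\<close>, and those of the approximation error vanish.
\<close>
lemma (in L2_basis) source_condition_bounds:
  fixes \<eta> bstar :: "nat \<Rightarrow> real" and vphi :: "real \<Rightarrow> real"
  assumes g0: "g0 \<in> L2_of M X" and q: "q \<ge> 1"
    and proj: "\<And>b. inner_X M X (\<lambda>x. g0 x - sieve_fun \<phi> q bstar x) (sieve_fun \<phi> q b) = 0"
    and \<eta>: "\<And>j. j \<ge> 1 \<Longrightarrow> \<eta> j > 0" "strict_antimono_on {1..} \<eta>"
    and vphi: "mono_on {0<..} vphi" "\<And>t. t > 0 \<Longrightarrow> vphi t > 0"
  shows "vphi ((\<eta> q)\<^sup>2) * (\<Sum>i=1..q. (b i - bstar i)\<^sup>2)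
           \<le> (\<Sum>i. vphi ((\<eta> (Suc i))\<^sup>2) * \<bar>inner_X M X (\<lambda>x. sieve_fun \<phi> q b x - g0 x) (\<phi> (Suc i))\<bar>\<^sup>2)"
    and "(\<Sum>i. vphi ((\<eta> (Suc i))\<^sup>2) * \<bar>inner_X M X (\<lambda>x. g0 x - sieve_fun \<phi> q bstar x) (\<phi> (Suc i))\<bar>\<^sup>2)
           \<le> vphi ((\<eta> q)\<^sup>2) * (norm_s M X (\<lambda>x. sieve_fun \<phi> q bstar x - g0 x))\<^sup>2"
proof -
  let ?w = "\<lambda>i. vphi ((\<eta> (Suc i))\<^sup>2)"
  have w0: "?w i \<ge> 0" for i using \<eta>(1)[of "Suc i"] by (intro less_imp_le vphi(2)) simp
  have dec: "?w j \<le> ?w i" if "i \<le> j" for i j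
  proof (cases "i = j")
    case False
    then have "\<eta> (Suc j) < \<eta> (Suc i)" using \<eta>(2) that by (auto simp: monotone_on_def)
    then have "(\<eta> (Suc j))\<^sup>2 \<le> (\<eta> (Suc i))\<^sup>2" using \<eta>(1)[of "Suc j"] by (intro power_mono) auto
    then show ?thesis using \<eta>(1)[of "Suc j"] \<eta>(1)[of "Suc i"] by (intro mono_onD[OF vphi(1)]) auto
  qed simp
  have wq: "?w (q - 1) = vphi ((\<eta> q)\<^sup>2)" using q by simp
  have shift: "(\<Sum>i<m. f (Suc i)) = (\<Sum>i=1..m. f i)" for f :: "nat \<Rightarrow> real" and m
    by (simp add: sum.atLeast1_atMost_eq)
  have diff_L2: "(\<lambda>x. f x - g x) \<in> L2_of M X" if "f \<in> L2_of M X" "g \<in> L2_of M X" for f g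
    using L2_of_scale_add[OF that X, of "-1"] by simp
  have inner_diff: "inner_X M X (\<lambda>x. f x - g x) e = inner_X M X f e - inner_X M X g e"
    if "f \<in> L2_of M X" "g \<in> L2_of M X" "e \<in> L2_of M X" for f g e
    using inner_X_scale_add_left[OF that X, of "-1"] by simp
  have resid0: "inner_X M X (\<lambda>x. g0 x - sieve_fun \<phi> q bstar x) (\<phi> i) = 0" if i: "i \<in> {1..q}" for i
  proof -
    have "sieve_fun \<phi> q (\<lambda>l. if l = i then 1 else 0) = \<phi> i"
    proof
      fix x
      have "sieve_fun \<phi> q (\<lambda>l. if l = i then 1 else 0) x = (\<Sum>l=1..q. if l = i then \<phi> i x else 0)"
        unfolding sieve_fun_def by (intro sum.cong) auto
      then show "sieve_fun \<phi> q (\<lambda>l. if l = i then 1 else 0) x = \<phi> i x" using i by simp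
    qed
    then show ?thesis using proj[of "\<lambda>l. if l = i then 1 else 0"] by simp
  qed
  have coef: "inner_X M X (\<lambda>x. sieve_fun \<phi> q b x - g0 x) (\<phi> i) = b i - bstar i" if i: "i \<in> {1..q}" for i
  proof -
    have \<phi>i: "\<phi> i \<in> L2_of M X" using i by (intro \<phi>_L2) auto
    have "inner_X M X g0 (\<phi> i) = bstar i"
      using resid0[OF i] inner_sieve_fun_basis[OF i, of bstar] by (simp add: inner_diff[OF g0 sieve_fun_L2 \<phi>i])
    then show ?thesis by (simp add: inner_diff[OF sieve_fun_L2 g0 \<phi>i] inner_sieve_fun_basis[OF i])
  qed
  have bess: "(\<Sum>i<m. \<bar>inner_X M X f (\<phi> (Suc i))\<bar>\<^sup>2) \<le> (norm_s M X f)\<^sup>2" if "f \<in> L2_of M X" for f m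
    using bessel[OF that, of m] shift[of "\<lambda>i. (inner_X M X f (\<phi> i))\<^sup>2" m] by simp
  let ?f = "\<lambda>x. sieve_fun \<phi> q b x - g0 x"
  have "(\<Sum>i<q. \<bar>inner_X M X ?f (\<phi> (Suc i))\<bar>\<^sup>2) = (\<Sum>i=1..q. (b i - bstar i)\<^sup>2)"
    unfolding shift[of "\<lambda>i. \<bar>inner_X M X ?f (\<phi> i)\<bar>\<^sup>2"] by (intro sum.cong) (auto simp: coef)
  then show "vphi ((\<eta> q)\<^sup>2) * (\<Sum>i=1..q. (b i - bstar i)\<^sup>2)
           \<le> (\<Sum>i. ?w i * \<bar>inner_X M X ?f (\<phi> (Suc i))\<bar>\<^sup>2)"
    using weighted_series_bounds(1)[of ?w "\<lambda>i. \<bar>inner_X M X ?f (\<phi> (Suc i))\<bar>\<^sup>2", OF w0 dec _ bess[OF diff_L2[OF sieve_fun_L2 g0]] q]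
    unfolding wq by simp
  let ?g = "\<lambda>x. g0 x - sieve_fun \<phi> q bstar x"
  have "norm_s M X ?g = norm_s M X (\<lambda>x. sieve_fun \<phi> q bstar x - g0 x)"
    by (simp add: norm_s_def power2_commute)
  moreover have "(\<Sum>i. ?w i * \<bar>inner_X M X ?g (\<phi> (Suc i))\<bar>\<^sup>2) \<le> ?w (q - 1) * (norm_s M X ?g)\<^sup>2"
    by (rule weighted_series_bounds(2)[of ?w "\<lambda>i. \<bar>inner_X M X ?g (\<phi> (Suc i))\<bar>\<^sup>2", OF w0 dec _ bess[OF diff_L2[OF g0 sieve_fun_L2]] q])
      (auto simp: resid0)
  ultimately show "(\<Sum>i. ?w i * \<bar>inner_X M X ?g (\<phi> (Suc i))\<bar>\<^sup>2)
      \<le> vphi ((\<eta> q)\<^sup>2) * (norm_s M X (\<lambda>x. sieve_fun \<phi> q bstar x - g0 x))\<^sup>2"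
    unfolding wq by simp
qed

text \<open>
  Since \<open>Y - g\<^sub>0(X)\<close> has conditional mean zero, \<open>g\<^sub>b - g\<^sub>0\<close> and \<open>g\<^sub>b - Y\<close> have the same projection on
  functions of \<open>W\<close>. The weak norm is therefore the population criterion.
\<close>
lemma (in iv_moments) norm_w_sieve_eq:
  assumes model: "\<And>\<omega>. \<omega> \<in> space M \<Longrightarrow> Y \<omega> = g0 (X \<omega>) + eps \<omega>"
    and eps: "integrable M eps" "AE \<omega> in M. cexp M W eps \<omega> = 0"
    and g0[measurable]: "g0 \<in> borel_measurable borel"
  shows "(norm_w M X W (\<lambda>x. sieve_fun \<phi> q b x - g0 x))\<^sup>2 = expectation (\<lambda>\<omega>. (\<Sum>a=0..q. residual_coef b a * h a (W \<omega>))\<^sup>2)"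
proof -
  let ?\<beta> = "residual_coef b"
  let ?R = "\<lambda>\<omega>. \<Sum>a=0..q. ?\<beta> a * Z a \<omega>"
  have [measurable]: "eps \<in> borel_measurable M" using eps(1) by auto
  have [measurable]: "(\<lambda>\<omega>. sieve_fun \<phi> q b (X \<omega>)) \<in> borel_measurable M"
    by (rule sieve_fun_measurable) auto
  have Rint: "integrable M ?R" using Z_integrable by (intro Bochner_Integration.integrable_sum) auto
  have "AE \<omega> in M. real_cond_exp M FW (\<lambda>\<omega>. sieve_fun \<phi> q b (X \<omega>) - g0 (X \<omega>)) \<omega> = real_cond_exp M FW (\<lambda>\<omega>. eps \<omega> - ?R \<omega>) \<omega>"
  proof (rule cond.real_cond_exp_cong)
    show "AE \<omega> in M. sieve_fun \<phi> q b (X \<omega>) - g0 (X \<omega>) = eps \<omega> - ?R \<omega>"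
      by (rule AE_I2) (simp add: residual_eq_sum[symmetric] model)
  qed measurable
  moreover have "AE \<omega> in M. real_cond_exp M FW (\<lambda>\<omega>. eps \<omega> - ?R \<omega>) \<omega> = real_cond_exp M FW eps \<omega> - real_cond_exp M FW ?R \<omega>"
    by (rule cond.real_cond_exp_diff[OF eps(1) Rint])
  moreover have "AE \<omega> in M. real_cond_exp M FW ?R \<omega> = (\<Sum>a=0..q. real_cond_exp M FW (\<lambda>\<omega>. ?\<beta> a * Z a \<omega>) \<omega>)"
    by (rule cond.real_cond_exp_sum) (use Z_integrable in auto)
  moreover have "AE \<omega> in M. \<forall>a\<in>{0..q}. real_cond_exp M FW (\<lambda>\<omega>. ?\<beta> a * Z a \<omega>) \<omega> = ?\<beta> a * real_cond_exp M FW (Z a) \<omega>"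
    by (intro AE_finite_allI cond.real_cond_exp_cmult Z_integrable) auto
  moreover have "AE \<omega> in M. \<forall>a\<in>{0..q}. real_cond_exp M FW (Z a) \<omega> = h a (W \<omega>)"
    using version by (intro AE_finite_allI) (auto simp: cond_mean_version_def cexp_def)
  moreover have "AE \<omega> in M. real_cond_exp M FW eps \<omega> = 0" using eps(2) by (simp add: cexp_def)
  ultimately have ae: "AE \<omega> in M. (cexp M W (\<lambda>\<omega>. sieve_fun \<phi> q b (X \<omega>) - g0 (X \<omega>)) \<omega>)\<^sup>2 = (\<Sum>a=0..q. ?\<beta> a * h a (W \<omega>))\<^sup>2"
    by eventually_elim (simp add: cexp_def)
  have "expectation (\<lambda>\<omega>. (cexp M W (\<lambda>\<omega>. sieve_fun \<phi> q b (X \<omega>) - g0 (X \<omega>)) \<omega>)\<^sup>2) = expectation (\<lambda>\<omega>. (\<Sum>a=0..q. ?\<beta> a * h a (W \<omega>))\<^sup>2)"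
    by (rule integral_cong_AE) (use ae in \<open>auto simp: cexp_def\<close>)
  then show ?thesis by (simp add: norm_w_def integral_nonneg)
qed

text \<open>
  Near a reference vector \<open>b'\<close> the criterion exceeds twice its value at \<open>b'\<close> by at most a quadratic
  term. The crude factor \<open>q\<close> is harmless because the half-width \<open>t\<close> will be chosen of order \<open>1 / q\<close>.
\<close>
lemma (in iv_moments) population_criterion_cube_le:
  assumes "\<And>i. i \<in> {1..q} \<Longrightarrow> \<bar>b i - b' i\<bar> \<le> t" and t: "t \<ge> 0"
  shows "expectation (\<lambda>\<omega>. (\<Sum>a=0..q. residual_coef b a * h a (W \<omega>))\<^sup>2)
     \<le> 2 * expectation (\<lambda>\<omega>. (\<Sum>a=0..q. residual_coef b' a * h a (W \<omega>))\<^sup>2) + 2 * (real q * t * H)\<^sup>2"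
proof -
  let ?m = "\<lambda>b \<omega>. \<Sum>a=0..q. residual_coef b a * h a (W \<omega>)"
  have bound: "\<bar>?m b \<omega>\<bar> \<le> (\<Sum>a=0..q. \<bar>residual_coef b a\<bar> * H)" if "\<omega> \<in> space M" for b \<omega>
    by (rule order_trans[OF sum_abs]) (use that in \<open>auto intro!: sum_mono mult_left_mono h_bound W_cube simp: abs_mult\<close>)
  have int: "integrable M (\<lambda>\<omega>. (?m b \<omega>)\<^sup>2)" for b
  proof (rule integrable_const_bound)
    show "AE \<omega> in M. norm ((?m b \<omega>)\<^sup>2) \<le> (\<Sum>a=0..q. \<bar>residual_coef b a\<bar> * H)\<^sup>2"
    proof (rule AE_I2)
      fix \<omega> assume "\<omega> \<in> space M"
      then show "norm ((?m b \<omega>)\<^sup>2) \<le> (\<Sum>a=0..q. \<bar>residual_coef b a\<bar> * H)\<^sup>2"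
        using power_mono[OF bound[of \<omega> b], of 2] by simp
    qed
  qed measurable
  have diff: "\<bar>?m b \<omega> - ?m b' \<omega>\<bar> \<le> real q * t * H" if "\<omega> \<in> space M" for \<omega>
  proof -
    have "?m b \<omega> - ?m b' \<omega> = (\<Sum>i=1..q. (b' i - b i) * h i (W \<omega>))"
      by (simp add: sum.atLeast_Suc_atMost[of 0] residual_coef_def sum_subtractf[symmetric] algebra_simps)
    also have "\<bar>\<dots>\<bar> \<le> (\<Sum>i=1..q. \<bar>(b' i - b i) * h i (W \<omega>)\<bar>)" by (rule sum_abs)
    also have "\<dots> \<le> (\<Sum>i=1..q. t * H)"
      unfolding abs_mult using assms that
      by (intro sum_mono mult_mono h_bound W_cube) (auto simp: abs_minus_commute)
    finally show ?thesis by simp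
  qed
  have "expectation (\<lambda>\<omega>. (?m b \<omega>)\<^sup>2) \<le> expectation (\<lambda>\<omega>. 2 * (?m b' \<omega>)\<^sup>2 + 2 * (real q * t * H)\<^sup>2)"
  proof (rule integral_mono)
    fix \<omega> assume \<omega>: "\<omega> \<in> space M"
    have sq: "(x :: real)\<^sup>2 \<le> 2 * y\<^sup>2 + 2 * (x - y)\<^sup>2" for x y
    proof -
      have "0 \<le> (x - 2 * y)\<^sup>2" by simp
      then show ?thesis by (simp add: power2_eq_square algebra_simps)
    qed
    from \<omega> have "(?m b \<omega> - ?m b' \<omega>)\<^sup>2 \<le> (real q * t * H)\<^sup>2"
      using power_mono[OF diff[of \<omega>], of 2] by simp
    then show "(?m b \<omega>)\<^sup>2 \<le> 2 * (?m b' \<omega>)\<^sup>2 + 2 * (real q * t * H)\<^sup>2"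
      using sq[of "?m b \<omega>" "?m b' \<omega>"] by linarith
  qed (use int in auto)
  also have "\<dots> = 2 * expectation (\<lambda>\<omega>. (?m b' \<omega>)\<^sup>2) + 2 * (real q * t * H)\<^sup>2"
    using int[of b'] by (simp add: prob_space)
  finally show ?thesis .
qed

section \<open>Consequences of the rate condition\<close>

text \<open>
  All three claims come from writing \<open>q \<delta> ^ (1/3) = x p\<close> with \<open>x\<close> tending to \<open>0\<close>, together with
  \<open>q\<^sup>2 \<delta> \<le> (q \<delta> ^ (1/3)) ^ 3\<close>. The last one uses that \<open>\<delta>\<close> is never smaller than the parametric rate
  \<open>1 / sqrt n\<close>, so that \<open>p\<close> eventually stays above \<open>q n ^ (- 1/6)\<close>.
\<close>
lemma sieve_rate_consequences:
  fixes p \<delta> :: "nat \<Rightarrow> real" and q :: "nat \<Rightarrow> nat"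
  assumes rate: "(\<lambda>n. real (q n) * \<delta> n powr (1/3)) \<in> o(p)"
    and p: "\<And>n. p n > 0" "p \<longlonglongrightarrow> 0" and q: "\<forall>\<^sub>F n in sequentially. q n \<ge> 1"
    and \<delta>: "\<And>n. \<delta> n \<ge> 0" "\<forall>\<^sub>F n in sequentially. 1 / sqrt (real n) \<le> \<delta> n"
  shows "(\<lambda>n. (real (q n))\<^sup>2 * \<delta> n / p n) \<longlonglongrightarrow> 0"
    and "\<delta> \<longlonglongrightarrow> 0"
    and "\<forall>\<^sub>F n in sequentially. (real (q n))\<^sup>2 * real n powr (2/3) \<le> real n * (p n)\<^sup>2"
proof -
  define x where "x = (\<lambda>n. real (q n) * \<delta> n powr (1/3) / p n)"
  have x_lim: "x \<longlonglongrightarrow> 0"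
    unfolding x_def by (rule smalloD_tendsto[OF rate])
  have xp: "real (q n) * \<delta> n powr (1/3) = x n * p n" for n
    using p(1)[of n] by (simp add: x_def)
  have cube: "(\<delta> n powr (1/3)) ^ 3 = \<delta> n" for n
  proof (cases "\<delta> n = 0")
    case False
    then have "(\<delta> n powr (1/3)) ^ 3 = \<delta> n powr (1/3 * real 3)" by (simp add: powr_power)
    then show ?thesis using \<delta>(1)[of n] False by simp
  qed simp
  have root_le: "\<delta> n powr (1/3) \<le> real (q n) * \<delta> n powr (1/3)" if "q n \<ge> 1" for n
    using that mult_right_mono[of 1 "real (q n)" "\<delta> n powr (1/3)"] by simp
  have q2: "(real (q n))\<^sup>2 * \<delta> n \<le> (x n * p n) ^ 3" if "q n \<ge> 1" for n
  proof -
    have "(real (q n))\<^sup>2 * \<delta> n = (real (q n) * \<delta> n powr (1/3))\<^sup>2 * \<delta> n powr (1/3)"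
      by (subst cube[symmetric]) (simp add: power2_eq_square power3_eq_cube)
    also have "\<dots> \<le> (real (q n) * \<delta> n powr (1/3))\<^sup>2 * (real (q n) * \<delta> n powr (1/3))"
      by (intro mult_left_mono root_le that) auto
    also have "\<dots> = (x n * p n) ^ 3" by (simp add: xp power2_eq_square power3_eq_cube)
    finally show ?thesis .
  qed
  show "(\<lambda>n. (real (q n))\<^sup>2 * \<delta> n / p n) \<longlonglongrightarrow> 0"
  proof (rule tendsto_sandwich)
    show "\<forall>\<^sub>F n in sequentially. 0 \<le> (real (q n))\<^sup>2 * \<delta> n / p n"
      using p(1) \<delta>(1) by (simp add: less_imp_le)
    show "\<forall>\<^sub>F n in sequentially. (real (q n))\<^sup>2 * \<delta> n / p n \<le> x n ^ 3 * (p n)\<^sup>2"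
      using q
    proof eventually_elim
      case (elim n)
      have "(real (q n))\<^sup>2 * \<delta> n / p n \<le> (x n * p n) ^ 3 / p n"
        using q2[OF elim] p(1)[of n] by (simp add: divide_right_mono)
      also have "\<dots> = x n ^ 3 * (p n)\<^sup>2"
        using p(1)[of n] by (simp add: power_mult_distrib power2_eq_square power3_eq_cube)
      finally show ?case .
    qed
    have "(\<lambda>n. x n ^ 3 * (p n)\<^sup>2) \<longlonglongrightarrow> 0 ^ 3 * 0\<^sup>2" by (intro tendsto_intros x_lim p(2))
    then show "(\<lambda>n. x n ^ 3 * (p n)\<^sup>2) \<longlonglongrightarrow> 0" by simp
  qed simp
  show "\<delta> \<longlonglongrightarrow> 0"
  proof (rule tendsto_sandwich[of "\<lambda>_. 0"])
    show "\<forall>\<^sub>F n in sequentially. \<delta> n \<le> (x n * p n) ^ 3"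
      using q
    proof eventually_elim
      case (elim n)
      have "\<delta> n \<le> (real (q n))\<^sup>2 * \<delta> n"
        using elim \<delta>(1)[of n] mult_right_mono[of 1 "(real (q n))\<^sup>2" "\<delta> n"] by simp
      then show ?case using q2[OF elim] by linarith
    qed
    have "(\<lambda>n. (x n * p n) ^ 3) \<longlonglongrightarrow> (0 * 0) ^ 3" by (intro tendsto_intros x_lim p(2))
    then show "(\<lambda>n. (x n * p n) ^ 3) \<longlonglongrightarrow> 0" by simp
  qed (use \<delta>(1) in auto)
  have "\<forall>\<^sub>F n in sequentially. x n < 1" using order_tendstoD(2)[OF x_lim, of 1] by simp
  then show "\<forall>\<^sub>F n in sequentially. (real (q n))\<^sup>2 * real n powr (2/3) \<le> real n * (p n)\<^sup>2"
    using \<delta>(2) eventually_gt_at_top[of 0]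
  proof eventually_elim
    case (elim n)
    have "real n powr (-1/2) = 1 / sqrt (real n)"
      using elim by (simp add: powr_minus_divide powr_half_sqrt)
    then have "(real n powr (-1/2)) powr (1/3) \<le> \<delta> n powr (1/3)"
      using elim by (intro powr_mono2) auto
    then have "real (q n) * real n powr (-1/6) \<le> real (q n) * \<delta> n powr (1/3)"
      by (intro mult_left_mono) (auto simp: powr_powr)
    also have "\<dots> = x n * p n" by (rule xp)
    also have "\<dots> \<le> 1 * p n" using elim p(1)[of n] by (intro mult_right_mono) auto
    finally have "(real (q n) * real n powr (-1/6))\<^sup>2 \<le> (p n)\<^sup>2" by (intro power_mono) auto
    then have "real n * (real (q n) * real n powr (-1/6))\<^sup>2 \<le> real n * (p n)\<^sup>2" by (intro mult_left_mono) auto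
    moreover have "real n * (real n powr (-1/6))\<^sup>2 = real n powr (2/3)"
    proof -
      have "real n * (real n powr (-1/6))\<^sup>2 = real n powr 1 * (real n powr (-1/6) * real n powr (-1/6))"
        by (simp add: power2_eq_square)
      also have "\<dots> = real n powr (1 + (-1/6 + -1/6))" by (simp only: powr_add)
      finally show ?thesis by simp
    qed
    moreover have "real n * (real (q n) * real n powr (-1/6))\<^sup>2 = (real (q n))\<^sup>2 * (real n * (real n powr (-1/6))\<^sup>2)"
      by (simp add: power_mult_distrib)
    ultimately show ?case by simp
  qed
qed

text \<open>
  The inverse prior mass of a cube with half-width \<open>p / q\<close> is at most \<open>exp (q\<^sup>2 / (2 \<kappa> p))\<close>, by the
  crude estimate \<open>1 / y \<le> exp (1 / y)\<close>. It loses against \<open>exp (- n c p)\<close> because \<open>n p\<^sup>2\<close> dominates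
  \<open>q\<^sup>2 n ^ (2/3)\<close>.
\<close>
lemma contraction_factor_tendsto_0:
  fixes p :: "nat \<Rightarrow> real" and q :: "nat \<Rightarrow> nat"
  assumes c: "c > 0" and \<kappa>: "\<kappa> > 0" and p: "\<And>n. p n > 0" "p \<longlonglongrightarrow> 0"
    and q: "\<forall>\<^sub>F n in sequentially. q n \<ge> 1"
    and growth: "\<forall>\<^sub>F n in sequentially. (real (q n))\<^sup>2 * real n powr (2/3) \<le> real n * (p n)\<^sup>2"
  shows "(\<lambda>n. exp (- (real n * (c * p n))) / (2 * (p n / real (q n)) * \<kappa>) ^ q n) \<longlonglongrightarrow> 0"
proof (rule tendsto_sandwich[of "\<lambda>_. 0"])
  have lim: "filterlim (\<lambda>n. c * real n powr (2/3) - 1 / (2 * \<kappa>)) at_top sequentially"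
    using c by real_asymp
  have ev_p: "\<forall>\<^sub>F n in sequentially. p n < 1" using order_tendstoD(2)[OF p(2), of 1] by simp
  have ev_big: "\<forall>\<^sub>F n in sequentially. 0 \<le> c * real n powr (2/3) - 1 / (2 * \<kappa>)"
    using lim[unfolded filterlim_at_top, rule_format, of 0] .
  show "\<forall>\<^sub>F n in sequentially. exp (- (real n * (c * p n))) / (2 * (p n / real (q n)) * \<kappa>) ^ q n
      \<le> exp (- (c * real n powr (2/3) - 1 / (2 * \<kappa>)))"
    using q growth ev_p ev_big
  proof eventually_elim
    case (elim n)
    define Q where "Q = real (q n)"
    have Q: "Q \<ge> 1" using elim by (simp add: Q_def)
    have pn: "p n > 0" by (rule p(1))
    let ?y = "2 * (p n / Q) * \<kappa>"
    have y: "?y > 0" using pn Q \<kappa> by simp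
    have "1 / ?y \<le> exp (1 / ?y)" using exp_ge_add_one_self[of "1 / ?y"] by linarith
    moreover have "0 \<le> 1 / ?y" using y by (intro divide_nonneg_pos) auto
    ultimately have "(1 / ?y) ^ q n \<le> exp (1 / ?y) ^ q n" by (rule power_mono)
    also have "\<dots> = exp (Q * (1 / ?y))" by (simp only: Q_def exp_of_nat_mult)
    also have "Q * (1 / ?y) = Q\<^sup>2 / (2 * \<kappa> * p n)" using Q by (simp add: power2_eq_square)
    finally have "1 / ?y ^ q n \<le> exp (Q\<^sup>2 / (2 * \<kappa> * p n))" by (simp only: power_one_over)
    then have "exp (- (real n * (c * p n))) * (1 / ?y ^ q n) \<le> exp (- (real n * (c * p n))) * exp (Q\<^sup>2 / (2 * \<kappa> * p n))"
      by (rule mult_left_mono) simp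
    also have "\<dots> = exp (- (real n * (c * p n)) + Q\<^sup>2 / (2 * \<kappa> * p n))" by (rule exp_add[symmetric])
    also have "\<dots> \<le> exp (- (c * real n powr (2/3) - 1 / (2 * \<kappa>)))"
    proof -
      let ?b = "c * real n powr (2/3) - 1 / (2 * \<kappa>)"
      have "1 * ?b \<le> (Q\<^sup>2 / p n) * ?b"
      proof (rule mult_right_mono)
        have "p n \<le> Q\<^sup>2" using elim(3) one_le_power[OF Q, of 2] by linarith
        then show "1 \<le> Q\<^sup>2 / p n" using pn by simp
      qed (rule elim(4))
      also have "\<dots> = c * (Q\<^sup>2 * real n powr (2/3)) / p n - Q\<^sup>2 / (2 * \<kappa> * p n)"
        using pn \<kappa> by (simp add: field_simps)
      also have "\<dots> \<le> c * (real n * (p n)\<^sup>2) / p n - Q\<^sup>2 / (2 * \<kappa> * p n)"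
        using elim(2) c pn by (intro diff_right_mono divide_right_mono mult_left_mono) (auto simp: Q_def)
      also have "\<dots> = real n * (c * p n) - Q\<^sup>2 / (2 * \<kappa> * p n)"
        using pn by (simp add: power2_eq_square)
      finally show ?thesis by simp
    qed
    finally show ?case by (simp add: Q_def)
  qed
  show "(\<lambda>n. exp (- (c * real n powr (2/3) - 1 / (2 * \<kappa>)))) \<longlonglongrightarrow> 0"
    by (rule filterlim_compose[OF exp_at_bot filterlim_compose[OF filterlim_uminus_at_bot_at_top lim]])
  show "\<forall>\<^sub>F n in sequentially. 0 \<le> exp (- (real n * (c * p n))) / (2 * (p n / real (q n)) * \<kappa>) ^ q n"
    using p(1) \<kappa> by (intro always_eventually allI divide_nonneg_nonneg zero_le_power mult_nonneg_nonneg) (auto simp: less_imp_le)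
qed simp

section \<open>Posterior contraction\<close>

text \<open>
  The deterministic heart of the argument, for one sample on which \<open>cell_dev\<close> is small. The error of
  the empirical criterion is at most \<open>\<tau> p (1 + 2 Bs + 2 r)\<close>, where \<open>r\<close> is the squared distance of
  \<open>b\<close> from \<open>bstar\<close>, whereas the population criterion is at least \<open>C1 p r\<close>. Far from \<open>g0\<close> one has
  \<open>r \<ge> \<epsilon>\<^sup>2 / 4\<close>, so the error is absorbed for every such \<open>b\<close>, however large. On the cube of half-width
  \<open>p / q\<close> about \<open>bstar\<close> the criterion is a small multiple of \<open>p\<close>; the three thirds of
  \<open>C1 p \<epsilon>\<^sup>2 / 16\<close> are spent on the error, on the approximation error \<open>e\<close> and on the quadratic term.
\<close>
lemma (in iv_moments) posterior_prob_le:
  fixes Ys :: "nat \<Rightarrow> 'a \<Rightarrow> real" and Xs :: "nat \<Rightarrow> 'a \<Rightarrow> 'x" and Ws :: "nat \<Rightarrow> 'a \<Rightarrow> real ^ 'd"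
    and g0 :: "'x \<Rightarrow> real" and bstar :: "nat \<Rightarrow> real" and n k q :: nat
    and \<epsilon> p S \<tau> C1 C2 Bs \<sigma> :: real
  defines "G \<equiv> \<lambda>b. expectation (\<lambda>\<omega>. (\<Sum>a=0..q. residual_coef b a * h a (W \<omega>))\<^sup>2)"
  defines "e \<equiv> norm_s M X (\<lambda>x. sieve_fun \<phi> q bstar x - g0 x)"
  assumes basis: "L2_basis M X \<phi>" and g0: "g0 \<in> L2_of M X"
    and q: "q \<ge> 1" and k: "k \<ge> 1" and pos: "\<And>j. j \<in> cell_indices k \<Longrightarrow> cell_prob k j > 0"
    and dev: "cell_dev Ys Xs Ws n k q \<omega> \<le> S" and S: "S \<le> 1/2"
    and approx: "(real q + 1) * (2 * (H + 1)\<^sup>2 * S + (C * real CARD('d) / real k)\<^sup>2) \<le> \<tau> * p"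
    and lower: "\<And>b. C1 * (p * (\<Sum>i=1..q. (b i - bstar i)\<^sup>2)) \<le> G b"
    and upper: "G bstar \<le> C2 * (p * e\<^sup>2)"
    and Bs: "(\<Sum>i=1..q. (bstar i)\<^sup>2) \<le> Bs"
    and params: "C1 > 0" "0 < p" "p \<le> 1" "\<epsilon> > 0" "\<sigma> > 0"
    and e_small: "4 * e\<^sup>2 \<le> \<epsilon>\<^sup>2" "2 * C2 * e\<^sup>2 \<le> C1 * \<epsilon>\<^sup>2 / 48"
    and p_small: "2 * H\<^sup>2 * p \<le> C1 * \<epsilon>\<^sup>2 / 48"
    and \<tau>_small: "(4 * (1 + 2 * Bs) / \<epsilon>\<^sup>2 + 2) * \<tau> \<le> C1 / 2" "(3 + 2 * Bs) * \<tau> \<le> C1 * \<epsilon>\<^sup>2 / 48"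
  shows "posterior_prob Ys Xs Ws \<phi> (normal_prior \<sigma> q) n k q (\<lambda>g. norm_s M X (\<lambda>x. g x - g0 x) > \<epsilon>) \<omega>
      \<le> exp (- (real n * (C1 * \<epsilon>\<^sup>2 / 32 * p))) / (2 * (p / real q) * normal_density 0 \<sigma> (sqrt Bs + 1)) ^ q"
proof -
  interpret L2: L2_basis M X \<phi> by (rule basis)
  have g0m: "g0 \<in> borel_measurable borel" by (rule L2_of_measurable[OF g0])
  define r where "r = (\<lambda>b. \<Sum>i=1..q. (b i - bstar i)\<^sup>2)"
  have r0: "r b \<ge> 0" for b by (simp add: r_def sum_nonneg)
  have Bs0: "Bs \<ge> 0" by (rule order_trans[OF _ Bs]) (simp add: sum_nonneg)
  define Gb where "Gb = (\<lambda>b. G_bar Ys Xs Ws n k (sieve_fun \<phi> q b) \<omega>)"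
  have Gb_close: "\<bar>Gb b - G b\<bar> \<le> (1 + 2 * Bs + 2 * r b) * (\<tau> * p)" for b
  proof -
    have "(\<Sum>i=1..q. (b i)\<^sup>2) \<le> (\<Sum>i=1..q. 2 * (b i - bstar i)\<^sup>2 + 2 * (bstar i)\<^sup>2)"
    proof (rule sum_mono)
      fix i
      have "0 \<le> (b i - 2 * bstar i)\<^sup>2" by simp
      then show "(b i)\<^sup>2 \<le> 2 * (b i - bstar i)\<^sup>2 + 2 * (bstar i)\<^sup>2"
        by (simp add: power2_eq_square algebra_simps)
    qed
    also have "\<dots> = 2 * r b + 2 * (\<Sum>i=1..q. (bstar i)\<^sup>2)"
      by (simp add: r_def sum.distrib sum_distrib_left)
    finally have b2: "1 + (\<Sum>i=1..q. (b i)\<^sup>2) \<le> 1 + 2 * Bs + 2 * r b" using Bs by linarith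
    have S0: "0 \<le> S"
      by (rule order_trans[OF _ dev]) (auto simp: cell_dev_def cell_prob_nonneg intro!: sum_nonneg add_nonneg_nonneg)
    have "\<bar>Gb b - G b\<bar> \<le> (1 + (\<Sum>i=1..q. (b i)\<^sup>2)) * ((real q + 1) * (2 * (H + 1)\<^sup>2 * S + (C * real CARD('d) / real k)\<^sup>2))"
      using G_bar_approx[OF k pos dev S, of b] unfolding Gb_def G_def by (simp add: mult_ac)
    also have "\<dots> \<le> (1 + 2 * Bs + 2 * r b) * (\<tau> * p)"
    proof (rule mult_mono[OF b2 approx])
      show "0 \<le> 1 + 2 * Bs + 2 * r b" using Bs0 r0[of b] by simp
      show "0 \<le> (real q + 1) * (2 * (H + 1)\<^sup>2 * S + (C * real CARD('d) / real k)\<^sup>2)" using S0 by simp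
    qed
    finally show ?thesis .
  qed
  have far: "r b \<ge> \<epsilon>\<^sup>2 / 4" if "norm_s M X (\<lambda>x. sieve_fun \<phi> q b x - g0 x) > \<epsilon>" for b
  proof -
    have "\<epsilon>\<^sup>2 \<le> (norm_s M X (\<lambda>x. sieve_fun \<phi> q b x - g0 x))\<^sup>2"
      using that params by (intro power_mono) auto
    also have "\<dots> \<le> 2 * (norm_s M X (\<lambda>x. sieve_fun \<phi> q b x - sieve_fun \<phi> q bstar x))\<^sup>2 + 2 * e\<^sup>2"
      unfolding e_def by (rule L2.norm_s_diff_le[OF L2.sieve_fun_L2 L2.sieve_fun_L2 g0])
    also have "(\<lambda>x. sieve_fun \<phi> q b x - sieve_fun \<phi> q bstar x) = sieve_fun \<phi> q (\<lambda>i. b i - bstar i)"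
      by (simp add: sieve_fun_def fun_eq_iff sum_subtractf left_diff_distrib)
    also have "(norm_s M X (sieve_fun \<phi> q (\<lambda>i. b i - bstar i)))\<^sup>2 = r b"
      by (simp add: L2.norm_sieve_fun r_def)
    finally show ?thesis using e_small(1) by linarith
  qed
  \<comment> \<open>Half of the population lower bound \<open>C1 p \<epsilon>\<^sup>2 / 4\<close> is left after the error is absorbed.\<close>
  define \<gamma> where "\<gamma> = C1 * \<epsilon>\<^sup>2 / 8 * p"
  have out: "Gb b \<ge> \<gamma>" if "norm_s M X (\<lambda>x. sieve_fun \<phi> q b x - g0 x) > \<epsilon>" for b
  proof -
    have rb: "r b \<ge> \<epsilon>\<^sup>2 / 4" by (rule far[OF that])
    define m where "m = 4 * (1 + 2 * Bs) / \<epsilon>\<^sup>2 + 2"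
    have "1 + 2 * Bs = 4 * (1 + 2 * Bs) / \<epsilon>\<^sup>2 * (\<epsilon>\<^sup>2 / 4)" using params by simp
    also have "\<dots> \<le> 4 * (1 + 2 * Bs) / \<epsilon>\<^sup>2 * r b" using rb Bs0 by (intro mult_left_mono) auto
    finally have "1 + 2 * Bs + 2 * r b \<le> m * r b" unfolding m_def by (simp add: distrib_right)
    moreover have "\<tau> * p \<ge> 0"
    proof (rule order_trans[OF _ approx])
      have "0 \<le> S"
        by (rule order_trans[OF _ dev]) (auto simp: cell_dev_def cell_prob_nonneg intro!: sum_nonneg add_nonneg_nonneg)
      then show "0 \<le> (real q + 1) * (2 * (H + 1)\<^sup>2 * S + (C * real CARD('d) / real k)\<^sup>2)" by simp
    qed
    ultimately have "(1 + 2 * Bs + 2 * r b) * (\<tau> * p) \<le> m * r b * (\<tau> * p)" by (rule mult_right_mono)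
    also have "\<dots> = m * \<tau> * (r b * p)" by simp
    also have "\<dots> \<le> C1 / 2 * (r b * p)"
      using \<tau>_small(1) r0[of b] params unfolding m_def by (intro mult_right_mono) auto
    finally have "G b - C1 / 2 * (r b * p) \<le> Gb b" using Gb_close[of b] by linarith
    moreover have "C1 * (p * r b) \<le> G b" using lower[of b] by (simp only: r_def)
    ultimately have "C1 * (p * r b) - C1 / 2 * (r b * p) \<le> Gb b" by linarith
    then have "Gb b \<ge> C1 / 2 * (r b * p)" by (simp add: mult_ac)
    moreover have "C1 / 2 * (r b * p) \<ge> C1 / 2 * (\<epsilon>\<^sup>2 / 4 * p)"
      using rb params by (intro mult_left_mono mult_right_mono) auto
    ultimately show ?thesis by (simp add: \<gamma>_def mult_ac)
  qed
  have cube: "Gb b \<le> \<gamma> / 2" if "\<forall>i\<in>{1..q}. \<bar>b i - bstar i\<bar> \<le> p / real q" for b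
  proof -
    have "r b \<le> (\<Sum>i=1..q. 1 / real q)"
      unfolding r_def
    proof (rule sum_mono)
      fix i assume "i \<in> {1..q}"
      then have "\<bar>b i - bstar i\<bar> \<le> p / real q" using that by blast
      also have "\<dots> \<le> 1 / real q" using params by (intro divide_right_mono) auto
      finally have 1: "\<bar>b i - bstar i\<bar> \<le> 1 / real q" .
      then have "\<bar>b i - bstar i\<bar>\<^sup>2 \<le> (1 / real q)\<^sup>2" by (intro power_mono) auto
      also have "\<dots> \<le> 1 / real q" using q by (simp add: power2_eq_square field_simps)
      finally show "(b i - bstar i)\<^sup>2 \<le> 1 / real q" by simp
    qed
    then have r1: "r b \<le> 1" using q by simp
    have \<tau>0: "\<tau> * p \<ge> 0" using Gb_close[of bstar] Bs0 
      by (simp add: r_def) (smt (verit) zero_le_mult_iff)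
    have "Gb b \<le> G b + (1 + 2 * Bs + 2 * r b) * (\<tau> * p)" using Gb_close[of b] by linarith
    also have "(1 + 2 * Bs + 2 * r b) * (\<tau> * p) \<le> (3 + 2 * Bs) * (\<tau> * p)"
      using r1 \<tau>0 by (intro mult_right_mono) auto
    also have "\<dots> = (3 + 2 * Bs) * \<tau> * p" by simp
    also have "\<dots> \<le> C1 * \<epsilon>\<^sup>2 / 48 * p" using \<tau>_small(2) params by (intro mult_right_mono) auto
    also have "G b \<le> 2 * G bstar + 2 * (real q * (p / real q) * H)\<^sup>2"
      unfolding G_def by (rule population_criterion_cube_le) (use that params in auto)
    also have "real q * (p / real q) = p" using q by simp
    also have "2 * G bstar \<le> 2 * (C2 * (p * e\<^sup>2))" using upper by simp
    also have "2 * (C2 * (p * e\<^sup>2)) = 2 * C2 * e\<^sup>2 * p" by simp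
    also have "\<dots> \<le> C1 * \<epsilon>\<^sup>2 / 48 * p" using e_small(2) params by (intro mult_right_mono) auto
    also have "2 * (p * H)\<^sup>2 = 2 * H\<^sup>2 * p * p" by (simp add: power2_eq_square)
    also have "\<dots> \<le> C1 * \<epsilon>\<^sup>2 / 48 * p" using p_small params by (intro mult_right_mono) auto
    finally show ?thesis by (simp add: \<gamma>_def mult_ac)
  qed
  have meas: "Gb \<in> borel_measurable (coef_lebesgue q)"
    unfolding Gb_def by (rule G_bar_sieve_measurable) (auto intro: \<phi>_meas coef_component_measurable)
  have set: "{b \<in> space (coef_lebesgue q). norm_s M X (\<lambda>x. sieve_fun \<phi> q b x - g0 x) > \<epsilon>} \<in> sets (coef_lebesgue q)"
    using norm_s_sieve_measurable[of q \<phi> X g0, OF \<phi>_meas X_meas g0m] by measurable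
  have nonneg: "Gb b \<ge> 0" for b
    unfolding Gb_def G_bar_def v_hat_def by (intro sum_nonneg divide_nonneg_nonneg mult_nonneg_nonneg) auto
  have coef: "\<bar>bstar i\<bar> + p / real q \<le> sqrt Bs + 1" if "i \<in> {1..q}" for i
  proof -
    have "(bstar i)\<^sup>2 \<le> Bs"
      by (rule order_trans[OF member_le_sum[of i "{1..q}" "\<lambda>i. (bstar i)\<^sup>2"] Bs]) (use that in auto)
    then have "\<bar>bstar i\<bar> \<le> sqrt Bs" by (rule real_le_rsqrt[of "\<bar>bstar i\<bar>", simplified])
    moreover have "p / real q \<le> 1" using params q by simp
    ultimately show ?thesis by simp
  qed
  have "posterior_prob Ys Xs Ws \<phi> (normal_prior \<sigma> q) n k q (\<lambda>g. norm_s M X (\<lambda>x. g x - g0 x) > \<epsilon>) \<omega>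
      \<le> exp (- (real n * \<gamma> / 4)) / (2 * (p / real q) * normal_density 0 \<sigma> (sqrt Bs + 1)) ^ q"
    unfolding posterior_prob_def quasi_posterior_def quasi_lik_def Gb_def[symmetric] fun_cong[OF Gb_def, symmetric]
    by (rule quasi_posterior_set_le[OF _ _ coef meas set nonneg])
      (use params q out cube in auto)
  then show ?thesis by (simp add: \<gamma>_def mult_ac)
qed

section \<open>Discharging the assumptions\<close>

lemma cond_mean_sup_less_AE:
  assumes "cond_mean_sup_less M W Z C" and W: "\<And>\<omega>. \<omega> \<in> space M \<Longrightarrow> W \<omega> \<in> cbox 0 1"
  shows "integrable M Z" and "AE \<omega> in M. cexp M W Z \<omega> \<le> C"
proof -
  obtain h where h: "cond_mean_version M W Z h" "bdd_above (h ` cbox 0 1)" "(SUP w\<in>cbox 0 1. h w) < C"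
    using assms(1) by (auto simp: cond_mean_sup_less_def)
  show "integrable M Z" using h(1) by (simp add: cond_mean_version_def)
  have "AE \<omega> in M. cexp M W Z \<omega> = h (W \<omega>)" using h(1) by (simp add: cond_mean_version_def)
  then show "AE \<omega> in M. cexp M W Z \<omega> \<le> C" using AE_space
  proof eventually_elim
    case (elim \<omega>)
    have "h (W \<omega>) \<le> (SUP w\<in>cbox 0 1. h w)" by (intro cSUP_upper W elim h(2))
    then show ?case using elim(1) h(3) by linarith
  qed
qed

text \<open>
  As \<open>q\<close> tends to infinity, every index \<open>i \<ge> 1\<close> is eventually at most \<open>q n\<close>. The moment conditions,
  whose constant does not depend on \<open>n\<close>, thus hold for the whole basis.
\<close>
lemma iv_moments_of_assumptions:
  fixes Y :: "'a \<Rightarrow> real" and X :: "'a \<Rightarrow> 'x::euclidean_space" and W :: "'a \<Rightarrow> real ^ 'd::finite"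
  assumes "prob_space M" and model: "NPIV_model M Y X W g0 eps"
    and basis: "orthonormal_basis_L2 M X \<phi>" and q_lim: "filterlim q at_top sequentially"
    and N3: "N3 M Y X W \<phi> q" and N5: "N5 M Y X W"
  obtains h C fW where "iv_moments M Y X W \<phi> h C fW"
proof -
  interpret prob_space M by fact
  have W_cube: "W \<omega> \<in> cbox 0 1" if "\<omega> \<in> space M" for \<omega>
    using model that by (auto simp: NPIV_model_def)
  have in_range: "\<exists>n. i \<in> {1..q n}" if "i \<ge> 1" for i
  proof -
    have "\<forall>\<^sub>F n in sequentially. i \<le> q n" using q_lim by (auto simp: filterlim_at_top)
    then obtain n where "i \<le> q n" by (meson eventually_happens sequentially_bot)
    then show ?thesis using that by auto
  qed
  obtain C0 where C0: "C0 > 0" "cond_mean_sup_less M W (\<lambda>\<omega>. (Y \<omega>)\<^sup>2) C0"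
    and Y: "\<exists>h. cond_mean_version M W Y h \<and> (\<exists>L. L-lipschitz_on (cbox 0 1) h)"
    and \<phi>: "\<And>n i. i \<in> {1..q n} \<Longrightarrow> cond_mean_sup_less M W (\<lambda>\<omega>. (\<phi> i (X \<omega>))\<^sup>2) C0 \<and>
           (\<exists>h. cond_mean_version M W (\<lambda>\<omega>. \<phi> i (X \<omega>)) h \<and>
                (\<forall>w1\<in>cbox 0 1. \<forall>w2\<in>cbox 0 1. \<bar>h w1 - h w2\<bar> \<le> C0 * norm (w1 - w2)))"
    using N3 unfolding N3_def by blast
  obtain hY L where hY: "cond_mean_version M W Y hY" "L-lipschitz_on (cbox 0 1) hY" using Y by blast
  define C where "C = max 1 (max C0 L)"
  have C: "C \<ge> 1" "C \<ge> C0" "C \<ge> L" by (auto simp: C_def)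
  let ?Z = "regressor Y X \<phi>"
  have Z0: "?Z 0 = Y" by (simp add: regressor_def fun_eq_iff)
  have Zi: "?Z i = (\<lambda>\<omega>. \<phi> i (X \<omega>))" if "i \<ge> 1" for i using that by (simp add: regressor_def fun_eq_iff)
  have sup: "cond_mean_sup_less M W (\<lambda>\<omega>. (?Z a \<omega>)\<^sup>2) C0" for a
  proof (cases "a = 0")
    case True
    then show ?thesis using C0 by (simp add: Z0)
  next
    case False
    then show ?thesis using in_range[of a] \<phi>[of a] by (auto simp: Zi)
  qed
  have "\<exists>h. cond_mean_version M W (?Z a) h \<and> (\<forall>w1\<in>cbox 0 1. \<forall>w2\<in>cbox 0 1. \<bar>h w1 - h w2\<bar> \<le> C * norm (w1 - w2))" for a
  proof (cases "a = 0")
    case True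
    have "\<bar>hY w1 - hY w2\<bar> \<le> C * norm (w1 - w2)" if "w1 \<in> cbox 0 1" "w2 \<in> cbox 0 1" for w1 w2
    proof -
      have "\<bar>hY w1 - hY w2\<bar> \<le> L * norm (w1 - w2)"
        using lipschitz_onD[OF hY(2) that] by (simp add: dist_norm)
      also have "\<dots> \<le> C * norm (w1 - w2)" using C by (intro mult_right_mono) auto
      finally show ?thesis .
    qed
    then show ?thesis using hY True by (auto simp: Z0)
  next
    case False
    then obtain n where "a \<in> {1..q n}" using in_range[of a] by auto
    then obtain h where h: "cond_mean_version M W (\<lambda>\<omega>. \<phi> a (X \<omega>)) h"
        "\<forall>w1\<in>cbox 0 1. \<forall>w2\<in>cbox 0 1. \<bar>h w1 - h w2\<bar> \<le> C0 * norm (w1 - w2)"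
      using \<phi> by blast
    have "\<bar>h w1 - h w2\<bar> \<le> C * norm (w1 - w2)" if "w1 \<in> cbox 0 1" "w2 \<in> cbox 0 1" for w1 w2
    proof -
      have "\<bar>h w1 - h w2\<bar> \<le> C0 * norm (w1 - w2)" using h(2) that by blast
      also have "\<dots> \<le> C * norm (w1 - w2)" using C by (intro mult_right_mono) auto
      finally show ?thesis .
    qed
    then show ?thesis using h(1) False by (auto simp: Zi)
  qed
  then obtain h where h: "\<And>a. cond_mean_version M W (?Z a) (h a)"
      "\<And>a w1 w2. w1 \<in> cbox 0 1 \<Longrightarrow> w2 \<in> cbox 0 1 \<Longrightarrow> \<bar>h a w1 - h a w2\<bar> \<le> C * norm (w1 - w2)"
    by metis
  obtain fW :: "real ^ 'd \<Rightarrow> real" where fW: "distributed M lborel W (\<lambda>w. ennreal (fW w))"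
    using N5 unfolding N5_def by blast
  have "iv_moments M Y X W \<phi> h C (\<lambda>w. ennreal (fW w))"
  proof
    show "Y \<in> borel_measurable M" "X \<in> borel_measurable M" "W \<in> borel_measurable M"
      using model by (auto simp: NPIV_model_def)
    show "\<phi> a \<in> borel_measurable borel" if "a \<ge> 1" for a
      using basis that by (auto simp: orthonormal_basis_L2_def L2_of_def)
    show "AE \<omega> in M. cexp M W (\<lambda>\<omega>. (?Z a \<omega>)\<^sup>2) \<omega> \<le> C" for a
      using cond_mean_sup_less_AE(2)[OF sup W_cube, of a] C by (auto elim: eventually_mono)
  qed (use W_cube fW C h cond_mean_sup_less_AE(1)[OF sup W_cube] in auto)
  then show ?thesis by (rule that)
qed

lemma N1_measurable:
  assumes "prob_space M" and N1: "N1 M Y X W Ys Xs Ws" and i: "i \<ge> 1"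
  shows "Ys i \<in> borel_measurable M" "Xs i \<in> borel_measurable M" "Ws i \<in> borel_measurable M"
proof -
  interpret prob_space M by fact
  have triple: "(\<lambda>\<omega>. (Ys i \<omega>, Xs i \<omega>, Ws i \<omega>)) \<in> borel_measurable M"
    using N1 i by (auto simp: N1_def indep_vars_def)
  have "(\<lambda>\<omega>. fst (Ys i \<omega>, Xs i \<omega>, Ws i \<omega>)) \<in> borel_measurable M"
    by (rule measurable_compose[OF triple]) (intro borel_measurable_continuous_onI continuous_intros)
  moreover have "(\<lambda>\<omega>. fst (snd (Ys i \<omega>, Xs i \<omega>, Ws i \<omega>))) \<in> borel_measurable M"
    by (rule measurable_compose[OF triple]) (intro borel_measurable_continuous_onI continuous_intros)
  moreover have "(\<lambda>\<omega>. snd (snd (Ys i \<omega>, Xs i \<omega>, Ws i \<omega>))) \<in> borel_measurable M"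
    by (rule measurable_compose[OF triple]) (intro borel_measurable_continuous_onI continuous_intros)
  ultimately show "Ys i \<in> borel_measurable M" "Xs i \<in> borel_measurable M" "Ws i \<in> borel_measurable M"
    by simp_all
qed

lemma N2_cell_prob_ge:
  fixes W :: "'a \<Rightarrow> real ^ 'd::finite"
  assumes N2: "N2 M W k" and k: "\<forall>\<^sub>F n in sequentially. k n \<ge> 1"
  obtains K where "K > 0"
    "\<forall>\<^sub>F n in sequentially. \<forall>j\<in>cell_indices (k n).
        1 / real (k n) ^ CARD('d) \<le> K * measure M {\<omega> \<in> space M. W \<omega> \<in> cell (k n) j}"
proof -
  let ?m = "\<lambda>n j. measure M {\<omega> \<in> space M. W \<omega> \<in> cell (k n) j}"
  obtain K where K: "K > 0"
    and ev: "\<forall>\<^sub>F n in sequentially. norm (1 / real (k n) ^ CARD('d)) \<le> K * norm (Min (?m n ` cell_indices (k n)))"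
    using N2 unfolding N2_def by (auto elim: landau_o.bigE)
  have "\<forall>\<^sub>F n in sequentially. \<forall>j\<in>cell_indices (k n). 1 / real (k n) ^ CARD('d) \<le> K * ?m n j"
    using ev k
  proof eventually_elim
    case (elim n)
    show ?case
    proof
      fix j :: "'d \<Rightarrow> nat" assume j: "j \<in> cell_indices (k n)"
      have "Min (?m n ` cell_indices (k n)) \<le> ?m n j" using j by (intro Min_le) auto
      moreover have "0 \<le> Min (?m n ` cell_indices (k n))"
        using j by (intro Min.boundedI) auto
      ultimately have "K * norm (Min (?m n ` cell_indices (k n))) \<le> K * ?m n j"
        using K by (intro mult_left_mono) auto
      then show "1 / real (k n) ^ CARD('d) \<le> K * ?m n j" using elim(1) by simp
    qed
  qed
  then show ?thesis using K that by blast
qed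

theorem theorem4p4:
  fixes M :: "'a measure"
    and Y eps :: "'a \<Rightarrow> real" and X :: "'a \<Rightarrow> 'x::euclidean_space" and W :: "'a \<Rightarrow> real ^ 'd::finite"
    and Ys :: "nat \<Rightarrow> 'a \<Rightarrow> real" and Xs :: "nat \<Rightarrow> 'a \<Rightarrow> 'x" and Ws :: "nat \<Rightarrow> 'a \<Rightarrow> real ^ 'd"
    and \<phi> :: "nat \<Rightarrow> 'x \<Rightarrow> real" and q k :: "nat \<Rightarrow> nat"
    and g0 :: "'x \<Rightarrow> real" and bstar \<eta> :: "nat \<Rightarrow> real" and vphi :: "real \<Rightarrow> real" and \<sigma> :: real
  assumes "prob_space M"
    and model: "NPIV_model M Y X W g0 eps"
    and basis: "orthonormal_basis_L2 M X \<phi>"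
    and q_lim: "filterlim q at_top sequentially"
    and k_lim: "filterlim k at_top sequentially"
    and ident: "point_identified M Y X W g0"
    and N1: "N1 M Y X W Ys Xs Ws"
    and N2: "N2 M W k"
    and N3: "N3 M Y X W \<phi> q"
    and N4: "N4 M Y X W \<phi> q g0 bstar \<eta>"
    and N5: "N5 M Y X W"
    and N6: "N6 M X W \<phi> q g0 bstar \<eta> vphi"
    and sigma_pos: "\<sigma> > 0"
    and rate: "(\<lambda>n. real (q n) *
                 (real (k n) powr (3 * real CARD('d) / 2) / sqrt (real n) + 1 / real (k n)) powr (1 / 3))
               \<in> o(\<lambda>n. vphi ((\<eta> (q n))\<^sup>2))"
  shows "\<forall>\<epsilon>>0. little_o_p_one M (\<lambda>n.
           posterior_prob Ys Xs Ws \<phi> (normal_prior \<sigma> (q n)) n (k n) (q n)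
             (\<lambda>g. norm_s M X (\<lambda>x. g x - g0 x) > \<epsilon>))"
proof -
  obtain h C fW where iv: "iv_moments M Y X W \<phi> h C fW"
    using iv_moments_of_assumptions[OF \<open>prob_space M\<close> model basis q_lim N3 N5] .
  interpret iv_moments M Y X W \<phi> h C fW by (rule iv)
  have eps: "integrable M eps" "AE \<omega> in M. cexp M W eps \<omega> = 0"
    and Y_eq: "\<And>\<omega>. \<omega> \<in> space M \<Longrightarrow> Y \<omega> = g0 (X \<omega>) + eps \<omega>"
    using model by (auto simp: NPIV_model_def)
  have basis': "L2_basis M X \<phi>"
    using basis X_meas by unfold_locales (auto simp: orthonormal_basis_L2_def)
  interpret L2: L2_basis M X \<phi> by (rule basis')
  have g0: "g0 \<in> L2_of M X" using N4 by (auto simp: N4_def Theta_I_def)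
  have g0m: "g0 \<in> borel_measurable borel" by (rule L2_of_measurable[OF g0])
  have \<eta>: "\<And>j. j \<ge> 1 \<Longrightarrow> \<eta> j > 0" "strict_antimono_on {1..} \<eta>" "\<eta> \<longlonglongrightarrow> 0"
    and proj: "\<And>n b. inner_X M X (\<lambda>x. g0 x - sieve_fun \<phi> (q n) bstar x) (sieve_fun \<phi> (q n) b) = 0"
    and bsum: "summable (\<lambda>i. (bstar (Suc i))\<^sup>2)"
    and e_rate: "(\<lambda>n. norm_s M X (\<lambda>x. sieve_fun \<phi> (q n) bstar x - g0 x)) \<in> O(\<lambda>n. \<eta> (q n))"
    using N4 by (auto simp: N4_def)
  have vphi: "mono_on {0<..} vphi" "\<And>t. t > 0 \<Longrightarrow> vphi t > 0" "(vphi \<longlongrightarrow> 0) (at_right 0)"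
    using N6 by (auto simp: N6_def)
  obtain C1 where C1_pos: "C1 > 0" and C1: "\<And>g. g \<in> L2_of M X \<Longrightarrow>
      (norm_w M X W (\<lambda>x. g x - g0 x))\<^sup>2 \<ge>
          C1 * (\<Sum>i. vphi ((\<eta> (Suc i))\<^sup>2) * \<bar>inner_X M X (\<lambda>x. g x - g0 x) (\<phi> (Suc i))\<bar>\<^sup>2)"
    using N6 unfolding N6_def by blast
  obtain C2 where C2_pos: "C2 > 0" and C2: "\<And>n. (norm_w M X W (\<lambda>x. sieve_fun \<phi> (q n) bstar x - g0 x))\<^sup>2 \<le>
          C2 * (\<Sum>i. vphi ((\<eta> (Suc i))\<^sup>2) *
                 \<bar>inner_X M X (\<lambda>x. g0 x - sieve_fun \<phi> (q n) bstar x) (\<phi> (Suc i))\<bar>\<^sup>2)"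
    using N6 unfolding N6_def by blast

  have q1: "\<forall>\<^sub>F n in sequentially. q n \<ge> 1" using q_lim by (auto simp: filterlim_at_top)
  have k1: "\<forall>\<^sub>F n in sequentially. k n \<ge> 1" using k_lim by (auto simp: filterlim_at_top)
  obtain K where K: "K > 0" "\<forall>\<^sub>F n in sequentially. \<forall>j\<in>cell_indices (k n).
        1 / real (k n) ^ CARD('d) \<le> K * cell_prob (k n) j"
    using N2_cell_prob_ge[OF N2 k1] unfolding cell_prob_def by blast

  \<comment> \<open>For \<open>q n = 0\<close> the value of \<open>vphi\<close> need not be positive; the replacement affects finitely many \<open>n\<close>.\<close>
  define p where "p = (\<lambda>n. if q n \<ge> 1 then vphi ((\<eta> (q n))\<^sup>2) else 1)"
  define \<delta> where "\<delta> = (\<lambda>n. real (k n) powr (3 * real CARD('d) / 2) / sqrt (real n) + 1 / real (k n))"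
  define e where "e = (\<lambda>n. norm_s M X (\<lambda>x. sieve_fun \<phi> (q n) bstar x - g0 x))"
  define G where "G = (\<lambda>n b. expectation (\<lambda>\<omega>. (\<Sum>a=0..q n. residual_coef b a * h a (W \<omega>))\<^sup>2))"
  define Bs where "Bs = (\<Sum>i. (bstar (Suc i))\<^sup>2)"
  have p_eq: "\<forall>\<^sub>F n in sequentially. vphi ((\<eta> (q n))\<^sup>2) = p n"
    using q1 by eventually_elim (simp add: p_def)
  have p_pos: "p n > 0" for n
  proof (cases "q n \<ge> 1")
    case True
    then have "(\<eta> (q n))\<^sup>2 > 0" using \<eta>(1)[of "q n"] by simp
    then show ?thesis using vphi(2) True by (simp add: p_def)
  qed (simp add: p_def)
  have \<eta>q: "(\<lambda>n. \<eta> (q n)) \<longlonglongrightarrow> 0" by (rule filterlim_compose[OF \<eta>(3) q_lim])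
  have p_lim: "p \<longlonglongrightarrow> 0"
  proof -
    have "filterlim (\<lambda>n. (\<eta> (q n))\<^sup>2) (at_right 0) sequentially"
      unfolding filterlim_at
    proof
      show "\<forall>\<^sub>F n in sequentially. (\<eta> (q n))\<^sup>2 \<in> {0<..} \<and> (\<eta> (q n))\<^sup>2 \<noteq> 0"
        using q1
      proof eventually_elim
        case (elim n)
        then show ?case using \<eta>(1)[of "q n"] by simp
      qed
      show "(\<lambda>n. (\<eta> (q n))\<^sup>2) \<longlonglongrightarrow> 0" using tendsto_power[OF \<eta>q, of 2] by simp
    qed
    then have "(\<lambda>n. vphi ((\<eta> (q n))\<^sup>2)) \<longlonglongrightarrow> 0" by (rule filterlim_compose[OF vphi(3)])
    then show ?thesis using p_eq by (rule Lim_transform_eventually)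
  qed
  have e_lim: "e \<longlonglongrightarrow> 0"
  proof -
    obtain c where "\<forall>\<^sub>F n in sequentially. norm (e n) \<le> c * norm (\<eta> (q n))"
      using e_rate unfolding e_def by (auto elim: landau_o.bigE)
    moreover have "(\<lambda>n. c * norm (\<eta> (q n))) \<longlonglongrightarrow> 0"
      using tendsto_mult[OF tendsto_const tendsto_norm[OF \<eta>q], of c] by simp
    ultimately show ?thesis by (rule Lim_null_comparison)
  qed
  have rate': "(\<lambda>n. real (q n) * \<delta> n powr (1/3)) \<in> o(p)"
    using rate landau_o.small.cong[OF p_eq] unfolding \<delta>_def by simp
  have \<delta>0: "\<delta> n \<ge> 0" for n by (simp add: \<delta>_def)
  have \<delta>_ge: "\<forall>\<^sub>F n in sequentially. 1 / sqrt (real n) \<le> \<delta> n"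
    using k1
  proof eventually_elim
    case (elim n)
    have "1 \<le> real (k n) powr (3 * real CARD('d) / 2)" using elim by (intro ge_one_powr_ge_zero) auto
    then have "1 / sqrt (real n) \<le> real (k n) powr (3 * real CARD('d) / 2) / sqrt (real n)"
      by (intro divide_right_mono) auto
    then show ?case unfolding \<delta>_def using elim by (simp add: add_increasing2)
  qed
  note rates = sieve_rate_consequences[OF rate' p_pos p_lim q1 \<delta>0 \<delta>_ge]

  have G_eq: "(norm_w M X W (\<lambda>x. sieve_fun \<phi> (q n) b x - g0 x))\<^sup>2 = G n b" for n b
    unfolding G_def by (rule norm_w_sieve_eq[OF Y_eq eps g0m])
  have G_lower: "C1 * (p n * (\<Sum>i=1..q n. (b i - bstar i)\<^sup>2)) \<le> G n b" if q: "q n \<ge> 1" for n b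
  proof -
    have "C1 * (p n * (\<Sum>i=1..q n. (b i - bstar i)\<^sup>2))
        \<le> C1 * (\<Sum>i. vphi ((\<eta> (Suc i))\<^sup>2) * \<bar>inner_X M X (\<lambda>x. sieve_fun \<phi> (q n) b x - g0 x) (\<phi> (Suc i))\<bar>\<^sup>2)"
      using L2.source_condition_bounds(1)[OF g0 q proj \<eta>(1,2) vphi(1,2), of b] q C1_pos
      by (intro mult_left_mono) (simp_all add: p_def)
    also have "\<dots> \<le> G n b" unfolding G_eq[symmetric] by (rule C1[OF L2.sieve_fun_L2])
    finally show ?thesis .
  qed
  have G_upper: "G n bstar \<le> C2 * (p n * (e n)\<^sup>2)" if q: "q n \<ge> 1" for n
  proof -
    have "G n bstar \<le> C2 * (\<Sum>i. vphi ((\<eta> (Suc i))\<^sup>2) * \<bar>inner_X M X (\<lambda>x. g0 x - sieve_fun \<phi> (q n) bstar x) (\<phi> (Suc i))\<bar>\<^sup>2)"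
      unfolding G_eq[symmetric] by (rule C2)
    also have "\<dots> \<le> C2 * (p n * (e n)\<^sup>2)"
      using L2.source_condition_bounds(2)[OF g0 q proj \<eta>(1,2) vphi(1,2)] q C2_pos
      by (intro mult_left_mono) (simp_all add: p_def e_def)
    finally show ?thesis .
  qed
  have Bs: "(\<Sum>i=1..m. (bstar i)\<^sup>2) \<le> Bs" for m
  proof -
    have "(\<Sum>i=1..m. (bstar i)\<^sup>2) = (\<Sum>i<m. (bstar (Suc i))\<^sup>2)"
      by (simp add: sum.atLeast1_atMost_eq)
    also have "\<dots> \<le> Bs" unfolding Bs_def by (rule sum_le_suminf[OF bsum]) auto
    finally show ?thesis .
  qed
  have Bs0: "Bs \<ge> 0" using Bs[of 0] by simp

  show ?thesis
  proof (intro allI impI)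
    fix \<epsilon> :: real assume \<epsilon>: "\<epsilon> > 0"
    define Z where "Z = (\<lambda>n. posterior_prob Ys Xs Ws \<phi> (normal_prior \<sigma> (q n)) n (k n) (q n)
             (\<lambda>g. norm_s M X (\<lambda>x. g x - g0 x) > \<epsilon>))"
    have Z_meas: "Z n \<in> borel_measurable M" for n
      unfolding Z_def
    proof (rule posterior_prob_measurable)
      show "{b \<in> space (coef_lebesgue (q n)). \<epsilon> < norm_s M X (\<lambda>x. sieve_fun \<phi> (q n) b x - g0 x)} \<in> sets (coef_lebesgue (q n))"
        using norm_s_sieve_measurable[of "q n" \<phi> X g0, OF \<phi>_meas X_meas g0m] by measurable
    qed (use N1_measurable[OF \<open>prob_space M\<close> N1] in \<open>auto intro: \<phi>_meas normal_prior_measurable\<close>)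
    have Z0: "Z n \<omega> \<ge> 0" for n \<omega> by (simp add: Z_def posterior_prob_def)

    define \<tau> where "\<tau> = min (C1 / 2 / (4 * (1 + 2 * Bs) / \<epsilon>\<^sup>2 + 2)) (C1 * \<epsilon>\<^sup>2 / 48 / (3 + 2 * Bs))"
    have m_pos: "4 * (1 + 2 * Bs) / \<epsilon>\<^sup>2 + 2 > 0" "3 + 2 * Bs > 0"
      using Bs0 by (auto intro!: add_nonneg_pos)
    have \<tau>_pos: "\<tau> > 0"
      unfolding \<tau>_def min_less_iff_conj by (intro conjI divide_pos_pos m_pos) (use C1_pos \<epsilon> in auto)
    have "\<tau> \<le> C1 / 2 / (4 * (1 + 2 * Bs) / \<epsilon>\<^sup>2 + 2)" "\<tau> \<le> C1 * \<epsilon>\<^sup>2 / 48 / (3 + 2 * Bs)"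
      unfolding \<tau>_def by (rule min.cobounded1, rule min.cobounded2)
    then have \<tau>_small: "(4 * (1 + 2 * Bs) / \<epsilon>\<^sup>2 + 2) * \<tau> \<le> C1 / 2" "(3 + 2 * Bs) * \<tau> \<le> C1 * \<epsilon>\<^sup>2 / 48"
      unfolding pos_le_divide_eq[OF m_pos(1)] pos_le_divide_eq[OF m_pos(2)] by (simp_all only: mult.commute)
    define c where "c = \<tau> / (4 * (H + 1)\<^sup>2)"
    have H1: "(H + 1)\<^sup>2 > 0" using H_nonneg by simp
    have c_pos: "c > 0" using \<tau>_pos H1 by (simp add: c_def)
    \<comment> \<open>With this threshold the stochastic error in \<open>posterior_prob_le\<close> is exactly half of the budget \<open>\<tau> p\<close>.\<close>
    define S where "S = (\<lambda>n. c * p n / (real (q n) + 1))"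
    have S_pos: "S n > 0" for n using c_pos p_pos by (simp add: S_def)
    define \<kappa> where "\<kappa> = normal_density 0 \<sigma> (sqrt Bs + 1)"
    have \<kappa>: "\<kappa> > 0" using sigma_pos by (simp add: \<kappa>_def normal_density_pos)
    define R where "R = (\<lambda>n. exp (- (real n * (C1 * \<epsilon>\<^sup>2 / 32 * p n))) / (2 * (p n / real (q n)) * \<kappa>) ^ q n)"
    have R_lim: "R \<longlonglongrightarrow> 0"
      unfolding R_def by (rule contraction_factor_tendsto_0[OF _ \<kappa> p_pos p_lim q1 rates(3)]) (use C1_pos \<epsilon> in simp)

    have small: "\<forall>\<^sub>F n in sequentially. f n \<le> a" if "f \<longlonglongrightarrow> 0" "a > 0" for f :: "nat \<Rightarrow> real" and a
      using order_tendstoD(2)[OF that] by (rule eventually_mono) simp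
    have e2: "(\<lambda>n. u * (e n)\<^sup>2) \<longlonglongrightarrow> 0" for u
      using tendsto_mult[OF tendsto_const tendsto_power[OF e_lim, of 2], of u] by simp
    have pu: "(\<lambda>n. u * p n) \<longlonglongrightarrow> 0" for u
      using tendsto_mult[OF tendsto_const p_lim, of u] by simp
    have qd: "(\<lambda>n. u * ((real (q n))\<^sup>2 * \<delta> n / p n)) \<longlonglongrightarrow> 0" for u
      using tendsto_mult[OF tendsto_const rates(1), of u] by simp
    define dC where "dC = 2 * (C * real CARD('d))\<^sup>2"

    have pos_\<epsilon>: "\<epsilon>\<^sup>2 > 0" "C1 * \<epsilon>\<^sup>2 / 48 > 0" using \<epsilon> C1_pos by auto

    have bound: "\<forall>\<^sub>F n in sequentially. \<forall>\<omega>. cell_dev Ys Xs Ws n (k n) (q n) \<omega> \<le> S n \<longrightarrow> Z n \<omega> \<le> R n"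
      using q1 k1 K(2) small[OF p_lim zero_less_one]
        small[OF pu[of c], of "1/2", simplified] small[OF rates(2) zero_less_one]
        small[OF qd[of dC] half_gt_zero[OF \<tau>_pos]] small[OF e2[of 4] pos_\<epsilon>(1)]
        small[OF e2[of "2 * C2"] pos_\<epsilon>(2)] small[OF pu[of "2 * H\<^sup>2"] pos_\<epsilon>(2)]
    proof eventually_elim
      case (elim n)
      have qn: "q n \<ge> 1" and kn: "k n \<ge> 1" and pn: "p n \<le> 1" and \<delta>n: "\<delta> n \<le> 1" using elim by auto
      have pos: "cell_prob (k n) j > 0" if "j \<in> cell_indices (k n)" for j
      proof -
        have "0 < 1 / real (k n) ^ CARD('d)" using kn by simp
        also have "\<dots> \<le> K * cell_prob (k n) j" using elim(3) that by blast
        finally show ?thesis using K(1) by (simp add: zero_less_mult_iff)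
      qed
      have S_half: "S n \<le> 1 / 2"
      proof -
        have "S n \<le> c * p n / 1" unfolding S_def using c_pos p_pos[of n] by (intro divide_left_mono) auto
        then show ?thesis using elim(5) by simp
      qed
      have approx: "(real (q n) + 1) * (2 * (H + 1)\<^sup>2 * S n + (C * real CARD('d) / real (k n))\<^sup>2) \<le> \<tau> * p n"
      proof -
        have "(real (q n) + 1) * (2 * (H + 1)\<^sup>2 * S n) = 2 * (H + 1)\<^sup>2 * (c * p n)"
          by (simp add: S_def)
        also have "\<dots> = \<tau> / 2 * p n" using H1 by (simp add: c_def)
        finally have 1: "(real (q n) + 1) * (2 * (H + 1)\<^sup>2 * S n) = \<tau> / 2 * p n" .
        have k\<delta>: "1 / real (k n) \<le> \<delta> n" by (simp add: \<delta>_def)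
        have "(1 / real (k n))\<^sup>2 \<le> \<delta> n * 1"
          unfolding power2_eq_square using k\<delta> \<delta>n \<delta>0[of n] by (intro mult_mono) auto
        moreover have "real (q n) + 1 \<le> 2 * (real (q n))\<^sup>2"
        proof -
          have "real (q n) * 1 \<le> real (q n) * real (q n)" using qn by (intro mult_left_mono) auto
          moreover have "1 \<le> real (q n)" using qn by simp
          ultimately show ?thesis unfolding power2_eq_square by linarith
        qed
        ultimately have "(real (q n) + 1) * (1 / real (k n))\<^sup>2 \<le> 2 * (real (q n))\<^sup>2 * \<delta> n"
          using \<delta>0[of n] by (intro mult_mono) auto
        then have "(C * real CARD('d))\<^sup>2 * ((real (q n) + 1) * (1 / real (k n))\<^sup>2) \<le> (C * real CARD('d))\<^sup>2 * (2 * (real (q n))\<^sup>2 * \<delta> n)"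
          by (rule mult_left_mono) simp
        also have "\<dots> = dC * ((real (q n))\<^sup>2 * \<delta> n / p n) * p n" using p_pos[of n] by (simp add: dC_def)
        also have "\<dots> \<le> \<tau> / 2 * p n" using elim(7) \<tau>_pos p_pos[of n] by (intro mult_right_mono) auto
        finally have 2: "(real (q n) + 1) * (C * real CARD('d) / real (k n))\<^sup>2 \<le> \<tau> / 2 * p n"
          by (simp add: power_divide mult_ac)
        show ?thesis using 1 2 by (simp add: distrib_left)
      qed
      show ?case
      proof (intro allI impI)
        fix \<omega> assume dev: "cell_dev Ys Xs Ws n (k n) (q n) \<omega> \<le> S n"
        show "Z n \<omega> \<le> R n"
          unfolding Z_def R_def \<kappa>_def
          by (rule posterior_prob_le[
                OF basis' g0 qn kn pos dev S_half approx G_lower[OF qn, unfolded G_def]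
                G_upper[OF qn, unfolded G_def e_def] Bs C1_pos p_pos pn \<epsilon> sigma_pos])
            (use elim \<tau>_small \<epsilon> C1_pos \<tau>_pos in \<open>auto simp: e_def\<close>)
      qed
    qed

    \<comment> \<open>The factor \<open>q + 2\<close> comes from the number of deviations per cell and \<open>q + 1\<close> from the threshold.\<close>
    have dev_prob: "\<forall>\<^sub>F n in sequentially. prob {\<omega> \<in> space M. cell_dev Ys Xs Ws n (k n) (q n) \<omega> \<ge> S n}
        \<le> (6 * sqrt (C * K) / c) * ((real (q n))\<^sup>2 * \<delta> n / p n)"
      using q1 k1 K(2) eventually_ge_at_top[of 1]
    proof eventually_elim
      case (elim n)
      have K': "\<And>j. j \<in> cell_indices (k n) \<Longrightarrow> 1 / real (k n) ^ CARD('d) \<le> K * cell_prob (k n) j"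
        using elim(3) by blast
      note dev = expectation_cell_dev_le[OF N1 elim(4) elim(2) K(1) K', of "q n"]
      have "prob {\<omega> \<in> space M. cell_dev Ys Xs Ws n (k n) (q n) \<omega> \<ge> S n} \<le> expectation (cell_dev Ys Xs Ws n (k n) (q n)) / S n"
        by (rule integral_Markov_inequality_measure[OF dev(1), of "{}"])
          (auto simp: S_pos cell_dev_def cell_prob_nonneg intro!: sum_nonneg add_nonneg_nonneg)
      also have "\<dots> \<le> (real (q n) + 2) * sqrt (C * K) * \<delta> n / S n"
      proof (rule divide_right_mono)
        have "real (k n) powr (3 * real CARD('d) / 2) / sqrt (real n) \<le> \<delta> n" by (simp add: \<delta>_def)
        then have "(real (q n) + 2) * sqrt (C * K) * (real (k n) powr (3 * real CARD('d) / 2) / sqrt (real n))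
            \<le> (real (q n) + 2) * sqrt (C * K) * \<delta> n"
          using C_ge_1 K(1) by (intro mult_left_mono) auto
        then show "expectation (cell_dev Ys Xs Ws n (k n) (q n)) \<le> (real (q n) + 2) * sqrt (C * K) * \<delta> n"
          using dev(2) by linarith
      qed (use S_pos[of n] in simp)
      also have "\<dots> = (real (q n) + 2) * (real (q n) + 1) * (sqrt (C * K) * \<delta> n / (c * p n))"
        by (simp add: S_def)
      also have "\<dots> \<le> 6 * (real (q n))\<^sup>2 * (sqrt (C * K) * \<delta> n / (c * p n))"
      proof (rule mult_right_mono)
        have "(real (q n) + 2) * (real (q n) + 1) \<le> (3 * real (q n)) * (2 * real (q n))"
          using elim(1) by (intro mult_mono) auto
        then show "(real (q n) + 2) * (real (q n) + 1) \<le> 6 * (real (q n))\<^sup>2" by (simp add: power2_eq_square)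
        show "0 \<le> sqrt (C * K) * \<delta> n / (c * p n)"
          using c_pos p_pos[of n] \<delta>0[of n] C_ge_1 K(1) by (intro divide_nonneg_nonneg mult_nonneg_nonneg) auto
      qed
      also have "\<dots> = (6 * sqrt (C * K) / c) * ((real (q n))\<^sup>2 * \<delta> n / p n)" by (simp add: mult_ac)
      finally show ?case .
    qed

    have "(\<lambda>n. prob {\<omega> \<in> space M. \<bar>Z n \<omega>\<bar> > d}) \<longlonglongrightarrow> 0" if d: "d > 0" for d
    proof (rule tendsto_sandwich[of "\<lambda>_. 0"])
      show "\<forall>\<^sub>F n in sequentially. prob {\<omega> \<in> space M. \<bar>Z n \<omega>\<bar> > d} \<le> (6 * sqrt (C * K) / c) * ((real (q n))\<^sup>2 * \<delta> n / p n)"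
        using bound dev_prob small[OF R_lim d] q1 k1 K(2) eventually_ge_at_top[of 1]
      proof eventually_elim
        case (elim n)
        have K': "\<And>j. j \<in> cell_indices (k n) \<Longrightarrow> 1 / real (k n) ^ CARD('d) \<le> K * cell_prob (k n) j"
          using elim(6) by blast
        have [measurable]: "cell_dev Ys Xs Ws n (k n) (q n) \<in> borel_measurable M"
          using expectation_cell_dev_le(1)[OF N1 elim(7) elim(5) K(1) K'] by (rule borel_measurable_integrable)
        have "{\<omega> \<in> space M. \<bar>Z n \<omega>\<bar> > d} \<subseteq> {\<omega> \<in> space M. cell_dev Ys Xs Ws n (k n) (q n) \<omega> \<ge> S n}"
        proof (intro subsetI CollectI conjI)
          fix \<omega> assume \<omega>: "\<omega> \<in> {\<omega> \<in> space M. \<bar>Z n \<omega>\<bar> > d}"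
          then show "\<omega> \<in> space M" by simp
          show "S n \<le> cell_dev Ys Xs Ws n (k n) (q n) \<omega>"
          proof (rule ccontr)
            assume "\<not> S n \<le> cell_dev Ys Xs Ws n (k n) (q n) \<omega>"
            then have "Z n \<omega> \<le> R n" using elim(1) by simp
            then show False using \<omega> Z0[of n \<omega>] elim(3) by simp
          qed
        qed
        then have "prob {\<omega> \<in> space M. \<bar>Z n \<omega>\<bar> > d} \<le> prob {\<omega> \<in> space M. cell_dev Ys Xs Ws n (k n) (q n) \<omega> \<ge> S n}"
          by (rule finite_measure_mono) measurable
        then show ?case using elim(2) by linarith
      qed
      show "(\<lambda>n. (6 * sqrt (C * K) / c) * ((real (q n))\<^sup>2 * \<delta> n / p n)) \<longlonglongrightarrow> 0"
        by (rule qd)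
    qed auto
    then have "little_o_p_one M Z" using Z_meas by (auto simp: little_o_p_one_def)
    then show "little_o_p_one M (\<lambda>n. posterior_prob Ys Xs Ws \<phi> (normal_prior \<sigma> (q n)) n (k n) (q n)
             (\<lambda>g. norm_s M X (\<lambda>x. g x - g0 x) > \<epsilon>))"
      unfolding Z_def .
  qed
qed

end
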